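(* Let $X$ be a geometric distance-regular graph of diameter $d\geq 2$ with smallest eigenvalue $-m$, vertex degree $k$, and second largest eigenvalue $\theta_1$. Suppose that $\mu\geq 2$ and $\theta_1+1>(1-\varepsilon^* )b_1$, where $\varepsilon^*=\frac{-2-\vartheta_1}{-1-\vartheta_1}\approx 0.0065$ is the absolute constant described in the context. Moreover, assume that $k\geq \max(m^3,29)$ and that the neighborhood graph $X(v)$ is connected for some vertex $v$ of $X$. Then $X$ is a Johnson graph $J(s,d)$ with $s=(k/d)+d\geq 2d+1$.
   Context: A connected graph $X$ of diameter $d$ is distance-regular if for each $0\le i\le d$ there are constants $a_i,b_i,c_i$ such that for any vertices $v,w$ with $\mathrm{dist}(v,w)=i$, $w$ has exactly $c_i$ neighbors at distance $i-1$ from $v$, $a_i$ at distance $i$, and $b_i$ at distance $i+1$. The degree is $k=b_0$, and $\lambda=a_1$, $\mu=c_2$. Eigenvalues are those of the adjacency matrix; $X$ has $d+1$ distinct eigenvalues $k=\theta_0>\theta_1>\dots>\theta_d$. The neighborhood graph $X(v)$ is the subgraph induced on the neighbors of $v$. Every clique $C$ satisfies $|C|\le 1-k/\theta_d$; a clique of size $1-k/\theta_d$ is a Delsarte clique. $X$ is geometric if there is a collection of Delsarte cliques such that every edge lies in exactly one of them. $\vartheta_1$ denotes the supremum of the smallest eigenvalues of graphs with minimum valency $1$ and smallest eigenvalue $<-2$; it equals the smallest root $\approx -2.006594$ of $\theta^2(\theta^2-1)^2(\theta^2-3)(\theta^2-4)=1$. The Johnson graph $J(s,d)$ ($s\ge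 2d$) has as vertices the $d$-subsets of an $s$-set, two being adjacent iff their intersection has size $d-1$. *)

theory Defs
  imports
    "Graph_Theory.Graph_Theory"
    "Jordan_Normal_Form.Char_Poly"
begin

text \<open>
  Finite simple graphs are symmetric loop-free digraphs without parallel arcs
  (locale \<^locale>\<open>pair_graph\<close>); an edge \<open>{u, v}\<close> is the pair of arcs
  \<open>(u, v)\<close>, \<open>(v, u)\<close>.
\<close>

definition neighbors :: "'a pair_pre_digraph \<Rightarrow> 'a \<Rightarrow> 'a set" where
  "neighbors G v = {w. (v, w) \<in> parcs G}"

definition neighborhood_graph :: "'a pair_pre_digraph \<Rightarrow> 'a \<Rightarrow> ('a, 'a \<times> 'a) pre_digraph" where
  "neighborhood_graph G v = with_proj G \<restriction> neighbors G v"

text \<open>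
  Graph distance is the shortest-path distance for unit arc weights; it is infinite between
  different components, so \<open>diameter G = ereal (real d)\<close> asserts that the diameter is finite.
\<close>

definition gdist :: "'a pair_pre_digraph \<Rightarrow> 'a \<Rightarrow> 'a \<Rightarrow> ereal" where
  "gdist G u v = wf_digraph.\<mu> (with_proj G) (\<lambda>_. 1) u v"

definition diameter :: "'a pair_pre_digraph \<Rightarrow> ereal" where
  "diameter G = (SUP u\<in>pverts G. SUP v\<in>pverts G. gdist G u v)"

text \<open>
  The intersection numbers \<open>a i\<close>, \<open>b i\<close>, \<open>c i\<close> are constrained (and then uniquely
  determined) only for \<open>i \<le> d\<close>. ``Distance \<open>i - 1\<close>'' is written additively to avoid truncated
  subtraction, so that \<open>c 0 = 0\<close>.
\<close>

definition distance_regular ::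
  "'a pair_pre_digraph \<Rightarrow> nat \<Rightarrow> (nat \<Rightarrow> nat) \<Rightarrow> (nat \<Rightarrow> nat) \<Rightarrow> (nat \<Rightarrow> nat) \<Rightarrow> bool" where
  "distance_regular G d a b c \<longleftrightarrow>
     pair_graph G \<and> connected (with_proj G) \<and> diameter G = ereal (real d) \<and>
     (\<forall>i\<le>d. \<forall>v\<in>pverts G. \<forall>w\<in>pverts G. gdist G v w = ereal (real i) \<longrightarrow>
        card {u \<in> neighbors G w. gdist G v u + 1 = ereal (real i)} = c i \<and>
        card {u \<in> neighbors G w. gdist G v u = ereal (real i)} = a i \<and>
        card {u \<in> neighbors G w. gdist G v u = ereal (real (i + 1))} = b i)"

text \<open>
  The adjacency matrix is taken with respect to an enumeration of the vertices. Two enumerations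
  give permutation-similar matrices, so the spectrum does not depend on the choice; as the matrices
  are symmetric, all eigenvalues are real.
\<close>

definition adj_matrix :: "'a pair_pre_digraph \<Rightarrow> 'a list \<Rightarrow> real mat" where
  "adj_matrix G vs =
     mat (length vs) (length vs) (\<lambda>(i, j). if (vs ! i, vs ! j) \<in> parcs G then 1 else 0)"

definition graph_spectrum :: "'a pair_pre_digraph \<Rightarrow> real set" where
  "graph_spectrum G =
     {\<theta>. \<exists>vs. distinct vs \<and> set vs = pverts G \<and> eigenvalue (adj_matrix G vs) \<theta>}"

definition smallest_eigenvalue :: "'a pair_pre_digraph \<Rightarrow> real" where
  "smallest_eigenvalue G = Min (graph_spectrum G)"

text \<open>The second largest \<^emph>\<open>distinct\<close> eigenvalue, irrespective of multiplicities.\<close>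

definition second_largest_eigenvalue :: "'a pair_pre_digraph \<Rightarrow> real" where
  "second_largest_eigenvalue G = Max (graph_spectrum G - {Max (graph_spectrum G)})"

definition clique :: "'a pair_pre_digraph \<Rightarrow> 'a set \<Rightarrow> bool" where
  "clique G C \<longleftrightarrow> C \<subseteq> pverts G \<and> (\<forall>u\<in>C. \<forall>v\<in>C. u \<noteq> v \<longrightarrow> (u, v) \<in> parcs G)"

text \<open>In the next two definitions, \<open>k\<close> is the valency of the regular graph \<open>G\<close>.\<close>

definition delsarte_clique :: "'a pair_pre_digraph \<Rightarrow> nat \<Rightarrow> 'a set \<Rightarrow> bool" where
  "delsarte_clique G k C \<longleftrightarrow>
     clique G C \<and> real (card C) = 1 - real k / smallest_eigenvalue G"

definition geometric :: "'a pair_pre_digraph \<Rightarrow> nat \<Rightarrow> bool" where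
  "geometric G k \<longleftrightarrow>
     (\<exists>\<C>. (\<forall>C\<in>\<C>. delsarte_clique G k C) \<and>
          (\<forall>u v. (u, v) \<in> parcs G \<longrightarrow> (\<exists>!C. C \<in> \<C> \<and> u \<in> C \<and> v \<in> C)))"

definition min_valency_one :: "'a pair_pre_digraph \<Rightarrow> bool" where
  "min_valency_one G \<longleftrightarrow>
     (\<forall>v\<in>pverts G. 1 \<le> out_degree (with_proj G) v) \<and>
     (\<exists>v\<in>pverts G. out_degree (with_proj G) v = 1)"

text \<open>
  Every finite graph is isomorphic to one with vertices in \<^typ>\<open>nat\<close>, so ranging over
  these covers all graphs.
\<close>

definition vartheta1 :: real where
  "vartheta1 = Sup {smallest_eigenvalue H | H :: nat pair_pre_digraph.
     pair_graph H \<and> min_valency_one H \<and> smallest_eigenvalue H < - 2}"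

definition eps_star :: real where
  "eps_star = (- 2 - vartheta1) / (- 1 - vartheta1)"

definition johnson_graph :: "nat \<Rightarrow> nat \<Rightarrow> nat set pair_pre_digraph" where
  "johnson_graph s d =
     (let V = {A. A \<subseteq> {..<s} \<and> card A = d}
      in \<lparr>pverts = V, parcs = {(A, B). A \<in> V \<and> B \<in> V \<and> card (A \<inter> B) + 1 = d}\<rparr>)"

end

theory Submission
  imports Defs
begin

text \<open>
  The cosine sequence of any eigenvalue gives a positive semidefinite matrix on the vertices. For the
  smallest eigenvalue \<open>- m\<close>, the indicator of a Delsarte clique is a null vector, so a vertex at
  distance 1 from a clique has a constant number of neighbors in it, at most \<open>m\<close>. For \<open>\<theta>1\<close>, zero-sum
  vectors on sets of diameter 2 have adjacency form at least \<open>- 9 / 4\<close> times their squared norm. Since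
  the cliques have at least \<open>m\<^sup>2 + 1\<close> vertices, three explicit test vectors then show that every
  neighborhood is a grid and that non-adjacent vertices have at most four common neighbors.

  Labelling the grids by swaps gives local charts modelled on a Johnson graph. They are compatible
  around triangles, and Johnson graphs are simply connected modulo triangles, so the charts glue to a
  covering by a Johnson graph. A nontrivial deck transformation would come from a permutation of
  the ground set. Such a permutation moves some set to distance 1 or 2, which is impossible
  for a covering that is injective on stars.
\<close>

section \<open>Adjacency in Johnson graphs\<close>

text \<open>The hypothesis on \<open>\<theta>1\<close> says exactly that Terwilliger's bound
  \<open>- 1 - b 1 / (\<theta>1 + 1)\<close> exceeds \<open>vartheta1\<close>, which is at least
  \<open>- 9 / 4\<close>. That value suffices because of the path on three vertices: subtracting
  line averages lowers its smallest eigenvalue \<open>- sqrt 2\<close> by about 1, and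
  \<open>- 1 - sqrt 2\<close> lies below \<open>- 9 / 4\<close> with a margin that absorbs errors of
  order \<open>m / n\<close>. This is where \<open>n \<ge> m ^ 2\<close>, that is, the bound
  \<open>m ^ 3\<close> on the degree, is used.

  Having grids as neighborhoods leaves two obstructions: charts may acquire holonomy around
  triangles, and the covering may be a proper quotient. The bound 4 on common neighbors removes the
  first, since two antipodes of an octahedron already have four. For the second, charts record lines
  and not only adjacency. This excludes the transposition of a square grid, so two charts with the
  same image differ by a permutation of the ground set and never by a complementation.\<close>

definition swap :: "'s set \<Rightarrow> 's \<Rightarrow> 's \<Rightarrow> 's set" where
  "swap A e f = insert f (A - {e})"

definition jadj :: "'s set \<Rightarrow> 's set \<Rightarrow> bool" where
  "jadj A B \<longleftrightarrow> (\<exists>e f. A - B = {e} \<and> B - A = {f})"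

lemma jadj_sym: "jadj A B \<Longrightarrow> jadj B A"
  unfolding jadj_def by blast

lemma jadj_commute: "jadj A B \<longleftrightarrow> jadj B A"
  using jadj_sym by blast

lemma jadj_irrefl [simp]: "\<not> jadj A A"
  by (simp add: jadj_def)

lemma swap_back: "e \<in> A \<Longrightarrow> f \<notin> A \<Longrightarrow> swap (swap A e f) f e = A"
  by (auto simp: swap_def)

lemma swap_minus:
  assumes "e \<in> A" "f \<notin> A"
  shows "A - swap A e f = {e}" "swap A e f - A = {f}"
  using assms by (auto simp: swap_def)

lemma jadj_swap [simp]: "e \<in> A \<Longrightarrow> f \<notin> A \<Longrightarrow> jadj A (swap A e f)"
  by (simp add: jadj_def swap_minus)

lemma jadj_swap' [simp]: "e \<in> A \<Longrightarrow> f \<notin> A \<Longrightarrow> jadj (swap A e f) A"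
  by (simp add: jadj_def swap_minus)

lemma jadjE:
  assumes "jadj A B"
  obtains e f where "e \<in> A" "f \<notin> A" "B = swap A e f"
proof -
  obtain e f where "A - B = {e}" "B - A = {f}" using assms unfolding jadj_def by blast
  then show thesis by (intro that[of e f]) (unfold swap_def, blast+)
qed

lemma swap_eq_iff:
  assumes "e \<in> A" "e' \<in> A" "f \<notin> A" "f' \<notin> A"
  shows "swap A e f = swap A e' f' \<longleftrightarrow> e = e' \<and> f = f'"
  using swap_minus[OF assms(1,3)] swap_minus[OF assms(2,4)] by auto

text \<open>The pair \<open>(e, f)\<close> serves as coordinates for the neighbors of
  \<open>A\<close>, and adjacency means that exactly one coordinate agrees: a grid. Later
  \<open>e\<close> labels a line and \<open>f\<close> a position on it.\<close>

lemma jadj_swap_iff: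
  assumes "e \<in> A" "e' \<in> A" "f \<notin> A" "f' \<notin> A"
  shows "jadj (swap A e f) (swap A e' f') \<longleftrightarrow> (e = e') \<noteq> (f = f')"
proof -
  consider "e = e'" "f = f'" | "e = e'" "f \<noteq> f'" | "e \<noteq> e'" "f = f'" | "e \<noteq> e'" "f \<noteq> f'"
    by blast
  then show ?thesis
  proof cases
    case 2
    then have "swap A e f - swap A e' f' = {f}" "swap A e' f' - swap A e f = {f'}"
      using assms by (auto simp: swap_def)
    with 2 show ?thesis by (auto simp: jadj_def)
  next
    case 3
    then have "swap A e f - swap A e' f' = {e'}" "swap A e' f' - swap A e f = {e}"
      using assms by (auto simp: swap_def)
    with 3 show ?thesis by (auto simp: jadj_def)
  next
    case 4
    then have "e' \<in> swap A e f - swap A e' f'" "f \<in> swap A e f - swap A e' f'" "e' \<noteq> f"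
      using assms by (auto simp: swap_def)
    then have "\<not> jadj (swap A e f) (swap A e' f')"
      by (metis jadj_def singletonD)
    with 4 show ?thesis by auto
  qed auto
qed

lemma swap_swap:
  assumes "e \<in> A" "f \<notin> A"
  shows "g \<noteq> e \<Longrightarrow> g \<in> A \<Longrightarrow> swap (swap A e f) g e = swap A g f"
    and "g \<noteq> f \<Longrightarrow> g \<notin> A \<Longrightarrow> swap (swap A e f) f g = swap A e g"
  using assms by (auto simp: swap_def)

text \<open>In the grid at \<open>B\<close>, the sets \<open>A\<close> and \<open>F\<close> are
  opposite corners of a rectangle, and \<open>C\<close>, \<open>D\<close> are the other corners. The
  inclusions keep them inside any ground set that contains the given sets.\<close>

lemma jadj_quad:
  assumes "jadj B A" "jadj B F" "A \<noteq> F" "\<not> jadj A F"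
  obtains C D where "jadj B C" "jadj B D" "jadj A C" "jadj A D" "jadj F C" "jadj F D"
    "C \<noteq> D" "\<not> jadj C D" "C \<subseteq> A \<union> B \<union> F" "D \<subseteq> A \<union> B \<union> F"
proof -
  obtain e f where ef: "e \<in> B" "f \<notin> B" and A: "A = swap B e f"
    using assms(1) by (rule jadjE)
  obtain e' f' where ef': "e' \<in> B" "f' \<notin> B" and F: "F = swap B e' f'"
    using assms(2) by (rule jadjE)
  have ne: "e \<noteq> e'" "f \<noteq> f'"
    using assms(3,4) ef ef' unfolding A F by (simp_all add: jadj_swap_iff swap_eq_iff)
  show thesis
  proof (rule that[of "swap B e f'" "swap B e' f"])
    show "swap B e f' \<subseteq> A \<union> B \<union> F" "swap B e' f \<subseteq> A \<union> B \<union> F"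
      by (auto simp: A F swap_def)
  qed (use ef ef' ne in \<open>simp_all add: A F jadj_swap_iff swap_eq_iff\<close>)
qed

text \<open>Sets at distance 2 share all but two elements each. Adding to the common part any two of
  the four remaining elements gives a copy of the Johnson graph J(4,2), an octahedron, in which
  \<open>D\<close> and \<open>G\<close> are the antipodes of \<open>C\<close> and
  \<open>B\<close>.\<close>

lemma jadj_octahedron:
  assumes "jadj A B" "jadj A C" "jadj B C" "jadj B F" "jadj C F" "F \<noteq> A" "\<not> jadj A F"
  obtains D G where "jadj A D" "jadj A G" "jadj B D" "jadj F D" "\<not> jadj C D" "C \<noteq> D"
    "jadj C G" "jadj F G" "jadj D G" "\<not> jadj B G" "B \<noteq> G"
    "D \<subseteq> A \<union> B \<union> C \<union> F" "G \<subseteq> A \<union> B \<union> C \<union> F"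
proof -
  obtain e f where ef: "e \<in> A" "f \<notin> A" "B = swap A e f" using assms(1) by (rule jadjE)
  obtain p q where pq: "p \<in> B" "q \<notin> B" "F = swap B p q" using assms(4) by (rule jadjE)
  have "p \<noteq> f"
  proof
    assume "p = f"
    then have "F = swap A e q" using ef pq by (auto simp: swap_def)
    then have "F = A \<or> jadj A F" using ef pq by (cases "q = e") (auto simp: swap_def jadj_def)
    then show False using assms by auto
  qed
  moreover have "q \<noteq> e"
  proof
    assume "q = e"
    then have "F = swap A p f" using ef pq \<open>p \<noteq> f\<close> by (auto simp: swap_def)
    then show False using assms ef pq \<open>p \<noteq> f\<close> jadj_swap[of p A f] by (auto simp: swap_def)
  qed
  ultimately have pq': "p \<in> A" "p \<noteq> e" "q \<notin> A" "q \<noteq> f" using pq ef by (auto simp: swap_def)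
  have F: "F = insert q (insert f (A - {e,p}))" using pq ef pq' by (auto simp: swap_def)
  obtain x y where xy: "x \<in> A" "y \<notin> A" "C = swap A x y" using assms(2) by (rule jadjE)
  have xor: "(e = x) \<noteq> (f = y)" using assms(3) ef xy jadj_swap_iff by metis
  obtain u w where uw: "C - F = {u}" "F - C = {w}" using assms(5) jadj_def by metis
  \<comment> \<open>Seen from \<open>A\<close>, the set \<open>C\<close> shares with
    \<open>B\<close> either the element removed or the element added.\<close>
  show thesis
  proof (cases "e = x")
    case True
    with xor have "y \<noteq> f" by auto
    then have "f \<in> F - C" using F xy ef by (auto simp: swap_def)
    have "y = q"
    proof (rule ccontr)
      assume "y \<noteq> q"
      then have "q \<in> F - C" using F xy pq' by (auto simp: swap_def)
      with \<open>f \<in> F - C\<close> uw pq' show False by auto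
    qed
    have B: "B = swap A e f" and C: "C = swap A e q" using ef xy True \<open>y = q\<close> by auto
    have FD: "jadj F (swap A p f)" "jadj F (swap A p q)"
      using F pq' ef by (auto simp: jadj_def swap_def)
    show thesis
      by (rule that[of "swap A p f" "swap A p q"])
        (use FD pq' ef in \<open>simp_all add: B C jadj_swap_iff swap_eq_iff\<close>,
         simp_all add: swap_def F subset_iff)
  next
    case False
    with xor have "y = f" by auto
    then have "e \<in> C - F" using F xy ef False \<open>q \<noteq> e\<close> by (auto simp: swap_def)
    have "x = p"
    proof (rule ccontr)
      assume "x \<noteq> p"
      then have "p \<in> C - F" using F xy pq' ef by (auto simp: swap_def)
      with \<open>e \<in> C - F\<close> uw pq' show False by auto
    qed
    have B: "B = swap A e f" and C: "C = swap A p f" using ef xy \<open>y = f\<close> \<open>x = p\<close> by auto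
    have FD: "jadj F (swap A e q)" "jadj F (swap A p q)"
      using F pq' ef by (auto simp: jadj_def swap_def)
    show thesis
      by (rule that[of "swap A e q" "swap A p q"])
        (use FD pq' ef in \<open>simp_all add: B C jadj_swap_iff swap_eq_iff\<close>,
         simp_all add: swap_def F subset_iff)
  qed
qed

section \<open>Graphs that are locally grids\<close>

lemma card_2_unique:
  assumes "card X = 2" "a \<in> X" "b \<in> X" "c \<in> X" "a \<noteq> b" "a \<noteq> c" shows "b = c"
proof -
  obtain p q where "X = {p, q}" using assms(1) by (auto simp: card_2_iff)
  then show ?thesis using assms by auto
qed

lemma card_2_other:
  assumes "card X = 2" "a \<in> X" obtains b where "b \<in> X" "b \<noteq> a"
proof -
  obtain p q where "X = {p, q}" "p \<noteq> q" using assms(1) by (auto simp: card_2_iff)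
  then show ?thesis using assms that by (cases "a = p") auto
qed

text \<open>By \<open>line_two\<close>, adjacency between the traces of two lines through \<open>v\<close> on the neighborhood of
  \<open>v\<close> is a perfect matching; by \<open>row\<close>, these matchings compose. So every neighborhood is an \<open>m \<times> n\<close>
  grid.\<close>

locale local_grid =
  fixes V :: "'a set" and E :: "'a \<Rightarrow> 'a \<Rightarrow> bool" and \<L> :: "'a set set" and m n :: nat
  assumes finite_V: "finite V"
    and E_sym: "E x y \<Longrightarrow> E y x"
    and E_irrefl [simp]: "\<not> E x x"
    and E_V: "E x y \<Longrightarrow> x \<in> V"
    and line_V: "C \<in> \<L> \<Longrightarrow> C \<subseteq> V"
    and line_clique: "C \<in> \<L> \<Longrightarrow> x \<in> C \<Longrightarrow> y \<in> C \<Longrightarrow> x \<noteq> y \<Longrightarrow> E x y"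
    and line_card: "C \<in> \<L> \<Longrightarrow> card C = n + 1"
    and line_ex1: "E x y \<Longrightarrow> \<exists>!C. C \<in> \<L> \<and> x \<in> C \<and> y \<in> C"
    and lines_card: "x \<in> V \<Longrightarrow> card {C \<in> \<L>. x \<in> C} = m"
    and line_two: "C \<in> \<L> \<Longrightarrow> x \<notin> C \<Longrightarrow> y \<in> C \<Longrightarrow> E x y \<Longrightarrow> card {u \<in> C. E x u} = 2"
    and row: "E v x \<Longrightarrow> E v y \<Longrightarrow> E v z \<Longrightarrow> E x y \<Longrightarrow> E x z \<Longrightarrow>
      \<nexists>C. C \<in> \<L> \<and> v \<in> C \<and> x \<in> C \<and> y \<in> C \<Longrightarrow> \<nexists>C. C \<in> \<L> \<and> v \<in> C \<and> x \<in> C \<and> z \<in> C \<Longrightarrow>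
      \<nexists>C. C \<in> \<L> \<and> v \<in> C \<and> y \<in> C \<and> z \<in> C \<Longrightarrow> E y z"
begin

text \<open>On the neighbors of \<open>v\<close> this is an equivalence relation, whose classes are
  the lines through \<open>v\<close> without \<open>v\<close>.\<close>

definition coll :: "'a \<Rightarrow> 'a \<Rightarrow> 'a \<Rightarrow> bool" where
  "coll v x y \<longleftrightarrow> (\<exists>C\<in>\<L>. v \<in> C \<and> x \<in> C \<and> y \<in> C)"

lemma E_commute: "E x y \<longleftrightarrow> E y x"
  using E_sym by blast

lemma E_V2: "E x y \<Longrightarrow> y \<in> V"
  using E_sym E_V by blast

lemma E_neq: "E x y \<Longrightarrow> x \<noteq> y"
  by auto

lemma finite_nbr: "finite {y. E x y}"
  using finite_V E_V2 by (auto intro: finite_subset)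

lemma finite_line: "C \<in> \<L> \<Longrightarrow> finite C"
  using line_V finite_V finite_subset by blast

lemma line_ex:
  assumes "E x y" obtains C where "C \<in> \<L>" "x \<in> C" "y \<in> C"
  using ex1_implies_ex[OF line_ex1[OF assms]] by blast

lemma line_unique:
  assumes "E x y" "C \<in> \<L>" "K \<in> \<L>" "x \<in> C" "y \<in> C" "x \<in> K" "y \<in> K" shows "C = K"
  using line_ex1[OF assms(1)] assms(2-) by blast

lemma coll_refl: "E v x \<Longrightarrow> coll v x x"
  using line_ex[of v x] unfolding coll_def by blast

lemma coll_sym: "coll v x y \<Longrightarrow> coll v y x"
  unfolding coll_def by blast

lemma coll_swap: "coll v x y \<Longrightarrow> coll x v y"
  unfolding coll_def by blast

lemma coll_E: "coll v x y \<Longrightarrow> x \<noteq> y \<Longrightarrow> E x y"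
  unfolding coll_def using line_clique by blast

lemma coll_trans:
  assumes "E v y" "coll v x y" "coll v y z" shows "coll v x z"
proof -
  obtain C where C: "C \<in> \<L>" "v \<in> C" "x \<in> C" "y \<in> C" using assms(2) unfolding coll_def by blast
  obtain K where K: "K \<in> \<L>" "v \<in> K" "y \<in> K" "z \<in> K" using assms(3) unfolding coll_def by blast
  have "C = K" using line_unique[OF assms(1) C(1) K(1)] C K by blast
  then show ?thesis using C K unfolding coll_def by blast
qed

lemma row': "E v x \<Longrightarrow> E v y \<Longrightarrow> E v z \<Longrightarrow> E x y \<Longrightarrow> E x z \<Longrightarrow>
    \<not> coll v x y \<Longrightarrow> \<not> coll v x z \<Longrightarrow> \<not> coll v y z \<Longrightarrow> E y z"
  using row[of v x y z] unfolding coll_def by blast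

text \<open>By \<open>line_two\<close> a point off \<open>C\<close> has two neighbors there. One is
  \<open>v\<close>; the other, its mate, is the point matched to \<open>x\<close> in the grid at
  \<open>v\<close>.\<close>

lemma mate_ex:
  assumes "C \<in> \<L>" "v \<in> C" "E v x" "x \<notin> C"
  obtains w where "w \<in> C" "w \<noteq> v" "E x w"
proof -
  have "v \<in> {u \<in> C. E x u}" using assms E_sym by blast
  from card_2_other[OF line_two[OF assms(1,4,2) E_sym[OF assms(3)]] this] that
  show thesis by blast
qed

lemma mate_unique:
  assumes "C \<in> \<L>" "v \<in> C" "E v x" "x \<notin> C" "w \<in> C" "w \<noteq> v" "E x w" "w' \<in> C" "w' \<noteq> v" "E x w'"
  shows "w = w'"
  using card_2_unique[OF line_two[OF assms(1,4,2) E_sym[OF assms(3)]], of v w w'] assms E_sym[OF assms(3)]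
  by simp

lemma not_coll_line:
  assumes "C \<in> \<L>" "v \<in> C" "y \<in> C" "\<not> coll v x y" shows "x \<notin> C"
  using assms unfolding coll_def by blast

lemma mate_unique':
  assumes "E v x" "E v w" "E v w'" "coll v w w'" "\<not> coll v x w" "E x w" "E x w'"
  shows "w = w'"
proof -
  obtain C where C: "C \<in> \<L>" "v \<in> C" "w \<in> C" "w' \<in> C" using assms(4) unfolding coll_def by blast
  have "x \<notin> C" using not_coll_line[OF C(1-3) assms(5)] .
  then show ?thesis using mate_unique[OF C(1,2) assms(1)] C assms E_neq by blast
qed

text \<open>Otherwise \<open>v\<close> would be a point off a line with three neighbors on it,
  against \<open>line_two\<close>.\<close>

lemma three_on_line:
  assumes "coll x y z" "x \<noteq> y" "x \<noteq> z" "y \<noteq> z" "E v x" "E v y" "E v z"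
  shows "coll v x y"
proof -
  obtain C where C: "C \<in> \<L>" "x \<in> C" "y \<in> C" "z \<in> C" using assms(1) unfolding coll_def by blast
  have "v \<in> C"
  proof (rule ccontr)
    assume "v \<notin> C"
    from card_2_unique[OF line_two[OF C(1) this C(2) assms(5)], of x y z] C assms
    show False by auto
  qed
  with C show ?thesis unfolding coll_def by blast
qed

text \<open>The common neighbors are the remaining corners of a rectangle: the mate of
  \<open>y\<close> on the line of \<open>x\<close> and the mate of \<open>x\<close> on the line of
  \<open>y\<close>. A further one would lie on neither line, and \<open>row'\<close> would then make
  \<open>x\<close> and \<open>y\<close> adjacent.\<close>

lemma two_common:
  assumes "E v x" "E v y" "x \<noteq> y" "\<not> E x y"
  shows "card {w. E v w \<and> E x w \<and> E y w} = 2"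
proof -
  have ncxy: "\<not> coll v x y" using assms coll_E by blast
  obtain C where C: "C \<in> \<L>" "v \<in> C" "x \<in> C" using line_ex[OF assms(1)] .
  obtain K where K: "K \<in> \<L>" "v \<in> K" "y \<in> K" using line_ex[OF assms(2)] .
  have yC: "y \<notin> C" and xK: "x \<notin> K" using C K ncxy unfolding coll_def by blast+
  obtain p where p: "p \<in> C" "p \<noteq> v" "E y p" using mate_ex[OF C(1,2) assms(2) yC] .
  obtain q where q: "q \<in> K" "q \<noteq> v" "E x q" using mate_ex[OF K(1,2) assms(1) xK] .
  have Ep: "E v p" "E x p" using line_clique[OF C(1)] C p assms E_sym by metis+
  have Eq: "E v q" "E y q" using line_clique[OF K(1)] K q assms E_sym by metis+
  have "p \<noteq> q" using p q C K assms yC line_unique[OF Ep(1)] by metis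
  moreover have "{w. E v w \<and> E x w \<and> E y w} = {p, q}"
  proof (intro equalityI subsetI)
    fix w assume w: "w \<in> {w. E v w \<and> E x w \<and> E y w}"
    then have "coll v x w \<or> coll v y w"
      using row'[of v w x y] assms ncxy E_sym coll_sym by blast
    then consider "w \<in> C" | "w \<in> K"
      using line_unique[OF assms(1) _ C(1) _ _ C(2,3)] line_unique[OF assms(2) _ K(1) _ _ K(2,3)]
      unfolding coll_def by blast
    then show "w \<in> {p, q}"
    proof cases
      case 1
      then have "w = p" using mate_unique[OF C(1,2) assms(2) yC] w p E_neq by blast
      then show ?thesis by simp
    next
      case 2
      then have "w = q" using mate_unique[OF K(1,2) assms(1) xK] w q E_neq by blast
      then show ?thesis by simp
    qed
  qed (use Ep Eq p q in auto)
  ultimately show ?thesis by simp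
qed

lemma two_common_unique:
  assumes "E v x" "E v y" "x \<noteq> y" "\<not> E x y"
    and "E v p" "E x p" "E y p" "E v q" "E x q" "E y q" "E v r" "E x r" "E y r" "p \<noteq> q" "p \<noteq> r"
  shows "q = r"
  using card_2_unique[OF two_common[OF assms(1-4)], of p q r] assms by blast

end

section \<open>Charts and coverings\<close>

text \<open>The sizes fit the grid: an \<open>m\<close>-subset of \<open>S\<close> has one element
  for each line through a point, and its complement has one element for each further point of a
  line.\<close>

locale johnson_charts = local_grid V E \<L> m n
  for V :: "'a set" and E \<L> m n +
  fixes S :: "'s set"
  assumes finite_S: "finite S" and card_S: "card S = m + n" and m_pos: "m > 0" and n_pos: "n > 0"
    and mu_le: "x \<noteq> y \<Longrightarrow> \<not> E x y \<Longrightarrow> card {u. E x u \<and> E y u} \<le> 4"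
begin

definition J :: "'s set set" where "J = {A. A \<subseteq> S \<and> card A = m}"

definition jn :: "'s set \<Rightarrow> 's set set" where "jn A = {B \<in> J. jadj A B}"

text \<open>A chart at \<open>A\<close> is an isomorphism from the ball of radius 1 around \<open>A\<close> in the Johnson graph
  to the ball around its image that also identifies the lines through the centre.\<close>

definition chart :: "'s set \<Rightarrow> ('s set \<Rightarrow> 'a) \<Rightarrow> bool" where
  "chart A \<sigma> \<longleftrightarrow> \<sigma> A \<in> V \<and> \<sigma> ` jn A = {y. E (\<sigma> A) y} \<and> inj_on \<sigma> (jn A) \<and>
    (\<forall>B\<in>jn A. \<forall>C\<in>jn A. B \<noteq> C \<longrightarrow> (E (\<sigma> B) (\<sigma> C) \<longleftrightarrow> jadj B C)) \<and>
    (\<forall>B\<in>jn A. \<forall>C\<in>jn A. coll (\<sigma> A) (\<sigma> B) (\<sigma> C) \<longleftrightarrow> A - B = A - C)"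

definition star :: "'s set \<Rightarrow> 's set set" where "star A = insert A (jn A)"

definition compat :: "'s set \<Rightarrow> 's set \<Rightarrow> ('s set \<Rightarrow> 'a) \<Rightarrow> ('s set \<Rightarrow> 'a) \<Rightarrow> bool" where
  "compat A B \<sigma> \<tau> \<longleftrightarrow> (\<forall>F \<in> star A \<inter> star B. \<sigma> F = \<tau> F)"

section \<open>Elementary properties of the Johnson graph and of charts\<close>

lemma J_finite: "A \<in> J \<Longrightarrow> finite A"
  using finite_S finite_subset unfolding J_def by blast

lemma swap_J: "A \<in> J \<Longrightarrow> e \<in> A \<Longrightarrow> f \<in> S - A \<Longrightarrow> swap A e f \<in> J"
  using J_finite[of A] unfolding J_def swap_def
  by (auto simp: card_insert_if card_Diff_singleton) (metis Suc_pred card_gt_0_iff empty_iff)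

lemma jadj_J:
  assumes "A \<in> J" "jadj A B" "B \<subseteq> S" shows "B \<in> J"
  using assms(2)
proof (rule jadjE)
  fix e f assume *: "e \<in> A" "f \<notin> A" "B = swap A e f"
  then have "f \<in> S - A" using assms(3) by (auto simp: swap_def)
  with * assms(1) show ?thesis using swap_J by blast
qed

lemma jn_swap: "A \<in> J \<Longrightarrow> e \<in> A \<Longrightarrow> f \<in> S - A \<Longrightarrow> swap A e f \<in> jn A"
  unfolding jn_def using swap_J by auto

lemma jnE:
  assumes "B \<in> jn A"
  obtains e f where "e \<in> A" "f \<in> S - A" "B = swap A e f"
proof -
  from assms have "jadj A B" "B \<subseteq> S" unfolding jn_def J_def by auto
  from this(1) obtain e f where "e \<in> A" "f \<notin> A" "B = swap A e f" by (rule jadjE)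
  moreover from this \<open>B \<subseteq> S\<close> have "f \<in> S" by (auto simp: swap_def)
  ultimately show thesis using that by blast
qed

lemma jn_J: "B \<in> jn A \<Longrightarrow> B \<in> J" and jn_jadj: "B \<in> jn A \<Longrightarrow> jadj A B"
  unfolding jn_def by auto

lemma jn_sym: "A \<in> J \<Longrightarrow> B \<in> jn A \<Longrightarrow> A \<in> jn B"
  unfolding jn_def using jadj_sym by blast

lemma jn_I: "A \<in> J \<Longrightarrow> jadj A B \<Longrightarrow> B \<subseteq> S \<Longrightarrow> B \<in> jn A"
  unfolding jn_def using jadj_J by blast

lemma J_sub: "A \<in> J \<Longrightarrow> A \<subseteq> S" unfolding J_def by blast

lemma chart_image: "chart A \<sigma> \<Longrightarrow> \<sigma> ` jn A = {y. E (\<sigma> A) y}"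
  by (simp add: chart_def)

lemma chart_nbr: "chart A \<sigma> \<Longrightarrow> B \<in> jn A \<Longrightarrow> E (\<sigma> A) (\<sigma> B)"
  using chart_image[of A \<sigma>] by blast

lemma chart_adj: "chart A \<sigma> \<Longrightarrow> B \<in> jn A \<Longrightarrow> C \<in> jn A \<Longrightarrow> B \<noteq> C \<Longrightarrow> E (\<sigma> B) (\<sigma> C) \<longleftrightarrow> jadj B C"
  by (simp add: chart_def)

lemma chart_coll: "chart A \<sigma> \<Longrightarrow> B \<in> jn A \<Longrightarrow> C \<in> jn A \<Longrightarrow> coll (\<sigma> A) (\<sigma> B) (\<sigma> C) \<longleftrightarrow> A - B = A - C"
  by (simp add: chart_def)

lemma chart_inj: "chart A \<sigma> \<Longrightarrow> B \<in> jn A \<Longrightarrow> C \<in> jn A \<Longrightarrow> \<sigma> B = \<sigma> C \<Longrightarrow> B = C"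
  unfolding chart_def by (elim conjE) (rule inj_onD)

lemma chart_surj: "chart A \<sigma> \<Longrightarrow> E (\<sigma> A) y \<Longrightarrow> \<exists>B\<in>jn A. \<sigma> B = y"
  using chart_image[of A \<sigma>] by (metis (mono_tags, lifting) imageE mem_Collect_eq)

lemma chart_V: "chart A \<sigma> \<Longrightarrow> \<sigma> A \<in> V"
  by (simp add: chart_def)

lemma compat_sym: "compat A B \<sigma> \<tau> \<Longrightarrow> compat B A \<tau> \<sigma>"
  unfolding compat_def by auto

text \<open>The neighbors of \<open>B\<close> equal or adjacent to \<open>A\<close> form a cross,
  the row and the column of \<open>A\<close> in the grid at \<open>B\<close>. Any other
  \<open>F\<close> is the corner opposite \<open>A\<close> in a rectangle whose remaining corners
  lie on the cross, so its image is their second common neighbor around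
  \<open>\<sigma> B\<close>.\<close>

lemma chart_unique:
  assumes B: "B \<in> J" and s: "chart B \<sigma>" and t: "chart B \<tau>" and A: "A \<in> jn B"
    and eq: "\<sigma> B = \<tau> B" "\<sigma> A = \<tau> A" "\<And>F. F \<in> jn A \<inter> jn B \<Longrightarrow> \<sigma> F = \<tau> F"
    and F: "F \<in> jn B"
  shows "\<sigma> F = \<tau> F"
proof (cases "F = A \<or> jadj A F")
  case True
  then show ?thesis using eq F unfolding jn_def by auto
next
  case False
  obtain C D where CD: "jadj B C" "jadj B D" "jadj A C" "jadj A D" "jadj F C" "jadj F D"
    "C \<noteq> D" "\<not> jadj C D" "C \<subseteq> A \<union> B \<union> F" "D \<subseteq> A \<union> B \<union> F"
    using jadj_quad[of B A F] A F False unfolding jn_def by blast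
  have S: "A \<union> B \<union> F \<subseteq> S" using J_sub[OF B] J_sub[OF jn_J[OF A]] J_sub[OF jn_J[OF F]] by simp
  note CS = subset_trans[OF CD(9) S] and DS = subset_trans[OF CD(10) S]
  have C: "C \<in> jn B" "C \<in> jn A" and D: "D \<in> jn B" "D \<in> jn A"
    using jn_I[OF B CD(1) CS] jn_I[OF jn_J[OF A] CD(3) CS] jn_I[OF B CD(2) DS]
      jn_I[OF jn_J[OF A] CD(4) DS] by simp_all
  have tC: "\<tau> C = \<sigma> C" "\<tau> D = \<sigma> D" using eq C D by auto
  have ne: "C \<noteq> A" "D \<noteq> A" "C \<noteq> F" "D \<noteq> F" using CD(3-6) by auto
  have nE: "\<sigma> C \<noteq> \<sigma> D" "\<not> E (\<sigma> C) (\<sigma> D)"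
    using chart_inj[OF s C(1) D(1)] chart_adj[OF s C(1) D(1) CD(7)] CD(7,8) by blast+
  have sF: "E (\<sigma> C) (\<sigma> F)" "E (\<sigma> D) (\<sigma> F)" "E (\<sigma> C) (\<sigma> A)" "E (\<sigma> D) (\<sigma> A)"
    using chart_adj[OF s C(1) F ne(3)] chart_adj[OF s D(1) F ne(4)] chart_adj[OF s C(1) A ne(1)]
      chart_adj[OF s D(1) A ne(2)] CD(3-6)[THEN jadj_sym] by blast+
  have tF: "E (\<tau> C) (\<tau> F)" "E (\<tau> D) (\<tau> F)"
    using chart_adj[OF t C(1) F ne(3)] chart_adj[OF t D(1) F ne(4)] CD(5,6)[THEN jadj_sym] by blast+
  have "\<sigma> F \<noteq> \<sigma> A" "\<tau> F \<noteq> \<sigma> A"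
    using chart_inj[OF s F A] chart_inj[OF t F A] eq(2) False by metis+
  then show ?thesis
    using two_common_unique[of "\<sigma> B" "\<sigma> C" "\<sigma> D" "\<sigma> A" "\<sigma> F" "\<tau> F"]
      nE sF tF[unfolded tC] chart_nbr[OF s C(1)] chart_nbr[OF s D(1)] chart_nbr[OF s A]
      chart_nbr[OF s F] chart_nbr[OF t F] eq by auto
qed

text \<open>If \<open>F\<close> is not adjacent to \<open>A\<close>, then \<open>A\<close>, \<open>B\<close>, \<open>C\<close>, \<open>F\<close> extend to an octahedron. The points
  over \<open>C\<close> and its opposite vertex \<open>D\<close> already have four common neighbors, so \<open>mu_le\<close> forces the
  two candidates for the image of \<open>F\<close> to coincide.\<close>

lemma chart_flat:
  assumes A: "A \<in> J" and B: "B \<in> jn A" and C: "C \<in> jn A" and BC: "jadj B C"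
    and a: "chart A \<alpha>" and b: "chart B \<beta>" and c: "chart C \<gamma>"
    and ab: "compat A B \<alpha> \<beta>" and ac: "compat A C \<alpha> \<gamma>"
  shows "compat B C \<beta> \<gamma>"
  unfolding compat_def
proof
  fix F assume F: "F \<in> star B \<inter> star C"
  have BJ: "B \<in> J" and CJ: "C \<in> J" using B C jn_J by auto
  have AB: "A \<in> jn B" "A \<in> jn C" using jn_sym[OF A] B C by auto
  have CB: "C \<in> jn B" "B \<in> jn C" using BC BJ CJ unfolding jn_def by (simp_all add: jadj_commute)
  have ab': "\<beta> X = \<alpha> X" if "X \<in> star A" "X \<in> star B" for X using ab that unfolding compat_def by auto
  have ac': "\<gamma> X = \<alpha> X" if "X \<in> star A" "X \<in> star C" for X using ac that unfolding compat_def by auto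
  show "\<beta> F = \<gamma> F"
  proof (cases "F \<in> star A")
    case True
    then show ?thesis using ab' ac' F by auto
  next
    case False
    have FB: "F \<in> jn B" "F \<in> jn C" using F False B C unfolding star_def by auto
    have nFA: "F \<noteq> A" "\<not> jadj A F" using False jn_I[OF A] J_sub[OF jn_J[OF FB(1)]] unfolding star_def by blast+
    have "jadj A B" "jadj A C" "jadj B F" "jadj C F" using B C FB jn_jadj by blast+
    from jadj_octahedron[OF this(1,2) BC this(3,4) nFA]
    obtain D G where DG: "jadj A D" "jadj A G" "jadj B D" "jadj F D" "\<not> jadj C D" "C \<noteq> D"
    "jadj C G" "jadj F G" "jadj D G" "\<not> jadj B G" "B \<noteq> G"
    "D \<subseteq> A \<union> B \<union> C \<union> F" "G \<subseteq> A \<union> B \<union> C \<union> F" by blast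
    have S: "A \<union> B \<union> C \<union> F \<subseteq> S"
      using J_sub[OF A] J_sub[OF BJ] J_sub[OF CJ] J_sub[OF jn_J[OF FB(1)]] by simp
    note DS = subset_trans[OF DG(12) S] and GS = subset_trans[OF DG(13) S]
    have D: "D \<in> jn A" "D \<in> jn B" and G: "G \<in> jn A" "G \<in> jn C"
      using jn_I[OF A DG(1) DS] jn_I[OF BJ DG(3) DS] jn_I[OF A DG(2) GS] jn_I[OF CJ DG(7) GS] by simp_all
    let ?z = "\<alpha> A" and ?B = "\<alpha> B" and ?C = "\<alpha> C" and ?D = "\<alpha> D" and ?G = "\<alpha> G"
    have bs: "\<beta> A = ?z" "\<beta> B = ?B" "\<beta> C = ?C" "\<beta> D = ?D"
      using ab' AB B C CB D unfolding star_def by auto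
    have cs: "\<gamma> A = ?z" "\<gamma> B = ?B" "\<gamma> C = ?C" "\<gamma> G = ?G"
      using ac' AB B C CB G unfolding star_def by auto
    have zE: "E ?z ?B" "E ?z ?C" "E ?z ?D" "E ?z ?G"
      using chart_nbr[OF a] B C D G by auto
    have neq: "B \<noteq> C" "B \<noteq> D" "C \<noteq> G" "D \<noteq> G" "C \<noteq> F" "D \<noteq> F" "G \<noteq> F" "B \<noteq> F"
      using BC DG(3,4,7,8,9) \<open>jadj B F\<close> \<open>jadj C F\<close> by auto
    have adj: "E ?B ?C" "E ?B ?D" "E ?C ?G" "E ?D ?G" "\<not> E ?B ?G" "\<not> E ?C ?D"
      "?B \<noteq> ?G" "?C \<noteq> ?D"
      using chart_adj[OF a B C neq(1)] chart_adj[OF a B D(1) neq(2)] chart_adj[OF a C G(1) neq(3)]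
        chart_adj[OF a D(1) G(1) neq(4)] chart_adj[OF a B G(1) DG(11)] chart_adj[OF a C D(1) DG(6)]
        chart_inj[OF a B G(1)] chart_inj[OF a C D(1)] DG(3,5,6,7,9,10,11) BC by blast+
    let ?y = "\<beta> F" and ?y' = "\<gamma> F"
    have y: "E ?B ?y" "E ?C ?y" "E ?D ?y" "?y \<noteq> ?z"
      using chart_nbr[OF b FB(1)] chart_adj[OF b CB(1) FB(1)] chart_adj[OF b D(2) FB(1)]
        chart_inj[OF b FB(1) AB(1)] neq(5,6) DG(4) \<open>jadj C F\<close> nFA(1)
      unfolding bs jadj_commute[of D F] by blast+
    have y': "E ?C ?y'" "E ?B ?y'" "E ?G ?y'" "?y' \<noteq> ?z"
      using chart_nbr[OF c FB(2)] chart_adj[OF c CB(2) FB(2)] chart_adj[OF c G(2) FB(2)]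
        chart_inj[OF c FB(2) AB(2)] neq(7,8) DG(8) \<open>jadj B F\<close> nFA(1)
      unfolding cs jadj_commute[of G F] by blast+
    have "?y \<noteq> ?G" using y(1) adj(5) by metis
    let ?U = "{w. E ?C w \<and> E ?D w}"
    have finU: "finite ?U" using finite_nbr[of ?C] by (auto intro: finite_subset)
    have sub: "{?z, ?B, ?G, ?y} \<subseteq> ?U" using zE adj y by (simp add: E_commute)
    have "?z \<noteq> ?B" "?z \<noteq> ?G" "?B \<noteq> ?y" using zE y E_neq by blast+
    then have "card {?z, ?B, ?G, ?y} = 4" using adj y \<open>?y \<noteq> ?G\<close> by simp
    then have U: "?U = {?z, ?B, ?G, ?y}"
      using card_subset_eq[OF finU sub] card_mono[OF finU sub] mu_le[of ?C ?D] adj by simp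
    \<comment> \<open>The missing adjacency of \<open>?G\<close> and \<open>?y\<close> comes from
      the grid at \<open>?G\<close>: there \<open>?C\<close> and \<open>?D\<close> have a second
      common neighbor besides \<open>?z\<close>, and by \<open>U\<close> it can only be
      \<open>?y\<close>.\<close>
    have "card {w. E ?G w \<and> E ?C w \<and> E ?D w} = 2"
      by (rule two_common) (use adj in \<open>simp_all add: E_commute\<close>)
    moreover have "?z \<in> {w. E ?G w \<and> E ?C w \<and> E ?D w}" using zE by (simp add: E_commute)
    ultimately obtain w where w: "E ?G w" "E ?C w" "E ?D w" "w \<noteq> ?z"
      by (rule card_2_other) blast
    then have "w \<in> {?z, ?B, ?G, ?y}" using U by auto
    moreover have "w \<noteq> ?B" "w \<noteq> ?G" using w adj E_sym E_neq by blast+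
    ultimately have "w = ?y" using w by simp
    then show ?thesis
      by (intro two_common_unique[of ?C ?B ?G ?z ?y ?y']) (use zE adj y y' w in \<open>simp_all add: E_commute\<close>)
  qed
qed


text \<open>A cross determines the grid: \<open>r\<close> lists the line with label
  \<open>e1\<close>, and \<open>k\<close> the column at position \<open>f1\<close>. The grid point
  \<open>p e f\<close> is the mate of \<open>r f\<close> on the line through \<open>k e\<close>. The
  axiom \<open>row\<close> makes columns cliques, and counting shows that every neighbor of
  \<open>z\<close> is reached.\<close>

lemma grid_chart:
  assumes B: "B \<in> J" and z: "z \<in> V" and e1: "e1 \<in> B" and f1: "f1 \<in> S - B"
    and C: "C \<in> \<L>" "z \<in> C" and r: "bij_betw r (S - B) (C - {z})" and rk: "r f1 = k e1"
    and k: "\<And>e. e \<in> B \<Longrightarrow> E z (k e)"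
    and kE: "\<And>e e'. e \<in> B \<Longrightarrow> e' \<in> B \<Longrightarrow> e \<noteq> e' \<Longrightarrow> E (k e) (k e')"
    and kc: "\<And>e e'. e \<in> B \<Longrightarrow> e' \<in> B \<Longrightarrow> e \<noteq> e' \<Longrightarrow> \<not> coll z (k e) (k e')"
  obtains \<sigma> where "chart B \<sigma>" "\<sigma> B = z" "\<And>f. f \<in> S - B \<Longrightarrow> \<sigma> (swap B e1 f) = r f"
    "\<And>e. e \<in> B \<Longrightarrow> \<sigma> (swap B e f1) = k e"
proof -
  have rC: "r f \<in> C" "r f \<noteq> z" if "f \<in> S - B" for f
    using bij_betw_apply[OF r that] by auto
  have rE: "E z (r f)" if "f \<in> S - B" for f
    using line_clique[OF C(1,2) rC(1)[OF that]] rC(2)[OF that] by metis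
  have rinj: "f = f'" if "r f = r f'" "f \<in> S - B" "f' \<in> S - B" for f f'
    using r that unfolding bij_betw_def inj_on_def by blast
  have rcoll: "coll z (r f) (r f')" if "f \<in> S - B" "f' \<in> S - B" for f f'
    using rC(1) that C unfolding coll_def by blast
  have k1r: "coll z (k e1) (r f)" if "f \<in> S - B" for f
    using rcoll[OF f1 that] rk by simp
  \<comment> \<open>On the line \<open>C\<close> itself there is no mate to take, so the row of
    \<open>e1\<close> is \<open>r\<close>.\<close>
  define Q where "Q e f w \<longleftrightarrow> (if e = e1 then w = r f else E z w \<and> coll z (k e) w \<and> E (r f) w)" for e f w
  define p where "p e f = (SOME w. Q e f w)" for e f
  have ncoll: "\<not> coll z (r f) (k e)" if "f \<in> S - B" "e \<in> B" "e \<noteq> e1" for e f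
    using coll_trans[OF rE[OF that(1)] k1r[OF that(1)]] kc[OF e1 that(2)] that(3) by blast
  have "\<exists>w. Q e f w" if "f \<in> S - B" "e \<in> B" for e f
  proof (cases "e = e1")
    case False
    note rEf = rE[OF that(1)]
    from line_ex[OF k[OF that(2)]] obtain K where K: "K \<in> \<L>" "z \<in> K" "k e \<in> K" .
    have "r f \<notin> K" using not_coll_line[OF K ncoll[OF that False]] .
    from mate_ex[OF K(1,2) rEf this] obtain w where w: "w \<in> K" "w \<noteq> z" "E (r f) w" .
    then have "E z w" "coll z (k e) w" using line_clique[OF K(1,2)] K unfolding coll_def by blast+
    then show ?thesis using w False unfolding Q_def by auto
  qed (simp add: Q_def)
  then have Qp: "Q e f (p e f)" if "f \<in> S - B" "e \<in> B" for e f
    unfolding p_def using that by (intro someI_ex[of "Q e f"]) blast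
  have p1: "p e1 f = r f" if "f \<in> S - B" for f using Qp[OF that e1] by (simp add: Q_def)
  have pz: "E z (p e f)" and pc: "coll z (k e) (p e f)" if "f \<in> S - B" "e \<in> B" for e f
    using Qp[OF that] rE[OF that(1)] k1r[OF that(1)] by (auto simp: Q_def split: if_splits)
  have pcc: "coll z (p e f) (p e f')" if "f \<in> S - B" "f' \<in> S - B" "e \<in> B" for e f f'
    using coll_trans[OF k[OF that(3)] coll_sym[OF pc[OF that(1,3)]] pc[OF that(2,3)]] .
  have pr: "E (r f) (p e f)" if "f \<in> S - B" "e \<in> B" "e \<noteq> e1" for e f
    using Qp[OF that(1,2)] that(3) by (simp add: Q_def)
  have nc2: "\<not> coll z (p e f) (p e' f')"
    if "f \<in> S - B" "f' \<in> S - B" "e \<in> B" "e' \<in> B" "e \<noteq> e'" for e f e' f'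
    using coll_trans[OF pz[OF that(1,3)] pc[OF that(1,3)]]
      coll_trans[OF pz[OF that(2,4)] _ coll_sym[OF pc[OF that(2,4)]], of "k e"] kc[OF that(3-5)] by blast
  \<comment> \<open>Both points are adjacent to \<open>r f\<close>, the point of the same column on
    the line \<open>C\<close>; the two matchings compose by \<open>row'\<close>.\<close>
  have padj: "E (p e f) (p e' f)" if "f \<in> S - B" "e \<in> B" "e' \<in> B" "e \<noteq> e'" for e e' f
  proof -
    consider "e = e1" | "e' = e1" | "e \<noteq> e1" "e' \<noteq> e1" by blast
    then show ?thesis
    proof cases
      case 3
      show ?thesis
        by (rule row'[OF rE[OF that(1)] pz[OF that(1,2)] pz[OF that(1,3)] pr[OF that(1,2) 3(1)]
              pr[OF that(1,3) 3(2)]])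
          (use nc2[OF that(1,1) e1 that(2)] nc2[OF that(1,1) e1 that(3)] nc2[OF that(1,1,2,3,4)] 3
            p1[OF that(1)] in auto)
    qed (use that p1 pr E_sym in metis)+
  qed
  have pinj: "f = f'" if "p e f = p e f'" "f \<in> S - B" "f' \<in> S - B" "e \<in> B" for e f f'
  proof (cases "e = e1")
    case True
    then show ?thesis using that p1 rinj by metis
  next
    case False
    have "r f = r f'"
    proof (rule mate_unique'[OF pz[OF that(2,4)] rE[OF that(2)] rE[OF that(3)] rcoll[OF that(2,3)]])
      show "\<not> coll z (p e f) (r f)"
        using nc2[OF that(2,2,4) e1 False] p1[OF that(2)] by simp
      show "E (p e f) (r f)" using pr[OF that(2,4) False] E_sym by blast
      show "E (p e f) (r f')" using pr[OF that(3,4) False] E_sym that(1) by metis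
    qed
    then show ?thesis using rinj that by blast
  qed
  have pk: "p e f1 = k e" if "e \<in> B" for e
  proof (cases "e = e1")
    case True
    then show ?thesis using p1[OF f1] rk by simp
  next
    case False
    show ?thesis
      by (rule mate_unique'[OF rE[OF f1] pz[OF f1 that] k[OF that] coll_sym[OF pc[OF f1 that]]])
        (use nc2[OF f1 f1 e1 that] p1[OF f1] pr[OF f1 that False] kE[OF e1 that] rk False in auto)
  qed
  have psurj: "\<exists>e\<in>B. \<exists>f\<in>S - B. p e f = w" if w: "E z w" for w
  proof -
    \<comment> \<open>The points \<open>k e\<close> select \<open>m\<close> different lines through
      \<open>z\<close>, which are therefore all of them.\<close>
    define LN where "LN e = (SOME K. K \<in> \<L> \<and> z \<in> K \<and> k e \<in> K)" for e
    have LN: "LN e \<in> \<L> \<and> z \<in> LN e \<and> k e \<in> LN e" if "e \<in> B" for e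
      unfolding LN_def by (rule someI_ex) (use line_ex[OF k[OF that]] in blast)
    have "inj_on LN B"
    proof (rule inj_onI)
      fix e e' assume *: "e \<in> B" "e' \<in> B" "LN e = LN e'"
      then have "coll z (k e) (k e')" unfolding coll_def using LN[OF *(1)] LN[OF *(2)] by auto
      then show "e = e'" using kc * by blast
    qed
    then have "card (LN ` B) = card {C \<in> \<L>. z \<in> C}"
      using B lines_card[OF z] by (simp add: card_image J_def)
    moreover have "finite {C \<in> \<L>. z \<in> C}"
      using lines_card[OF z] m_pos by (metis card_gt_0_iff)
    ultimately have LNs: "LN ` B = {C \<in> \<L>. z \<in> C}"
      using LN by (intro card_subset_eq) auto
    obtain K where K: "K \<in> \<L>" "z \<in> K" "w \<in> K" using line_ex[OF w] .
    then obtain e where e: "e \<in> B" "K = LN e" using LNs by blast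
    have sub: "p e ` (S - B) \<subseteq> K - {z}"
    proof
      fix y assume "y \<in> p e ` (S - B)"
      then obtain f where f: "f \<in> S - B" "y = p e f" by blast
      have "coll z (k e) y" using pc[OF f(1) e(1)] f by simp
      then obtain K' where K': "K' \<in> \<L>" "z \<in> K'" "k e \<in> K'" "y \<in> K'" unfolding coll_def by blast
      then have "K' = K" using line_unique[OF k[OF e(1)] K'(1) K(1)] LN[OF e(1)] e(2) by blast
      then show "y \<in> K - {z}" using K' pz[OF f(1) e(1)] f E_irrefl by auto
    qed
    have "card (p e ` (S - B)) = card (S - B)"
      by (rule card_image) (use pinj e in \<open>auto simp: inj_on_def\<close>)
    also have "\<dots> = n" using B finite_S card_S J_finite[OF B]
      by (simp add: card_Diff_subset J_def)
    also have "n = card (K - {z})" using line_card[OF K(1)] K by simp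
    finally have "p e ` (S - B) = K - {z}"
      using sub finite_line[OF K(1)] by (intro card_subset_eq) auto
    moreover have "w \<in> K - {z}" using K(3) E_neq[OF w] by simp
    ultimately have "w \<in> p e ` (S - B)" by simp
    then show ?thesis using e(1) by (metis imageE)
  qed
  \<comment> \<open>Off the star of \<open>B\<close> the value is arbitrary, since
    \<open>chart\<close> constrains only the star.\<close>
  define \<sigma> where "\<sigma> F = (if F = B then z else p (the_elem (B - F)) (the_elem (F - B)))" for F
  have s: "\<sigma> (swap B e f) = p e f" if "e \<in> B" "f \<in> S - B" for e f
  proof -
    have "swap B e f \<noteq> B" using that jadj_swap[of e B f] by (metis DiffD2 jadj_irrefl)
    then show ?thesis using swap_minus[of e B f] that by (simp add: \<sigma>_def)
  qed
  have sB: "\<sigma> B = z" by (simp add: \<sigma>_def)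
  have "chart B \<sigma>"
    unfolding chart_def sB
  proof (intro conjI ballI impI)
    show "\<sigma> ` jn B = {y. E z y}"
    proof (intro equalityI subsetI)
      fix y assume "y \<in> \<sigma> ` jn B"
      then obtain F where F: "F \<in> jn B" "y = \<sigma> F" by blast
      from F(1) obtain e f where "e \<in> B" "f \<in> S - B" "F = swap B e f" by (rule jnE)
      then show "y \<in> {y. E z y}" using s pz F by simp
    next
      fix y assume "y \<in> {y. E z y}"
      then obtain e f where "e \<in> B" "f \<in> S - B" "p e f = y" using psurj by blast
      then show "y \<in> \<sigma> ` jn B" using s jn_swap[OF B] by (metis imageI)
    qed
    have adj: "E (p e f) (p e' f') \<longleftrightarrow> jadj (swap B e f) (swap B e' f')"
      if "e \<in> B" "f \<in> S - B" "e' \<in> B" "f' \<in> S - B" "\<not> (e = e' \<and> f = f')" for e f e' f'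
    proof -
      have j: "jadj (swap B e f) (swap B e' f') \<longleftrightarrow> (e = e') \<noteq> (f = f')"
        using jadj_swap_iff[of e B e' f f'] that by auto
      from that(5) consider "e = e'" "f \<noteq> f'" | "e \<noteq> e'" "f = f'" | "e \<noteq> e'" "f \<noteq> f'" by blast
      then show ?thesis
      proof cases
        case 1
        then show ?thesis using j coll_E[OF pcc[OF that(2,4,1)]] pinj[of e f f'] that by auto
      next
        case 2
        then show ?thesis using j padj[OF that(2,1,3)] by auto
      next
        case 3
        have "\<not> E (p e f) (p e' f')"
        proof
          assume "E (p e f) (p e' f')"
          then have "p e' f' = p e' f"
            using mate_unique'[OF pz[OF that(2,1)] pz[OF that(4,3)] pz[OF that(2,3)] pcc[OF that(4,2,3)]]
              nc2[OF that(2,4,1,3) 3(1)] padj[OF that(2,1,3) 3(1)] by blast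
          then show False using pinj that 3 by metis
        qed
        then show ?thesis using 3 j by simp
      qed
    qed
    show "inj_on \<sigma> (jn B)"
    proof (rule inj_onI)
      fix F G assume *: "F \<in> jn B" "G \<in> jn B" "\<sigma> F = \<sigma> G"
      obtain e f where ef: "e \<in> B" "f \<in> S - B" "F = swap B e f" using *(1) by (rule jnE)
      obtain e' f' where ef': "e' \<in> B" "f' \<in> S - B" "G = swap B e' f'" using *(2) by (rule jnE)
      have pp: "p e f = p e' f'" using * s[OF ef(1,2)] s[OF ef'(1,2)] ef ef' by simp
      have "e = e'"
      proof (rule ccontr)
        assume "e \<noteq> e'"
        from nc2[OF ef(2) ef'(2) ef(1) ef'(1) this] pp coll_refl[OF pz[OF ef(2,1)]] show False by simp
      qed
      then show "F = G" using pinj pp ef ef' by metis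
    qed
    show "z \<in> V" by fact
    fix F G assume *: "F \<in> jn B" "G \<in> jn B"
    obtain e f where ef: "e \<in> B" "f \<in> S - B" "F = swap B e f" using *(1) by (rule jnE)
    obtain e' f' where ef': "e' \<in> B" "f' \<in> S - B" "G = swap B e' f'" using *(2) by (rule jnE)
    show "E (\<sigma> F) (\<sigma> G) \<longleftrightarrow> jadj F G" if "F \<noteq> G"
      using adj[OF ef(1,2) ef'(1,2)] that s[OF ef(1,2)] s[OF ef'(1,2)] ef(3) ef'(3) by auto
    show "coll z (\<sigma> F) (\<sigma> G) \<longleftrightarrow> B - F = B - G"
    proof (cases "e = e'")
      case True
      then show ?thesis using pcc[OF ef(2) ef'(2) ef(1)] s[OF ef(1,2)] s[OF ef'(1,2)] ef ef'
          swap_minus(1)[of e B] by auto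
    next
      case False
      then show ?thesis using nc2[OF ef(2) ef'(2) ef(1) ef'(1) False] s[OF ef(1,2)] s[OF ef'(1,2)] ef ef'
          swap_minus(1)[of e B f] swap_minus(1)[of e' B f'] by auto
    qed
  qed
  then show thesis
    by (rule that) (use sB s e1 f1 p1 pk in auto)
qed


lemma J_card: "A \<in> J \<Longrightarrow> card A = m" unfolding J_def by simp

lemma card_S_diff: "A \<in> J \<Longrightarrow> card (S - A) = n"
  using finite_S card_S J_finite[of A] by (simp add: card_Diff_subset J_def)

text \<open>The labels are free choices: a bijection of \<open>B\<close> with the lines through
  \<open>z\<close>, and one of \<open>S - B\<close> with the further points of one line. The column
  for \<open>grid_chart\<close> consists of a point \<open>?x\<close> of that line and its mates on
  the other lines.\<close>

lemma base_chart:
  assumes z: "z \<in> V" and B: "B \<in> J"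
  obtains \<sigma> where "chart B \<sigma>" "\<sigma> B = z"
proof -
  let ?L = "{C \<in> \<L>. z \<in> C}"
  have "finite ?L" using lines_card[OF z] m_pos by (metis card_gt_0_iff)
  then obtain g where g: "bij_betw g B ?L"
    using finite_same_card_bij[of B ?L] lines_card[OF z] J_finite[OF B] J_card[OF B] by auto
  obtain e1 where e1: "e1 \<in> B" using J_card[OF B] m_pos by fastforce
  obtain f1 where f1: "f1 \<in> S - B" using card_S_diff[OF B] n_pos by (metis all_not_in_conv card.empty less_not_refl)
  have gL: "g e \<in> \<L>" "z \<in> g e" if "e \<in> B" for e using bij_betw_apply[OF g that] by auto
  note C = gL[OF e1]
  have "card (S - B) = card (g e1 - {z})" using card_S_diff[OF B] line_card[OF C(1)] C(2) by simp
  then obtain r where r: "bij_betw r (S - B) (g e1 - {z})"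
    using finite_same_card_bij[of "S - B" "g e1 - {z}"] finite_S finite_line[OF C(1)] by auto
  let ?x = "r f1"
  have x: "?x \<in> g e1" "?x \<noteq> z" using bij_betw_apply[OF r f1] by auto
  have zx: "E z ?x" using line_clique[OF C x(1)] x(2) by metis
  have xg: "?x \<notin> g e" if "e \<in> B" "e \<noteq> e1" for e
    using line_unique[OF zx C(1) gL(1)[OF that(1)] C(2) x(1) gL(2)[OF that(1)]]
      g that e1 unfolding bij_betw_def inj_on_def by blast
  define k where "k e = (if e = e1 then ?x else (SOME w. w \<in> g e \<and> w \<noteq> z \<and> E ?x w))" for e
  have kS: "k e \<in> g e \<and> k e \<noteq> z \<and> E ?x (k e)" if "e \<in> B" "e \<noteq> e1" for e
  proof -
    from mate_ex[OF gL[OF that(1)] zx xg[OF that]] obtain w where "w \<in> g e" "w \<noteq> z" "E ?x w" .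
    then have "\<exists>w. w \<in> g e \<and> w \<noteq> z \<and> E ?x w" by blast
    from someI_ex[OF this] show ?thesis using that(2) by (simp add: k_def)
  qed
  have k1: "k e1 = ?x" by (simp add: k_def)
  have kg: "k e \<in> g e" "k e \<noteq> z" if "e \<in> B" for e
    using kS[OF that] k1 x by (cases "e = e1"; auto)+
  have kz: "E z (k e)" if "e \<in> B" for e
    using line_clique[OF gL[OF that] kg(1)[OF that]] kg(2)[OF that] by metis
  have kc: "\<not> coll z (k e) (k e')" if "e \<in> B" "e' \<in> B" "e \<noteq> e'" for e e'
  proof
    assume "coll z (k e) (k e')"
    then obtain K where K: "K \<in> \<L>" "z \<in> K" "k e \<in> K" "k e' \<in> K" unfolding coll_def by blast
    have "K = g e" using line_unique[OF kz[OF that(1)] K(1) gL(1)[OF that(1)]] K gL kg that by blast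
    moreover have "K = g e'" using line_unique[OF kz[OF that(2)] K(1) gL(1)[OF that(2)]] K gL kg that by blast
    ultimately show False using g that unfolding bij_betw_def inj_on_def by blast
  qed
  have kE: "E (k e) (k e')" if "e \<in> B" "e' \<in> B" "e \<noteq> e'" for e e'
  proof -
    consider "e = e1" | "e' = e1" | "e \<noteq> e1" "e' \<noteq> e1" by blast
    then show ?thesis
    proof cases
      case 3
      then show ?thesis
        using row'[OF zx kz[OF that(1)] kz[OF that(2)]] kS that kc[OF that] kc[OF e1 that(1)] kc[OF e1 that(2)] k1
        by auto
    qed (use kS that k1 E_sym in metis)+
  qed
  show thesis
    by (rule grid_chart[where k = k, OF B z e1 f1 C r k1[symmetric] kz kE kc]) (auto intro: that)
qed

text \<open>The points common to the two stars form a cross of the grid around \<open>\<sigma> B\<close>, and a cross determines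
  the grid.\<close>

lemma transport:
  assumes A: "A \<in> J" and s: "chart A \<sigma>" and B: "B \<in> jn A"
  obtains \<tau> where "chart B \<tau>" "compat A B \<sigma> \<tau>"
proof -
  have BJ: "B \<in> J" and AB: "A \<in> jn B" using B jn_J jn_sym[OF A] by auto
  obtain e0 f0 where ef: "e0 \<in> A" "f0 \<in> S - A" "B = swap A e0 f0" using B by (rule jnE)
  have e0B: "e0 \<in> S - B" and f0B: "f0 \<in> B" and Asw: "A = swap B f0 e0"
    using ef J_sub[OF A] swap_back[of e0 A f0] by (auto simp: swap_def)
  have zE: "E (\<sigma> A) (\<sigma> B)" by (rule chart_nbr[OF s B])
  have z: "\<sigma> B \<in> V" using E_V2[OF zE] .
  obtain C where C: "C \<in> \<L>" "\<sigma> B \<in> C" "\<sigma> A \<in> C" using line_ex[OF zE] by blast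
  have sw1: "swap B f0 f = swap A e0 f" if "f \<in> S - B" "f \<noteq> e0" for f
    using that ef swap_swap(2)[of e0 A f0 f] by (auto simp: swap_def)
  have sw2: "swap B e e0 = swap A e f0" if "e \<in> B" "e \<noteq> f0" for e
    using that ef swap_swap(1)[of e0 A f0 e] by (auto simp: swap_def)
  have inA: "swap B f0 f \<in> jn A" if "f \<in> S - B" "f \<noteq> e0" for f
    unfolding sw1[OF that] by (rule jn_swap[OF A ef(1)]) (use that ef in \<open>auto simp: swap_def\<close>)
  have inA2: "swap B e e0 \<in> jn A" if "e \<in> B" "e \<noteq> f0" for e
    unfolding sw2[OF that] by (rule jn_swap[OF A _ ef(2)]) (use that ef in \<open>auto simp: swap_def\<close>)
  \<comment> \<open>Row and column of \<open>A\<close> in the grid at \<open>B\<close>. The sets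
    involved are \<open>A\<close> itself or neighbors of \<open>A\<close>, so
    \<open>\<sigma>\<close> already prescribes their images.\<close>
  define r where "r f = \<sigma> (swap B f0 f)" for f
  define k where "k e = \<sigma> (swap B e e0)" for e
  have r0: "r e0 = \<sigma> A" and k0: "k f0 = \<sigma> A" using Asw by (auto simp: r_def k_def)
  have diff: "A - swap B f0 f = {e0}" if "f \<in> S - B" "f \<noteq> e0" for f
    unfolding sw1[OF that] by (rule swap_minus) (use that ef in \<open>auto simp: swap_def\<close>)
  have diffB: "A - B = {e0}" unfolding ef(3) by (rule swap_minus) (use ef in auto)
  have rC: "r f \<in> C" "r f \<noteq> \<sigma> B" if "f \<in> S - B" for f
  proof -
    have "r f \<in> C \<and> r f \<noteq> \<sigma> B"
    proof (cases "f = e0")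
      case True
      then show ?thesis using C zE E_neq r0 by auto
    next
      case False
      have "coll (\<sigma> A) (\<sigma> B) (r f)"
        unfolding r_def using chart_coll[OF s B inA[OF that False]] diffB diff[OF that False] by simp
      then obtain K where "K \<in> \<L>" "\<sigma> A \<in> K" "\<sigma> B \<in> K" "r f \<in> K" unfolding coll_def by blast
      then have "r f \<in> C" using line_unique[OF zE, of K C] C by blast
      moreover have "swap B f0 f \<noteq> B" using jadj_swap[of f0 B f] f0B that by (metis DiffD2 jadj_irrefl)
      ultimately show ?thesis using chart_inj[OF s inA[OF that False] B] unfolding r_def by blast
    qed
    then show "r f \<in> C" "r f \<noteq> \<sigma> B" by auto
  qed
  have rinj: "inj_on r (S - B)"
  proof (rule inj_onI)
    fix f f' assume *: "f \<in> S - B" "f' \<in> S - B" "r f = r f'"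
    have neA: "r g \<noteq> \<sigma> A" if "g \<in> S - B" "g \<noteq> e0" for g
      unfolding r_def using chart_nbr[OF s inA[OF that]] E_neq by metis
    show "f = f'"
    proof (cases "f = e0 \<or> f' = e0")
      case True
      then show ?thesis using neA r0 * by metis
    next
      case False
      then have "swap B f0 f = swap B f0 f'"
        using chart_inj[OF s inA inA] * unfolding r_def by blast
      then show ?thesis using swap_eq_iff[of f0 B f0 f f'] f0B * by auto
    qed
  qed
  have r: "bij_betw r (S - B) (C - {\<sigma> B})"
    unfolding bij_betw_def
  proof
    have "card (r ` (S - B)) = card (C - {\<sigma> B})"
      using card_image[OF rinj] card_S_diff[OF BJ] line_card[OF C(1)] C(2) by simp
    then show "r ` (S - B) = C - {\<sigma> B}"
      using rC finite_line[OF C(1)] by (intro card_subset_eq) auto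
  qed fact
  have adjB: "jadj B (swap B e e0)" if "e \<in> B" for e using that e0B by simp
  have kzA: "E (\<sigma> A) (k e)" if "e \<in> B" "e \<noteq> f0" for e
    unfolding k_def by (rule chart_nbr[OF s inA2[OF that]])
  have ncA: "\<not> coll (\<sigma> A) (\<sigma> B) (k e)" if "e \<in> B" "e \<noteq> f0" for e
  proof -
    have "A - swap B e e0 = {e}"
      unfolding sw2[OF that] by (rule swap_minus) (use that ef in \<open>auto simp: swap_def\<close>)
    moreover have "e \<noteq> e0" using that e0B by auto
    ultimately show ?thesis unfolding k_def using chart_coll[OF s B inA2[OF that]] diffB by simp
  qed
  have kz: "E (\<sigma> B) (k e)" if "e \<in> B" for e
  proof (cases "e = f0")
    case True
    then show ?thesis using k0 zE E_sym by simp
  next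
    case False
    have "B \<noteq> swap B e e0" using adjB[OF that] by (metis jadj_irrefl)
    then show ?thesis unfolding k_def
      using chart_adj[OF s B inA2[OF that False]] adjB[OF that] by simp
  qed
  have kE: "E (k e) (k e')" if "e \<in> B" "e' \<in> B" "e \<noteq> e'" for e e'
  proof -
    consider "e = f0" | "e' = f0" | "e \<noteq> f0" "e' \<noteq> f0" by blast
    then show ?thesis
    proof cases
      case 3
      have j: "jadj (swap B e e0) (swap B e' e0)"
        using jadj_swap_iff[of e B e' e0 e0] that e0B by simp
      then have "swap B e e0 \<noteq> swap B e' e0" by (metis jadj_irrefl)
      then show ?thesis unfolding k_def
        using chart_adj[OF s inA2[OF that(1) 3(1)] inA2[OF that(2) 3(2)]] j by simp
    qed (use kzA that k0 E_sym in metis)+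
  qed
  have kc: "\<not> coll (\<sigma> B) (k e) (k e')" if "e \<in> B" "e' \<in> B" "e \<noteq> e'" for e e'
  proof
    assume c: "coll (\<sigma> B) (k e) (k e')"
    consider "e = f0" | "e' = f0" | "e \<noteq> f0" "e' \<noteq> f0" by blast
    then show False
    proof cases
      case 1
      then show False using ncA[OF that(2)] that c coll_swap k0 by auto
    next
      case 2
      then show False using ncA[OF that(1)] that coll_swap[OF coll_sym[OF c]] k0 by auto
    next
      case 3
      \<comment> \<open>The line through \<open>\<sigma> B\<close> would contain three neighbors of
        \<open>\<sigma> A\<close>, hence \<open>\<sigma> A\<close> itself, contrary to
        \<open>ncA\<close>.\<close>
      have "coll (\<sigma> A) (\<sigma> B) (k e)"
        by (rule three_on_line[OF c])
          (use kz[OF that(1)] kz[OF that(2)] kE[OF that] kzA[OF that(1) 3(1)] kzA[OF that(2) 3(2)] zE in auto)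
      with ncA[OF that(1) 3(1)] show False by blast
    qed
  qed
  have rk: "r e0 = k f0" using r0 k0 by simp
  from grid_chart[where k = k, OF BJ z f0B e0B C(1,2) r rk kz kE kc]
  obtain \<tau> where t: "chart B \<tau>" "\<tau> B = \<sigma> B" "\<And>f. f \<in> S - B \<Longrightarrow> \<tau> (swap B f0 f) = r f"
    "\<And>e. e \<in> B \<Longrightarrow> \<tau> (swap B e e0) = k e" by blast
  have "compat A B \<sigma> \<tau>"
    unfolding compat_def
  proof
    fix F assume F: "F \<in> star A \<inter> star B"
    show "\<sigma> F = \<tau> F"
    proof (cases "F = B")
      case False
      then have FB: "F \<in> jn B" using F unfolding star_def by auto
      then obtain x y where xy: "x \<in> B" "y \<in> S - B" "F = swap B x y" by (rule jnE)
      have "F = A \<or> jadj A F" using F unfolding star_def jn_def by auto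
      then have "x = f0 \<or> y = e0"
      proof
        assume "F = A"
        then show ?thesis using xy Asw swap_eq_iff[of x B f0 y e0] f0B e0B by auto
      next
        assume "jadj A F"
        then show ?thesis using xy Asw jadj_swap_iff[of f0 B x e0 y] f0B e0B by auto
      qed
      then show ?thesis using t(3,4) xy unfolding r_def k_def by auto
    qed (use t in simp)
  qed
  with t(1) show thesis by (rule that)
qed

lemma chart_cong:
  assumes "A \<in> J" "chart A \<sigma>" "\<And>B. B \<in> star A \<Longrightarrow> \<tau> B = \<sigma> B"
  shows "chart A \<tau>"
proof -
  have "\<tau> A = \<sigma> A" "\<And>B. B \<in> jn A \<Longrightarrow> \<tau> B = \<sigma> B" using assms(3) unfolding star_def by auto
  moreover from this have "\<tau> ` jn A = \<sigma> ` jn A" by auto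
  moreover have "inj_on \<tau> (jn A) \<longleftrightarrow> inj_on \<sigma> (jn A)" by (rule inj_on_cong) fact
  ultimately show ?thesis using assms(2) unfolding chart_def by simp
qed


section \<open>Distance in the Johnson graph and gluing of charts\<close>

lemma card_diff_commute:
  assumes "A \<in> J" "B \<in> J" shows "card (B - A) = card (A - B)"
proof -
  have "card (A - B) + card (A \<inter> B) = m" "card (B - A) + card (A \<inter> B) = m"
    using assms J_finite J_card card_Diff_subset_Int[of A B] card_Diff_subset_Int[of B A]
      card_mono[of A "A \<inter> B"] card_mono[of B "A \<inter> B"]
    by (auto simp: Int_commute)
  then show ?thesis by linarith
qed

lemma closer_swap:
  assumes "B \<in> J" "A \<in> J" "h \<in> B - A" "e \<in> A - B"
  shows "swap B h e \<in> jn B" "card (A - B) = Suc (card (A - swap B h e))"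
proof -
  show "swap B h e \<in> jn B" using jn_swap[OF assms(1)] assms J_sub[OF assms(2)] by blast
  have "A - swap B h e = (A - B) - {e}" using assms by (auto simp: swap_def)
  then show "card (A - B) = Suc (card (A - swap B h e))"
    using assms J_finite[OF assms(2)] card_Suc_Diff1[of "A - B" e] by simp
qed

lemma pred_ex:
  assumes "B \<in> J" "A \<in> J" "A \<noteq> B"
  obtains h e where "h \<in> B - A" "e \<in> A - B"
proof -
  have "A - B \<noteq> {}" "B - A \<noteq> {}"
    using assms J_card[of A] J_card[of B] J_finite[of A] J_finite[of B]
    by (metis Diff_eq_empty_iff card_subset_eq)+
  then show thesis using that by blast
qed

text \<open>The neighbors of \<open>B\<close> nearer to \<open>A\<close> thus form a subgrid indexed
  by \<open>B - A\<close> and \<open>A - B\<close>; \<open>extend_pred\<close> walks through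
  it.\<close>

lemma pred_form:
  assumes B: "B \<in> J" and A: "A \<in> J" and C: "C \<in> jn B" and lt: "card (A - C) < card (A - B)"
  obtains h e where "h \<in> B - A" "e \<in> A - B" "C = swap B h e"
proof -
  obtain x y where xy: "x \<in> B" "y \<in> S - B" "C = swap B x y" using C by (rule jnE)
  have fin: "finite (A - C)" using J_finite[OF A] by simp
  have "y \<in> A"
  proof (rule ccontr)
    assume "y \<notin> A"
    then have "A - B \<subseteq> A - C" using xy by (auto simp: swap_def)
    from card_mono[OF fin this] lt show False by simp
  qed
  moreover have "x \<notin> A"
  proof
    assume "x \<in> A"
    then have "A - C = insert x (A - B - {y})" using xy \<open>y \<in> A\<close> by (auto simp: swap_def)
    moreover have "Suc (card (A - B - {y})) = card (A - B)"
      using card_Suc_Diff1[of "A - B" y] xy \<open>y \<in> A\<close> J_finite[OF A] by simp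
    moreover have "x \<notin> A - B - {y}" using xy by auto
    ultimately show False using lt J_finite[OF A] by simp
  qed
  ultimately show thesis using that xy by blast
qed

text \<open>A ball about \<open>A\<close>, because \<open>card (A - B)\<close> is the distance in
  the Johnson graph.\<close>

definition rad :: "'s set \<Rightarrow> nat \<Rightarrow> 's set set" where
  "rad A j = {B \<in> J. card (A - B) \<le> j}"

lemma rad_0: "A \<in> J \<Longrightarrow> rad A 0 = {A}"
proof (intro equalityI subsetI)
  fix B assume A: "A \<in> J" and "B \<in> rad A 0"
  then have B: "B \<in> J" "A \<subseteq> B" using J_finite[of A] unfolding rad_def by auto
  then have "A = B" using J_finite[of B] J_card[of B] J_card[OF A] by (intro card_subset_eq) auto
  then show "B \<in> {A}" by simp
qed (simp add: rad_def)

text \<open>The chart at \<open>B\<close> is transported from one predecessor. Adjacent predecessors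
  form a triangle with \<open>B\<close>, in which \<open>chart_flat\<close> passes compatibility
  from one to the other; at most two such moves in their subgrid reach any of them.\<close>

lemma extend_pred:
  assumes A: "A \<in> J" and B: "B \<in> J" and Bj: "card (A - B) = Suc j"
    and s: "\<And>C. C \<in> rad A j \<Longrightarrow> chart C (\<sigma> C)"
    and sc: "\<And>C D. C \<in> rad A j \<Longrightarrow> D \<in> rad A j \<Longrightarrow> jadj C D \<Longrightarrow> compat C D (\<sigma> C) (\<sigma> D)"
  obtains \<tau> where "chart B \<tau>" "\<And>C. C \<in> rad A j \<Longrightarrow> jadj C B \<Longrightarrow> compat C B (\<sigma> C) \<tau>"
proof -
  have "A \<noteq> B" using Bj by auto
  then obtain h0 e0 where he0: "h0 \<in> B - A" "e0 \<in> A - B" using pred_ex[OF B A] by blast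
  have pr: "swap B h e \<in> rad A j" "swap B h e \<in> jn B" if "h \<in> B - A" "e \<in> A - B" for h e
    using closer_swap[OF B A that] jn_J[OF closer_swap(1)[OF B A that]] Bj unfolding rad_def by simp_all
  let ?C0 = "swap B h0 e0"
  have "B \<in> jn ?C0" using jn_sym[OF B pr(2)[OF he0]] .
  then obtain \<tau> where t: "chart B \<tau>" "compat ?C0 B (\<sigma> ?C0) \<tau>"
    using transport[OF jn_J[OF pr(2)[OF he0]] s[OF pr(1)[OF he0]]] by blast
  have step: "compat C' B (\<sigma> C') \<tau>"
    if "C \<in> rad A j" "C' \<in> rad A j" "C \<in> jn B" "C' \<in> jn B" "jadj C C'" "compat C B (\<sigma> C) \<tau>" for C C'
  proof (rule chart_flat[of C C' B "\<sigma> C" "\<sigma> C'" \<tau>])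
    show "C \<in> J" "B \<in> jn C" using jn_J[OF that(3)] jn_sym[OF B that(3)] by simp_all
    show "C' \<in> jn C" using that(5) jn_J[OF that(4)] unfolding jn_def by simp
    show "jadj C' B" using jadj_sym[OF jn_jadj[OF that(4)]] .
    show "chart C (\<sigma> C)" "chart C' (\<sigma> C')" using s that(1,2) by blast+
    show "compat C C' (\<sigma> C) (\<sigma> C')" by (rule sc[OF that(1,2,5)])
  qed (fact t(1), fact that(6))
  have pp: "compat (swap B h e) B (\<sigma> (swap B h e)) \<tau>" if he: "h \<in> B - A" "e \<in> A - B" for h e
  proof -
    have 1: "compat (swap B h0 e) B (\<sigma> (swap B h0 e)) \<tau>"
    proof (cases "e = e0")
      case False
      then have "jadj (swap B h0 e0) (swap B h0 e)"
        using jadj_swap_iff[of h0 B h0 e0 e] he0 he by auto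
      then show ?thesis using step[OF pr(1)[OF he0] pr(1)[OF he0(1) he(2)] pr(2)[OF he0] pr(2)[OF he0(1) he(2)] _ t(2)]
        by blast
    qed (use t in simp)
    show ?thesis
    proof (cases "h = h0")
      case False
      then have "jadj (swap B h0 e) (swap B h e)"
        using jadj_swap_iff[of h0 B h e e] he0 he by auto
      then show ?thesis
        using step[OF pr(1)[OF he0(1) he(2)] pr(1)[OF he] pr(2)[OF he0(1) he(2)] pr(2)[OF he] _ 1]
        by blast
    qed (use 1 in simp)
  qed
  show thesis
  proof (rule that[OF t(1)])
    fix C assume C: "C \<in> rad A j" "jadj C B"
    then have CB: "C \<in> jn B" unfolding rad_def jn_def by (simp add: jadj_commute)
    from C(1) Bj have "card (A - C) < card (A - B)" unfolding rad_def by auto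
    from pred_form[OF B A CB this] obtain h e where "h \<in> B - A" "e \<in> A - B" "C = swap B h e" .
    then show "compat C B (\<sigma> C) \<tau>" using pp by blast
  qed
qed

text \<open>This handles edges inside a sphere: together with a common predecessor they form a
  triangle in which two sides are already compatible.\<close>

lemma common_pred:
  assumes A: "A \<in> J" and B: "B \<in> J" "card (A - B) = Suc j" and B': "B' \<in> jn B" "card (A - B') = Suc j"
  obtains C where "C \<in> rad A j" "C \<in> jn B" "C \<in> jn B'"
proof -
  have B'J: "B' \<in> J" using B' jn_J by blast
  obtain x y where xy: "x \<in> B" "y \<in> S - B" "B' = swap B x y" using B'(1) by (rule jnE)
  have "A \<noteq> B" using B by auto
  then obtain h e where he: "h \<in> B - A" "e \<in> A - B" using pred_ex[OF B(1) A] by blast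
  have iff: "x \<in> A \<longleftrightarrow> y \<in> A"
  proof -
    have 1: "\<not> (x \<in> A \<and> y \<notin> A)"
    proof
      assume "x \<in> A \<and> y \<notin> A"
      then have "A - B' = insert x (A - B)" "x \<notin> A - B" using xy by (auto simp: swap_def)
      then show False using B(2) B'(2) J_finite[OF A] by simp
    qed
    have 2: "\<not> (x \<notin> A \<and> y \<in> A)"
    proof
      assume "x \<notin> A \<and> y \<in> A"
      then have "A - B = insert y (A - B')" "y \<notin> A - B'" using xy by (auto simp: swap_def)
      then show False using B(2) B'(2) J_finite[OF A] by simp
    qed
    from 1 2 show ?thesis by blast
  qed
  have yx: "B' - A \<noteq> {}" by (metis B'(2) B'J A card_diff_commute card.empty nat.distinct(1))
  \<comment> \<open>If \<open>x\<close> and \<open>y\<close> lie outside \<open>A\<close>, both sets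
    trade theirs for \<open>e\<close>. If they lie in \<open>A\<close>, both sets trade
    \<open>h\<close> for the one that they lack.\<close>
  show thesis
  proof (cases "x \<in> A")
    case False
    then have "x \<in> B - A" "y \<notin> A" using xy iff by auto
    then have 1: "swap B x e \<in> jn B" "card (A - B) = Suc (card (A - swap B x e))"
      using closer_swap[OF B(1) A _ he(2)] by auto
    have y: "y \<in> B' - A" "e \<in> A - B'" using xy he \<open>y \<notin> A\<close> by (auto simp: swap_def)
    have eq: "swap B' y e = swap B x e" using xy he by (auto simp: swap_def)
    have "swap B x e \<in> jn B'" using closer_swap(1)[OF B'J A y] eq by simp
    with 1 B show thesis using that[of "swap B x e"] jn_J unfolding rad_def by auto
  next
    case True
    then have y: "y \<in> A - B" using iff xy by auto
    have 1: "swap B h y \<in> jn B" "card (A - B) = Suc (card (A - swap B h y))"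
      using closer_swap[OF B(1) A he(1) y] by auto
    have hx: "h \<in> B' - A" "x \<in> A - B'" using he xy True iff by (auto simp: swap_def)
    have eq: "swap B' h x = swap B h y" using xy he y True by (auto simp: swap_def)
    have "swap B h y \<in> jn B'" using closer_swap(1)[OF B'J A hx] eq by simp
    with 1 B show thesis using that[of "swap B h y"] jn_J unfolding rad_def by auto
  qed
qed

text \<open>Johnson graphs are simply connected modulo triangles: compatible charts extend
  from one ball around \<open>A\<close> to the next.\<close>

lemma charts_on_rad:
  assumes A: "A \<in> J" and z: "z \<in> V"
  shows "\<exists>\<sigma>. \<sigma> A A = z \<and> (\<forall>B\<in>rad A j. chart B (\<sigma> B)) \<and>
    (\<forall>B\<in>rad A j. \<forall>C\<in>rad A j. jadj B C \<longrightarrow> compat B C (\<sigma> B) (\<sigma> C))"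
proof (induction j)
  case 0
  obtain \<sigma>0 where "chart A \<sigma>0" "\<sigma>0 A = z" using base_chart[OF z A] .
  then show ?case unfolding rad_0[OF A] by (intro exI[of _ "\<lambda>_. \<sigma>0"]) auto
next
  case (Suc j)
  then obtain \<sigma> where s: "\<sigma> A A = z" "\<And>B. B \<in> rad A j \<Longrightarrow> chart B (\<sigma> B)"
    "\<And>B C. B \<in> rad A j \<Longrightarrow> C \<in> rad A j \<Longrightarrow> jadj B C \<Longrightarrow> compat B C (\<sigma> B) (\<sigma> C)" by blast
  define P where "P B \<tau> \<longleftrightarrow> chart B \<tau> \<and> (\<forall>C\<in>rad A j. jadj C B \<longrightarrow> compat C B (\<sigma> C) \<tau>)" for B \<tau>
  have ex: "\<exists>\<tau>. P B \<tau>" if "B \<in> J" "card (A - B) = Suc j" for B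
    using extend_pred[OF A that s(2,3)] unfolding P_def by metis
  define \<sigma>' where "\<sigma>' B = (if B \<in> rad A j then \<sigma> B else SOME \<tau>. P B \<tau>)" for B
  have new: "P B (\<sigma>' B)" if "B \<in> J" "card (A - B) = Suc j" for B
    using someI_ex[OF ex[OF that]] that unfolding \<sigma>'_def rad_def by auto
  have old: "\<sigma>' B = \<sigma> B" if "B \<in> rad A j" for B using that by (simp add: \<sigma>'_def)
  have split: "B \<in> rad A j \<or> (B \<in> J \<and> card (A - B) = Suc j)" if "B \<in> rad A (Suc j)" for B
    using that unfolding rad_def by auto
  have "\<sigma>' A A = z" using old[of A] s A unfolding rad_def by simp
  moreover have ch: "chart B (\<sigma>' B)" if "B \<in> rad A (Suc j)" for B
    using split[OF that] s(2) old new unfolding P_def by metis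
  moreover have "compat B C (\<sigma>' B) (\<sigma>' C)"
    if BC: "B \<in> rad A (Suc j)" "C \<in> rad A (Suc j)" "jadj B C" for B C
  proof -
    consider "B \<in> rad A j" "C \<in> rad A j" | "B \<in> rad A j" "C \<in> J" "card (A - C) = Suc j"
      | "C \<in> rad A j" "B \<in> J" "card (A - B) = Suc j"
      | "B \<in> J" "card (A - B) = Suc j" "C \<in> J" "card (A - C) = Suc j"
      using split[OF BC(1)] split[OF BC(2)] by blast
    then show ?thesis
    proof cases
      case 1
      then show ?thesis using s(3) old BC by simp
    next
      case 2
      then show ?thesis using new[OF 2(2,3)] old[OF 2(1)] BC(3) unfolding P_def by simp
    next
      case 3
      then show ?thesis using new[OF 3(2,3)] old[OF 3(1)] BC(3) unfolding P_def
        by (simp add: jadj_commute compat_sym)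
    next
      case 4
      have CB: "C \<in> jn B" using 4 BC unfolding jn_def by simp
      obtain D where D: "D \<in> rad A j" "D \<in> jn B" "D \<in> jn C"
        using common_pred[OF A 4(1,2) CB 4(4)] .
      have DJ: "D \<in> J" using D jn_J by blast
      show ?thesis
      proof (rule chart_flat[OF DJ jn_sym[OF 4(1) D(2)] jn_sym[OF 4(3) D(3)] BC(3)])
        show "chart D (\<sigma> D)" using s D by blast
        show "chart B (\<sigma>' B)" "chart C (\<sigma>' C)" using ch BC by blast+
        show "compat D B (\<sigma> D) (\<sigma>' B)" "compat D C (\<sigma> D) (\<sigma>' C)"
          using new[OF 4(1,2)] new[OF 4(3,4)] D jn_jadj[OF D(2)] jn_jadj[OF D(3)] jadj_sym
          unfolding P_def by blast+
      qed
    qed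
  qed
  ultimately show ?case by blast
qed

text \<open>Compatible charts at \<open>B\<close> and at a neighbor \<open>C\<close> agree at
  \<open>C\<close>, so their values at the centres alone define one map that is a chart
  everywhere.\<close>

lemma covering_ex:
  assumes A: "A \<in> J" and z: "z \<in> V"
  obtains \<phi> where "\<phi> A = z" "\<And>B. B \<in> J \<Longrightarrow> chart B \<phi>"
proof -
  have radm: "rad A m = J" unfolding rad_def using J_card[OF A] J_finite[OF A] by (auto intro: card_mono)
  obtain \<sigma> where s: "\<sigma> A A = z" "\<And>B. B \<in> J \<Longrightarrow> chart B (\<sigma> B)"
    "\<And>B C. B \<in> J \<Longrightarrow> C \<in> J \<Longrightarrow> jadj B C \<Longrightarrow> compat B C (\<sigma> B) (\<sigma> C)"
    using charts_on_rad[OF A z, of m] unfolding radm by blast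
  show thesis
  proof (rule that[of "\<lambda>B. \<sigma> B B"])
    fix B assume B: "B \<in> J"
    show "chart B (\<lambda>B. \<sigma> B B)"
    proof (rule chart_cong[OF B s(2)[OF B]])
      fix C assume C: "C \<in> star B"
      show "\<sigma> C C = \<sigma> B C"
      proof (cases "C = B")
        case False
        then have "C \<in> jn B" using C unfolding star_def by auto
        then have "compat B C (\<sigma> B) (\<sigma> C)" "C \<in> star B \<inter> star C"
          using s(3)[OF B jn_J jn_jadj] C unfolding star_def by auto
        then show ?thesis unfolding compat_def by metis
      qed simp
    qed
  qed fact
qed

end

section \<open>Injectivity of the covering\<close>

text \<open>\<open>C\<close> is grown along the cycles of \<open>g\<close>: an image that has left
  \<open>C\<close> is the next element to be added, and if there is none, any new element will
  do.\<close>

lemma perm_almost_invariant: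
  assumes g: "g ` S \<subseteq> S" and fin: "finite S" and inj: "inj_on g S" and j: "j \<le> card S"
  shows "\<exists>C\<subseteq>S. card C = j \<and> card (g ` C - C) \<le> 1"
  using j
proof (induction j)
  case 0
  then show ?case by (intro exI[of _ "{}"]) auto
next
  case (Suc j)
  then obtain C where C: "C \<subseteq> S" "card C = j" "card (g ` C - C) \<le> 1" by auto
  have finC: "finite C" using C fin finite_subset by blast
  have "\<exists>x\<in>S - C. g ` C - C \<subseteq> {x}"
  proof (cases "g ` C - C = {}")
    case True
    have "C \<noteq> S" using C Suc.prems by auto
    then show ?thesis using C(1) True by blast
  next
    case False
    then have "card (g ` C - C) = 1" using C(3) finC by (simp add: le_Suc_eq)
    then obtain x where "g ` C - C = {x}" by (auto simp: card_1_singleton_iff)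
    then show ?thesis using g C(1) by blast
  qed
  then obtain x where x: "x \<in> S - C" "g ` C - C \<subseteq> {x}" by blast
  have "g ` insert x C - insert x C \<subseteq> {g x}" using x(2) by auto
  then have "card (g ` insert x C - insert x C) \<le> 1"
    using card_mono[of "{g x}"] by fastforce
  then show ?case using x C finC by (intro exI[of _ "insert x C"]) auto
qed

text \<open>If the almost invariant set is invariant, one element is exchanged so that a point moved
  by \<open>g\<close> enters or leaves; this raises the displacement from 0 to 1 or 2. The strict
  bounds on \<open>card A\<close> leave room for the exchange.\<close>

lemma perm_small_displacement:
  assumes g: "bij_betw g S S" and fin: "finite S" and A: "A \<subseteq> S" "0 < card A" "card A < card S" "g ` A \<noteq> A"
  obtains C where "C \<subseteq> S" "card C = card A" "card (g ` C - C) = 1 \<or> card (g ` C - C) = 2"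
proof -
  have inj: "inj_on g S" and gS: "g ` S = S" using g by (auto simp: bij_betw_def)
  obtain C where C: "C \<subseteq> S" "card C = card A" "card (g ` C - C) \<le> 1"
    using perm_almost_invariant[of g S "card A"] gS fin inj A by auto
  have finC: "finite C" using C fin finite_subset by blast
  show thesis
  proof (cases "card (g ` C - C) = 1")
    case True
    then show ?thesis using that C by blast
  next
    case False
    then have "g ` C - C = {}" using C(3) finC by (simp add: le_Suc_eq)
    moreover have "card (g ` C) = card C" using inj C by (intro card_image) (blast intro: inj_on_subset)
    ultimately have gC: "g ` C = C" using finC by (intro card_subset_eq) auto
    obtain y where y: "y \<in> A" "g y \<noteq> y"
    proof (rule ccontr)
      assume "\<not> thesis"
      then have "\<And>y. y \<in> A \<Longrightarrow> g y = y" using that by blast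
      then have "g ` A = A" by force
      then show False using A by blast
    qed
    have yS: "y \<in> S" using y A by blast
    have two: "thesis" if "C' \<subseteq> S" "card C' = card A" "g ` C' - C' \<subseteq> {p, q}" "p \<in> g ` C' - C'" for C' p q
    proof -
      have "card (g ` C' - C') \<le> card {p, q}" by (rule card_mono) (use that in auto)
      also have "\<dots> \<le> 2" by (simp add: card_insert_if)
      finally have "card (g ` C' - C') \<le> 2" .
      moreover have "card (g ` C' - C') \<noteq> 0"
        using that(3,4) finite_subset[OF that(3)] by auto
      ultimately have "card (g ` C' - C') = 1 \<or> card (g ` C' - C') = 2" by linarith
      then show thesis using \<open>\<And>C. C \<subseteq> S \<Longrightarrow> card C = card A \<Longrightarrow> card (g ` C - C) = 1 \<or> card (g ` C - C) = 2 \<Longrightarrow> thesis\<close>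
          that(1,2) by blast
    qed
    show thesis
    proof (cases "y \<in> C")
      case True
      have "C \<noteq> S" using C A by auto
      then obtain x where x: "x \<in> S" "x \<notin> C" using C(1) by blast
      obtain y' where y': "y' \<in> C" "y = g y'" using gC True by blast
      show thesis
      proof (rule two)
        show "insert x (C - {y}) \<subseteq> S" using x C by blast
        show "card (insert x (C - {y})) = card A"
          using x True finC C(2) A(2) by (simp add: card_Diff_singleton)
        show "g ` insert x (C - {y}) - insert x (C - {y}) \<subseteq> {y, g x}" using gC by blast
        have "y' \<noteq> y" using y y' by auto
        then show "y \<in> g ` insert x (C - {y}) - insert x (C - {y})" using y' x True by blast
      qed
    next
      case False
      have "C \<noteq> {}" using C A by auto
      then obtain x where x: "x \<in> C" by blast
      have gy: "g y \<notin> C"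
      proof
        assume "g y \<in> C"
        then obtain w where "w \<in> C" "g y = g w" using gC by blast
        then show False using inj_onD[OF inj, of y w] yS C(1) False by blast
      qed
      show thesis
      proof (rule two)
        show "insert y (C - {x}) \<subseteq> S" using yS C by blast
        show "card (insert y (C - {x})) = card A"
          using x False finC C(2) A(2) by (simp add: card_Diff_singleton)
        show "g ` insert y (C - {x}) - insert y (C - {x}) \<subseteq> {g y, x}" using gC by blast
        show "g y \<in> g ` insert y (C - {x}) - insert y (C - {x})" using y gy by blast
      qed
    qed
  qed
qed

section \<open>Rigidity and deck transformations of coverings\<close>

context johnson_charts begin

lemma J_connected:
  assumes A: "A \<in> J" and PA: "P A" and step: "\<And>B C. B \<in> J \<Longrightarrow> P B \<Longrightarrow> C \<in> jn B \<Longrightarrow> P C" and B: "B \<in> J"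
  shows "P B"
  using B
proof (induction "card (A - B)" arbitrary: B)
  case 0
  then have "B \<in> rad A 0" unfolding rad_def by simp
  then show ?case using rad_0[OF A] PA by simp
next
  case (Suc j)
  then have "A \<noteq> B" by auto
  then obtain h e where he: "h \<in> B - A" "e \<in> A - B" using pred_ex[OF Suc(3) A] by blast
  note sw = closer_swap[OF Suc(3) A he]
  then have "P (swap B h e)" using Suc(1)[of "swap B h e"] Suc(2) jn_J[OF sw(1)] by simp
  then show ?case using step[OF jn_J[OF sw(1)] _ jn_sym[OF Suc(3) sw(1)]] by blast
qed

text \<open>The analogue of unique lifting: \<open>chart_unique\<close> carries agreement on a star
  to the stars of all neighbors, and the Johnson graph is connected.\<close>

lemma cover_agree:
  assumes f: "\<And>B. B \<in> J \<Longrightarrow> chart B \<phi>" and p: "\<And>B. B \<in> J \<Longrightarrow> chart B \<psi>"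
    and A: "A \<in> J" and eq: "\<And>F. F \<in> star A \<Longrightarrow> \<phi> F = \<psi> F" and B: "B \<in> J"
  shows "\<phi> B = \<psi> B"
proof -
  have "\<forall>F\<in>star B. \<phi> F = \<psi> F"
  proof (rule J_connected[OF A _ _ B])
    fix B C assume B: "B \<in> J" and e: "\<forall>F\<in>star B. \<phi> F = \<psi> F" and C: "C \<in> jn B"
    have CJ: "C \<in> J" using C jn_J by blast
    have CB: "\<phi> C = \<psi> C" "\<phi> B = \<psi> B" using e C unfolding star_def by auto
    show "\<forall>F\<in>star C. \<phi> F = \<psi> F"
    proof
      fix F assume "F \<in> star C"
      then consider "F = C" | "F \<in> jn C" unfolding star_def by blast
      then show "\<phi> F = \<psi> F"
      proof cases
        case 2
        show ?thesis
          by (rule chart_unique[OF CJ f[OF CJ] p[OF CJ] jn_sym[OF B C] CB _ 2])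
            (use e in \<open>auto simp: star_def\<close>)
      qed (use CB in simp)
    qed
  qed (use eq in blast)
  then show ?thesis unfolding star_def by blast
qed

text \<open>A permutation of \<open>S\<close> acts on the Johnson graph by automorphisms and
  permutes the labels of lines, so composing a covering with it gives another covering.\<close>

lemma chart_perm:
  assumes g: "bij_betw g S S" and C: "C \<in> J" and ch: "chart (g ` C) \<phi>"
  shows "chart C (\<lambda>F. \<phi> (g ` F))"
proof -
  have inj: "inj_on g S" and gS: "g ` S = S" using g by (auto simp: bij_betw_def)
  note CS = J_sub[OF C]
  have diff: "g ` X - g ` Y = g ` (X - Y)" if "X \<subseteq> S" "Y \<subseteq> S" for X Y
    using inj_on_image_set_diff[OF inj, of X Y] that by auto
  have eqI: "g ` X = g ` Y \<longleftrightarrow> X = Y" if "X \<subseteq> S" "Y \<subseteq> S" for X Y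
    using inj_on_image_eq_iff[OF inj that] .
  have swapI: "g ` swap X e f = swap (g ` X) (g e) (g f)" if "X \<subseteq> S" "e \<in> X" for X e f
    using diff[of X "{e}"] that by (auto simp: swap_def)
  have gJ: "g ` C \<in> J" using C gS inj card_image[OF inj_on_subset[OF inj CS]] unfolding J_def by auto
  have im: "(`) g ` jn C = jn (g ` C)"
  proof (intro equalityI subsetI)
    fix F assume "F \<in> (`) g ` jn C"
    then obtain G where G: "G \<in> jn C" "F = g ` G" by blast
    from G(1) obtain e f where ef: "e \<in> C" "f \<in> S - C" "G = swap C e f" by (rule jnE)
    have "g f \<notin> g ` C" using inj ef CS by (meson DiffD1 DiffD2 inj_on_image_mem_iff)
    then have "swap (g ` C) (g e) (g f) \<in> jn (g ` C)" using jn_swap[OF gJ, of "g e" "g f"] ef gS by blast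
    then show "F \<in> jn (g ` C)" using swapI[OF CS ef(1)] G ef by simp
  next
    fix F assume "F \<in> jn (g ` C)"
    then obtain e' f' where *: "e' \<in> g ` C" "f' \<in> S - g ` C" "F = swap (g ` C) e' f'" by (rule jnE)
    then obtain e f where ef: "e \<in> C" "e' = g e" "f \<in> S" "f' = g f" using gS by blast
    then have "f \<in> S - C" using * by blast
    then have "swap C e f \<in> jn C" using jn_swap[OF C ef(1)] by blast
    moreover have "F = g ` swap C e f" using * ef swapI[OF CS ef(1)] by simp
    ultimately show "F \<in> (`) g ` jn C" by blast
  qed
  have sub: "B \<subseteq> S" if "B \<in> jn C" for B using jn_J[OF that] J_sub by blast
  have in': "g ` B \<in> jn (g ` C)" if "B \<in> jn C" for B using im that by blast
  have jadjg: "jadj (g ` X) (g ` Y) \<longleftrightarrow> jadj X Y" if "X \<subseteq> S" "Y \<subseteq> S" for X Y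
  proof -
    have c: "is_singleton (g ` Z) \<longleftrightarrow> is_singleton Z" if "Z \<subseteq> S" for Z
      using card_image[OF inj_on_subset[OF inj that]] by (simp add: is_singleton_altdef)
    have j: "jadj P Q \<longleftrightarrow> is_singleton (P - Q) \<and> is_singleton (Q - P)" for P Q :: "'s set"
      unfolding jadj_def is_singleton_def by blast
    show ?thesis unfolding j diff[OF that] diff[OF that(2,1)]
      using c[of "X - Y"] c[of "Y - X"] that by blast
  qed
  show ?thesis
    unfolding chart_def
  proof (intro conjI ballI impI)
    show "\<phi> (g ` C) \<in> V" by (rule chart_V[OF ch])
    show "(\<lambda>F. \<phi> (g ` F)) ` jn C = {y. E (\<phi> (g ` C)) y}"
      using chart_image[OF ch] im by (metis image_image)
    show "inj_on (\<lambda>F. \<phi> (g ` F)) (jn C)"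
    proof (rule inj_onI)
      fix F G assume *: "F \<in> jn C" "G \<in> jn C" "\<phi> (g ` F) = \<phi> (g ` G)"
      then have "g ` F = g ` G" using chart_inj[OF ch in' in'] by blast
      then show "F = G" using eqI[OF sub sub] * by blast
    qed
    fix F G assume *: "F \<in> jn C" "G \<in> jn C"
    show "E (\<phi> (g ` F)) (\<phi> (g ` G)) \<longleftrightarrow> jadj F G" if "F \<noteq> G"
      using chart_adj[OF ch in'[OF *(1)] in'[OF *(2)]] jadjg[OF sub sub, OF *] eqI[OF sub sub, OF *] that
      by simp
    show "coll (\<phi> (g ` C)) (\<phi> (g ` F)) (\<phi> (g ` G)) \<longleftrightarrow> C - F = C - G"
      unfolding chart_coll[OF ch in'[OF *(1)] in'[OF *(2)]] diff[OF CS sub[OF *(1)]] diff[OF CS sub[OF *(2)]]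
      using eqI[of "C - F" "C - G"] CS by blast
  qed
qed

text \<open>The two charts at the common image of \<open>A\<close> and \<open>B\<close> label its lines in two ways; comparing the
  labels gives the permutation.\<close>

lemma deck_transformation:
  assumes f: "\<And>B. B \<in> J \<Longrightarrow> chart B \<phi>" and A: "A \<in> J" and B: "B \<in> J" and AB: "\<phi> A = \<phi> B"
  obtains g where "bij_betw g S S" "g ` A = B" "\<And>C. C \<in> J \<Longrightarrow> \<phi> (g ` C) = \<phi> C"
proof -
  note a = f[OF A] and b = f[OF B]
  \<comment> \<open>The transition map between the two charts: \<open>T F\<close> is the neighbor of
    \<open>B\<close> over the same vertex as \<open>F\<close>.\<close>
  define T where "T F = (SOME G. G \<in> jn B \<and> \<phi> G = \<phi> F)" for F
  have "\<exists>G. G \<in> jn B \<and> \<phi> G = \<phi> F" if "F \<in> jn A" for F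
    using chart_surj[OF b, of "\<phi> F"] chart_nbr[OF a that] AB by auto
  then have T: "T F \<in> jn B" "\<phi> (T F) = \<phi> F" if "F \<in> jn A" for F
    unfolding T_def using someI_ex[of "\<lambda>G. G \<in> jn B \<and> \<phi> G = \<phi> F"] that by blast+
  have Tc: "B - T F = B - T G \<longleftrightarrow> A - F = A - G" if "F \<in> jn A" "G \<in> jn A" for F G
    using chart_coll[OF a that] chart_coll[OF b T(1)[OF that(1)] T(1)[OF that(2)]] T(2) that AB by simp
  have Tinj: "T F = T G \<longleftrightarrow> F = G" if "F \<in> jn A" "G \<in> jn A" for F G
    using chart_inj[OF a that] T(2) that by metis
  have Tj: "jadj (T F) (T G) \<longleftrightarrow> jadj F G" if "F \<in> jn A" "G \<in> jn A" for F G
  proof (cases "F = G")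
    case False
    then show ?thesis
      using chart_adj[OF a that] chart_adj[OF b T(1)[OF that(1)] T(1)[OF that(2)]] T(2) Tinj[OF that] that
      by simp
  qed simp
  obtain e1 where e1: "e1 \<in> A" using J_card[OF A] m_pos by fastforce
  obtain f1 where f1: "f1 \<in> S - A" using card_S_diff[OF A] n_pos by (metis all_not_in_conv card.empty less_not_refl)
  \<comment> \<open>A point of \<open>A\<close> labels a line and is read off from the element
    removed; a point outside \<open>A\<close> labels a position and is read off from the element
    added. The references \<open>e1\<close> and \<open>f1\<close> are arbitrary, and
    \<open>gT\<close> shows that they do not influence the result.\<close>
  define g where "g x = (if x \<in> A then the_elem (B - T (swap A x f1)) else the_elem (T (swap A e1 x) - B))" for x
  note sw = jn_swap[OF A]
  have form: "\<exists>p q. p \<in> B \<and> q \<in> S - B \<and> T F = swap B p q" if "F \<in> jn A" for F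
    using jnE[OF T(1)[OF that]] by metis
  \<comment> \<open>Two points of one column are adjacent without sharing a line. \<open>T\<close>
    preserves both facts, so in the grid at \<open>B\<close> their images agree in the element
    added.\<close>
  have rowc: "T (swap A e f) - B = T (swap A e' f) - B" if "e \<in> A" "e' \<in> A" "f \<in> S - A" for e e' f
  proof (cases "e = e'")
    case False
    from form[OF sw[OF that(1,3)]]
    obtain p q where pq: "p \<in> B" "q \<in> S - B" "T (swap A e f) = swap B p q" by blast
    from form[OF sw[OF that(2,3)]]
    obtain p' q' where pq': "p' \<in> B" "q' \<in> S - B" "T (swap A e' f) = swap B p' q'" by blast
    have "jadj (swap A e f) (swap A e' f)" using jadj_swap_iff[of e A e' f f] that False by auto
    then have "jadj (swap B p q) (swap B p' q')" using Tj[OF sw[OF that(1,3)] sw[OF that(2,3)]] pq pq' by simp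
    then have x: "(p = p') \<noteq> (q = q')" using jadj_swap_iff[of p B p' q q'] pq pq' by auto
    have "A - swap A e f \<noteq> A - swap A e' f" using swap_minus(1)[of e A f] swap_minus(1)[of e' A f] that False by auto
    then have "B - swap B p q \<noteq> B - swap B p' q'"
      using Tc[OF sw[OF that(1,3)] sw[OF that(2,3)]] pq pq' by simp
    then have "p \<noteq> p'" using swap_minus(1)[of p B q] swap_minus(1)[of p' B q'] pq pq' by auto
    then have "q = q'" using x by blast
    then show ?thesis using pq pq' swap_minus(2)[of p B q] swap_minus(2)[of p' B q'] by auto
  qed simp
  have gT: "g e \<in> B \<and> g f \<in> S - B \<and> T (swap A e f) = swap B (g e) (g f)" if "e \<in> A" "f \<in> S - A" for e f
  proof -
    from form[OF sw[OF that]]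
    obtain p q where pq: "p \<in> B" "q \<in> S - B" "T (swap A e f) = swap B p q" by blast
    have 1: "B - T (swap A e f) = {p}" "T (swap A e f) - B = {q}"
      using pq swap_minus[of p B q] by auto
    have "A - swap A e f1 = A - swap A e f" using swap_minus(1)[of e A f] swap_minus(1)[of e A f1] that f1 by auto
    then have "B - T (swap A e f1) = {p}" using Tc[OF sw[OF that(1) f1] sw[OF that]] 1 by simp
    moreover have "T (swap A e1 f) - B = {q}" using rowc[OF e1 that] 1 by simp
    ultimately have "g e = p" "g f = q" using that by (auto simp: g_def)
    then show ?thesis using pq by simp
  qed
  have gA: "g e \<in> B" if "e \<in> A" for e using gT[OF that f1] by blast
  have gSA: "g f \<in> S - B" if "f \<in> S - A" for f using gT[OF e1 that] by blast
  have ginjA: "e = e'" if "g e = g e'" "e \<in> A" "e' \<in> A" for e e'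
  proof -
    have "T (swap A e f1) = T (swap A e' f1)" using gT[OF that(2) f1] gT[OF that(3) f1] that(1) by simp
    then show ?thesis using Tinj[OF sw[OF that(2) f1] sw[OF that(3) f1]] swap_eq_iff[of e A e' f1 f1] that f1 by auto
  qed
  have ginjS: "e = e'" if "g e = g e'" "e \<in> S - A" "e' \<in> S - A" for e e'
  proof -
    have "T (swap A e1 e) = T (swap A e1 e')" using gT[OF e1 that(2)] gT[OF e1 that(3)] that(1) by simp
    then show ?thesis using Tinj[OF sw[OF e1 that(2)] sw[OF e1 that(3)]] swap_eq_iff[of e1 A e1 e e'] that e1 by auto
  qed
  have inj: "inj_on g S"
  proof (rule inj_onI)
    fix x y assume *: "x \<in> S" "y \<in> S" "g x = g y"
    show "x = y"
      using ginjA[OF *(3)] ginjS[OF *(3)] gA[of x] gA[of y] gSA[of x] gSA[of y] * by fastforce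
  qed
  have "g ` S \<subseteq> S" using gA gSA J_sub[OF B] by (metis DiffI DiffD1 image_subsetI subsetD)
  then have bij: "bij_betw g S S" using inj finite_S by (simp add: bij_betw_def endo_inj_surj)
  have gAB: "g ` A = B"
  proof (rule card_subset_eq)
    show "finite B" by (rule J_finite[OF B])
    show "g ` A \<subseteq> B" using gA by blast
    show "card (g ` A) = card B" using card_image[OF inj_on_subset[OF inj J_sub[OF A]]] J_card A B by simp
  qed
  have gJ: "g ` C \<in> J" if "C \<in> J" for C
    using that bij card_image[OF inj_on_subset[OF inj J_sub[OF that]]] unfolding J_def bij_betw_def by auto
  have star: "\<phi> (g ` F) = \<phi> F" if "F \<in> star A" for F
  proof (cases "F = A")
    case False
    then have F: "F \<in> jn A" using that unfolding star_def by blast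
    then obtain e f where ef: "e \<in> A" "f \<in> S - A" "F = swap A e f" by (rule jnE)
    have "g ` (A - {e}) = g ` A - g ` {e}"
      using inj_on_image_set_diff[OF inj, of A "{e}"] J_sub[OF A] ef by auto
    then have "g ` F = swap B (g e) (g f)" using ef gAB by (auto simp: swap_def)
    then have "g ` F = T F" using gT[OF ef(1,2)] ef by simp
    then show ?thesis using T(2)[OF F] by simp
  qed (use gAB AB in simp)
  have "\<phi> (g ` C) = \<phi> C" if "C \<in> J" for C
    by (rule cover_agree[of "\<lambda>F. \<phi> (g ` F)" \<phi> A C])
      (use chart_perm[OF bij _ f[OF gJ]] f A star that in blast)+
  with bij gAB show thesis by (rule that)
qed

text \<open>A deck transformation keeps images. So a set moved by distance 1 would have the same
  image as one of its neighbors, and a set moved by distance 2 the same image as another neighbor of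
  a set in between; charts forbid both.\<close>

lemma cover_inj:
  assumes f: "\<And>B. B \<in> J \<Longrightarrow> chart B \<phi>" and A: "A \<in> J" and B: "B \<in> J" and AB: "\<phi> A = \<phi> B"
  shows "A = B"
proof (rule ccontr)
  assume ne: "A \<noteq> B"
  obtain g where g: "bij_betw g S S" "g ` A = B" "\<And>C. C \<in> J \<Longrightarrow> \<phi> (g ` C) = \<phi> C"
    using deck_transformation[OF f A B AB] by blast
  obtain C where C: "C \<subseteq> S" "card C = card A" "card (g ` C - C) = 1 \<or> card (g ` C - C) = 2"
    using perm_small_displacement[OF g(1) finite_S J_sub[OF A]] J_card[OF A] card_S m_pos n_pos g(2) ne by auto
  have CJ: "C \<in> J" using C J_card[OF A] unfolding J_def by auto
  have inj: "inj_on g S" and gS: "g ` S = S" using g by (auto simp: bij_betw_def)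
  have gCJ: "g ` C \<in> J"
    using CJ gS card_image[OF inj_on_subset[OF inj C(1)]] unfolding J_def by auto
  note sy = card_diff_commute[OF CJ gCJ]
  from C(3) show False
  proof
    assume 1: "card (g ` C - C) = 1"
    with sy have "card (C - g ` C) = 1" by simp
    with 1 have "jadj C (g ` C)" unfolding jadj_def by (meson card_1_singletonE)
    then have "g ` C \<in> jn C" using gCJ unfolding jn_def by simp
    then show False using chart_nbr[OF f[OF CJ]] g(3)[OF CJ] by fastforce
  next
    assume 2: "card (g ` C - C) = 2"
    then obtain e e' where e: "g ` C - C = {e, e'}" "e \<noteq> e'" by (auto simp: card_2_iff)
    from 2 sy obtain h h' where h: "C - g ` C = {h, h'}" "h \<noteq> h'" by (auto simp: card_2_iff)
    have D: "swap C h e \<in> jn C" using jn_swap[OF CJ, of h e] e h J_sub[OF gCJ] by blast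
    have "g ` C - swap C h e = {e'}" "swap C h e - g ` C = {h'}" using e h unfolding swap_def by blast+
    then have "jadj (swap C h e) (g ` C)" unfolding jadj_def by blast
    then have D2: "g ` C \<in> jn (swap C h e)" using gCJ unfolding jn_def by simp
    have "g ` C = C"
      by (rule chart_inj[OF f[OF jn_J[OF D]] D2 jn_sym[OF CJ D] g(3)[OF CJ]])
    then show False using 2 by simp
  qed
qed

theorem johnson_iso:
  assumes conn: "\<And>x y. x \<in> V \<Longrightarrow> y \<in> V \<Longrightarrow> E\<^sup>*\<^sup>* x y" and ne: "V \<noteq> {}"
  obtains \<phi> where "bij_betw \<phi> J V" "\<And>A B. A \<in> J \<Longrightarrow> B \<in> J \<Longrightarrow> E (\<phi> A) (\<phi> B) \<longleftrightarrow> jadj A B"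
proof -
  obtain z where z: "z \<in> V" using ne by blast
  obtain A where "A \<subseteq> S" "card A = m"
    using obtain_subset_with_card_n[of m S] card_S by auto
  then have A: "A \<in> J" unfolding J_def by simp
  obtain \<phi> where p: "\<phi> A = z" "\<And>B. B \<in> J \<Longrightarrow> chart B \<phi>" using covering_ex[OF A z] by blast
  have inj: "inj_on \<phi> J" by (rule inj_onI) (use cover_inj[OF p(2)] in blast)
  have surj: "y \<in> \<phi> ` J" if "y \<in> V" for y
    using conn[OF z that]
  proof (induction rule: rtranclp_induct)
    case base
    then show ?case using p(1) A by blast
  next
    case (step u w)
    then obtain B where B: "B \<in> J" "u = \<phi> B" by blast
    then obtain C where "C \<in> jn B" "\<phi> C = w" using chart_surj[OF p(2)[OF B(1)]] step by blast
    then show ?case using jn_J by blast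
  qed
  have "bij_betw \<phi> J V" unfolding bij_betw_def using inj surj chart_V[OF p(2)] by blast
  moreover have "E (\<phi> B) (\<phi> C) \<longleftrightarrow> jadj B C" if BC: "B \<in> J" "C \<in> J" for B C
  proof
    assume "jadj B C"
    then show "E (\<phi> B) (\<phi> C)" using chart_nbr[OF p(2)[OF BC(1)]] BC unfolding jn_def by blast
  next
    assume "E (\<phi> B) (\<phi> C)"
    then obtain D where D: "D \<in> jn B" "\<phi> D = \<phi> C" using chart_surj[OF p(2)[OF BC(1)]] by blast
    then have "D = C" using inj_onD[OF inj D(2)] jn_J BC by blast
    then show "jadj B C" using D jn_jadj by blast
  qed
  ultimately show thesis by (rule that)
qed

end

section \<open>Cosine sequences of distance-regular graphs\<close>

text \<open>Distance enters only as a function to the naturals: \<open>D_step\<close> is the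
  triangle inequality across an edge, and \<open>D_pred\<close> the existence of shortest
  paths.\<close>

locale drg =
  fixes V :: "'a set" and E :: "'a \<Rightarrow> 'a \<Rightarrow> bool" and D :: "'a \<Rightarrow> 'a \<Rightarrow> nat"
    and d :: nat and a b c :: "nat \<Rightarrow> nat"
  assumes finite_V: "finite V"
    and E_sym: "E x y \<Longrightarrow> E y x"
    and E_irrefl [simp]: "\<not> E x x"
    and E_V: "E x y \<Longrightarrow> x \<in> V"
    and D_zero: "x \<in> V \<Longrightarrow> y \<in> V \<Longrightarrow> D x y = 0 \<longleftrightarrow> x = y"
    and D_one: "x \<in> V \<Longrightarrow> y \<in> V \<Longrightarrow> D x y = 1 \<longleftrightarrow> E x y"
    and D_sym: "x \<in> V \<Longrightarrow> y \<in> V \<Longrightarrow> D x y = D y x"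
    and D_step: "x \<in> V \<Longrightarrow> E y z \<Longrightarrow> D x z \<le> Suc (D x y)"
    and D_pred: "x \<in> V \<Longrightarrow> y \<in> V \<Longrightarrow> D x y = Suc i \<Longrightarrow> \<exists>z. E y z \<and> D x z = i"
    and D_le: "x \<in> V \<Longrightarrow> y \<in> V \<Longrightarrow> D x y \<le> d"
    and D_att: "\<exists>x\<in>V. \<exists>y\<in>V. D x y = d"
    and num_c: "x \<in> V \<Longrightarrow> y \<in> V \<Longrightarrow> card {u. E y u \<and> Suc (D x u) = D x y} = c (D x y)"
    and num_a: "x \<in> V \<Longrightarrow> y \<in> V \<Longrightarrow> card {u. E y u \<and> D x u = D x y} = a (D x y)"
    and num_b: "x \<in> V \<Longrightarrow> y \<in> V \<Longrightarrow> card {u. E y u \<and> D x u = Suc (D x y)} = b (D x y)"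
    and d_ge_2: "d \<ge> 2"
begin

lemma E_V2: "E x y \<Longrightarrow> y \<in> V"
  using E_sym E_V by blast

lemma E_commute: "E x y \<longleftrightarrow> E y x"
  using E_sym by blast

lemma finite_nbr: "finite {y. E x y}"
  using finite_V E_V2 by (auto intro: finite_subset)

lemma finite_nbr': "finite {y. E x y \<and> Q y}"
  by (rule finite_subset[OF _ finite_nbr]) auto

lemma D_refl [simp]: "x \<in> V \<Longrightarrow> D x x = 0"
  using D_zero by blast

lemma D_step': "x \<in> V \<Longrightarrow> E y z \<Longrightarrow> D x y \<le> Suc (D x z)"
  using D_step E_sym by blast

text \<open>The neighbors of \<open>y\<close> lie in three consecutive spheres about
  \<open>x\<close>. At distance 0 the truncated \<open>D x y - 1\<close> is harmless, because its
  coefficient \<open>c 0\<close> counts an empty set.\<close>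

lemma nbr_sum:
  fixes F :: "nat \<Rightarrow> real"
  assumes x: "x \<in> V" "y \<in> V"
  shows "(\<Sum>z | E y z. F (D x z)) =
    c (D x y) * F (D x y - 1) + a (D x y) * F (D x y) + b (D x y) * F (Suc (D x y))"
proof -
  let ?i = "D x y"
  let ?C = "{u. E y u \<and> Suc (D x u) = ?i}" and ?A = "{u. E y u \<and> D x u = ?i}"
    and ?B = "{u. E y u \<and> D x u = Suc ?i}"
  have fin: "finite ?C" "finite ?A" "finite ?B" using finite_nbr[of y] by (auto intro: finite_subset)
  have U: "{z. E y z} = ?C \<union> (?A \<union> ?B)"
    using D_step[OF x(1), of y] D_step'[OF x(1), of y] by force
  have "(\<Sum>z | E y z. F (D x z)) = (\<Sum>z\<in>?C. F (D x z)) + ((\<Sum>z\<in>?A. F (D x z)) + (\<Sum>z\<in>?B. F (D x z)))"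
    unfolding U using fin by (subst sum.union_disjoint, simp, simp, force)
      (subst sum.union_disjoint, auto)
  also have "(\<Sum>z\<in>?C. F (D x z)) = (\<Sum>z\<in>?C. F (?i - 1))"
    by (rule sum.cong[OF refl]) (metis (mono_tags, lifting) diff_Suc_1 mem_Collect_eq)
  also have "(\<Sum>z\<in>?A. F (D x z)) = (\<Sum>z\<in>?A. F ?i)" by (rule sum.cong) auto
  also have "(\<Sum>z\<in>?B. F (D x z)) = (\<Sum>z\<in>?B. F (Suc ?i))" by (rule sum.cong) auto
  finally show ?thesis using num_a[OF x] num_b[OF x] num_c[OF x] by simp
qed

lemma degree: "x \<in> V \<Longrightarrow> card {y. E x y} = b 0"
proof -
  assume x: "x \<in> V"
  have "{u. E x u \<and> D x u = Suc (D x x)} = {y. E x y}" using D_one[OF x] E_V2 x by auto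
  then show ?thesis using num_b[OF x x] x by simp
qed

lemma abc_sum: "x \<in> V \<Longrightarrow> y \<in> V \<Longrightarrow> real (c (D x y)) + a (D x y) + b (D x y) = b 0"
  using nbr_sum[of x y "\<lambda>_. 1"] degree[of y] by simp

lemma dist_ex: "i \<le> d \<Longrightarrow> \<exists>x\<in>V. \<exists>y\<in>V. D x y = i"
proof (induction rule: inc_induct)
  case (step i)
  then obtain x y where xy: "x \<in> V" "y \<in> V" "D x y = Suc i" by blast
  then obtain z where "E y z" "D x z = i" using D_pred by blast
  then show ?case using xy E_V2 by blast
qed (rule D_att)

lemma c_pos: assumes "0 < i" "i \<le> d" shows "0 < c i"
proof -
  obtain x y where xy: "x \<in> V" "y \<in> V" "D x y = i" using dist_ex assms by blast
  then obtain z where "E y z" "Suc (D x z) = D x y" using D_pred[of x y "i - 1"] assms by auto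
  then have "{u. E y u \<and> Suc (D x u) = D x y} \<noteq> {}" by blast
  then have "card {u. E y u \<and> Suc (D x u) = D x y} > 0" using finite_nbr' by (simp only: card_gt_0_iff simp_thms)
  then show ?thesis using num_c[OF xy(1,2)] xy(3) by simp
qed

lemma b_pos: assumes "i < d" shows "0 < b i"
proof -
  obtain x y where xy: "x \<in> V" "y \<in> V" "D x y = Suc i" using dist_ex[of "Suc i"] assms by auto
  then obtain z where z: "E y z" "D x z = i" using D_pred by blast
  then have "y \<in> {u. E z u \<and> D x u = Suc (D x z)}" using xy E_sym[OF z(1)] by simp
  then have "{u. E z u \<and> D x u = Suc (D x z)} \<noteq> {}" by blast
  then have "card {u. E z u \<and> D x u = Suc (D x z)} > 0" using finite_nbr' by (simp only: card_gt_0_iff simp_thms)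
  then show ?thesis using num_b[OF xy(1) E_V2[OF z(1)]] z by simp
qed

lemma b_d: "b d = 0"
proof -
  obtain x y where xy: "x \<in> V" "y \<in> V" "D x y = d" using D_att by blast
  have "D x u \<noteq> Suc d" if "E y u" for u using D_le[OF xy(1) E_V2[OF that]] by simp
  then have "{u. E y u \<and> D x u = Suc (D x y)} = {}" using xy by auto
  then show ?thesis using num_b[OF xy(1,2)] xy(3) by (metis card.empty)
qed

lemma c_1: "c 1 = 1"
proof -
  obtain x y where xy: "x \<in> V" "y \<in> V" "D x y = 1" using dist_ex[of 1] d_ge_2 by auto
  then have "E y x" using D_one E_sym by blast
  then have "{u. E y u \<and> Suc (D x u) = D x y} = {x}" using xy D_zero[OF xy(1)] E_V2 by auto
  then show ?thesis using num_c[OF xy(1,2)] xy by simp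
qed

section \<open>Eigenfunctions summed over spheres\<close>

definition sphere :: "'a \<Rightarrow> nat \<Rightarrow> 'a set" where "sphere x i = {y \<in> V. D x y = i}"

definition eigfun :: "real \<Rightarrow> ('a \<Rightarrow> real) \<Rightarrow> bool" where
  "eigfun \<theta> f \<longleftrightarrow> (\<forall>x\<in>V. (\<Sum>y | E x y. f y) = \<theta> * f x)"

lemma finite_sphere [simp]: "finite (sphere x i)"
  unfolding sphere_def using finite_V by simp

lemma sphere_0: "x \<in> V \<Longrightarrow> sphere x 0 = {x}"
  unfolding sphere_def using D_zero by auto

lemma sphere_1: "x \<in> V \<Longrightarrow> sphere x (Suc 0) = {y. E x y}"
  unfolding sphere_def using D_one E_V2 by auto

lemma sphere_gt: "x \<in> V \<Longrightarrow> i > d \<Longrightarrow> sphere x i = {}"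
  unfolding sphere_def using D_le by fastforce

text \<open>This is the three-term recurrence of the distance matrices, applied to an eigenfunction:
  the arcs that meet a sphere are counted from their other end \<open>u\<close>, where
  \<open>?N u\<close> is an intersection number.\<close>

lemma sphere_sum_rec:
  fixes \<theta> :: real and f :: "'a \<Rightarrow> real"
  assumes f: "eigfun \<theta> f" and x: "x \<in> V"
  shows "\<theta> * sum f (sphere x (Suc i)) = b i * sum f (sphere x i) + a (Suc i) * sum f (sphere x (Suc i))
    + c (Suc (Suc i)) * sum f (sphere x (Suc (Suc i)))"
proof -
  let ?N = "\<lambda>u. real (card {y. E u y \<and> D x y = Suc i})"
  have N: "?N u = (if D x u = i then b i else 0) + (if D x u = Suc i then a (Suc i) else 0)
      + (if D x u = Suc (Suc i) then c (Suc (Suc i)) else 0)" if u: "u \<in> V" for u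
  proof -
    consider "D x u = i" | "D x u = Suc i" | "D x u = Suc (Suc i)"
      | "D x u \<notin> {i, Suc i, Suc (Suc i)}" by blast
    then show ?thesis
    proof cases
      case 1 then show ?thesis using num_b[OF x u] by simp
    next
      case 2 then show ?thesis using num_a[OF x u] by simp
    next
      case 3 then show ?thesis using num_c[OF x u] by simp
    next
      case 4
      have "{y. E u y \<and> D x y = Suc i} = {}"
        using D_step[OF x, of u] D_step'[OF x, of u] 4 by force
      then have "card {y. E u y \<and> D x y = Suc i} = 0" by (simp only: card.empty)
      then show ?thesis unfolding \<open>card _ = 0\<close> using 4 by simp
    qed
  qed
  have "\<theta> * sum f (sphere x (Suc i)) = (\<Sum>y\<in>sphere x (Suc i). \<Sum>u | E y u. f u)"
    using f unfolding eigfun_def sphere_def by (simp add: sum_distrib_left)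
  also have "\<dots> = (\<Sum>y\<in>sphere x (Suc i). \<Sum>u\<in>V. if E y u then f u else 0)"
  proof (rule sum.cong[OF refl])
    fix y
    have "{u. E y u} = {u \<in> V. E y u}" using E_V2 by auto
    then show "(\<Sum>u | E y u. f u) = (\<Sum>u\<in>V. if E y u then f u else 0)"
      using sum.inter_filter[OF finite_V, of f "E y"] by simp
  qed
  also have "\<dots> = (\<Sum>u\<in>V. \<Sum>y\<in>sphere x (Suc i). if E y u then f u else 0)"
    by (rule sum.swap)
  also have "\<dots> = (\<Sum>u\<in>V. f u * ?N u)"
  proof (rule sum.cong[OF refl])
    fix u
    have "(\<Sum>y\<in>sphere x (Suc i). if E y u then f u else 0) = (\<Sum>y | y \<in> sphere x (Suc i) \<and> E y u. f u)"
      by (rule sum.inter_filter[OF finite_sphere, symmetric])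
    also have "{y. y \<in> sphere x (Suc i) \<and> E y u} = {y. E u y \<and> D x y = Suc i}"
      unfolding sphere_def using E_sym E_V by blast
    finally show "(\<Sum>y\<in>sphere x (Suc i). if E y u then f u else 0) = f u * ?N u" by simp
  qed
  also have "\<dots> = (\<Sum>u\<in>V. (if D x u = i then b i * f u else 0) + (if D x u = Suc i then a (Suc i) * f u else 0)
      + (if D x u = Suc (Suc i) then c (Suc (Suc i)) * f u else 0))"
    by (rule sum.cong[OF refl]) (simp add: N)
  also have "\<dots> = (\<Sum>u\<in>sphere x i. b i * f u) + (\<Sum>u\<in>sphere x (Suc i). a (Suc i) * f u)
      + (\<Sum>u\<in>sphere x (Suc (Suc i)). c (Suc (Suc i)) * f u)"
    unfolding sum.distrib sphere_def using finite_V by (simp only: sum.inter_filter)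
  finally show ?thesis by (simp add: sum_distrib_left)
qed

text \<open>The polynomials that express the distance matrices in the adjacency matrix.\<close>

fun dist_poly :: "real \<Rightarrow> nat \<Rightarrow> real" where
  "dist_poly \<theta> 0 = 1"
| "dist_poly \<theta> (Suc 0) = \<theta>"
| "dist_poly \<theta> (Suc (Suc i)) = ((\<theta> - real (a (Suc i))) * dist_poly \<theta> (Suc i) - real (b i) * dist_poly \<theta> i) / real (c (Suc (Suc i)))"

lemma sphere_sum:
  fixes \<theta> :: real and f :: "'a \<Rightarrow> real"
  assumes f: "eigfun \<theta> f" and x: "x \<in> V"
  shows "i \<le> d \<Longrightarrow> sum f (sphere x i) = dist_poly \<theta> i * f x"
proof (induction i rule: induct_nat_012)
  case 0
  then show ?case using sphere_0[OF x] by simp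
next
  case 1
  then show ?case using sphere_1[OF x] f x unfolding eigfun_def by simp
next
  case (ge2 i)
  then show ?case using sphere_sum_rec[OF f x, of i] c_pos[of "Suc (Suc i)"] by (simp add: field_simps)
qed

text \<open>Beyond radius \<open>d\<close> the sphere is empty, so the recurrence closes up. This
  relation singles out eigenvalues among the arguments of \<open>dist_poly\<close>.\<close>

lemma sphere_sum_id:
  fixes \<theta> :: real and f :: "'a \<Rightarrow> real"
  assumes f: "eigfun \<theta> f" "\<exists>x\<in>V. f x \<noteq> 0"
  shows "\<theta> * dist_poly \<theta> d = b (d - 1) * dist_poly \<theta> (d - 1) + a d * dist_poly \<theta> d"
proof -
  obtain x where x: "x \<in> V" "f x \<noteq> 0" using f by blast
  obtain e where e: "d = Suc e" using d_ge_2 by (cases d) auto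
  have "\<theta> * (dist_poly \<theta> d * f x) = b e * (dist_poly \<theta> e * f x) + a d * (dist_poly \<theta> d * f x)"
    using sphere_sum_rec[OF f(1) x(1), of e] sphere_sum[OF f(1) x(1), of d] sphere_sum[OF f(1) x(1), of e]
      sphere_gt[OF x(1), of "Suc d"] e by simp
  then have "(\<theta> * dist_poly \<theta> d - b e * dist_poly \<theta> e - a d * dist_poly \<theta> d) * f x = 0" by (simp add: algebra_simps)
  then show ?thesis using x e by simp
qed

lemma eigfun_one: "eigfun (real (b 0)) (\<lambda>_. 1)"
  unfolding eigfun_def using degree by simp

text \<open>For \<open>i \<le> d\<close> this is the size of a sphere of radius \<open>i\<close>,
  because the constant function is an eigenfunction for \<open>b 0\<close>.\<close>

definition valency :: "nat \<Rightarrow> real" where "valency i = dist_poly (real (b 0)) i"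

lemma valency_rec: "i < d \<Longrightarrow> b i * valency i = c (Suc i) * valency (Suc i)"
proof (induction i)
  case 0
  then show ?case using c_1 by (simp add: valency_def)
next
  case (Suc i)
  obtain x y where xy: "x \<in> V" "y \<in> V" "D x y = Suc i" using dist_ex[of "Suc i"] Suc by auto
  have "c (Suc (Suc i)) > 0" using c_pos Suc by simp
  then have "c (Suc (Suc i)) * valency (Suc (Suc i)) = (real (b 0) - real (a (Suc i))) * valency (Suc i) - b i * valency i"
    by (simp add: valency_def)
  moreover have "real (b 0) - a (Suc i) = c (Suc i) + b (Suc i)" using abc_sum[OF xy(1,2)] xy by simp
  ultimately show ?case using Suc by (simp add: algebra_simps)
qed

lemma valency_pos: "i \<le> d \<Longrightarrow> valency i > 0"
proof (induction i)
  case 0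
  then show ?case by (simp add: valency_def)
next
  case (Suc i)
  then have "real (b i) * valency i > 0" using b_pos[of i] by simp
  then have "real (c (Suc i)) * valency (Suc i) > 0" using valency_rec[of i] Suc.prems by simp
  moreover have "real (c (Suc i)) > 0" using c_pos[of "Suc i"] Suc.prems by simp
  ultimately show ?case by (rule zero_less_mult_pos)
qed

text \<open>The standard sequence of \<open>\<theta>\<close>: the average over a sphere of radius
  \<open>i\<close> of an eigenfunction with value 1 at the centre.\<close>

definition cosine :: "real \<Rightarrow> nat \<Rightarrow> real" where "cosine \<theta> i = dist_poly \<theta> i / valency i"

lemma cosine_0 [simp]: "cosine \<theta> 0 = 1" and cosine_1: "cosine \<theta> (Suc 0) = \<theta> / real (b 0)"
  by (simp_all add: cosine_def valency_def)

lemma dist_poly_cosine: "i \<le> d \<Longrightarrow> dist_poly \<theta> i = valency i * cosine \<theta> i"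
  using valency_pos[of i] by (simp add: cosine_def)

definition eigval :: "real \<Rightarrow> bool" where
  "eigval \<theta> \<longleftrightarrow> (\<exists>f. eigfun \<theta> f \<and> (\<exists>x\<in>V. f x \<noteq> 0))"

text \<open>The two ends are degenerate: \<open>c 0\<close> and \<open>a 0\<close> vanish at
  \<open>i = 0\<close>, and \<open>b d\<close> at \<open>i = d\<close>. The upper end rests on
  \<open>sphere_sum_id\<close>, which is why \<open>\<theta>\<close> has to be an
  eigenvalue.\<close>

lemma cosine_rec:
  assumes ev: "eigval \<theta>" and i: "i \<le> d"
  shows "real (c i) * cosine \<theta> (i - 1) + real (a i) * cosine \<theta> i + b i * cosine \<theta> (Suc i) = \<theta> * cosine \<theta> i"
proof (cases i)
  case 0
  obtain x where x: "x \<in> V" using D_att by blast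
  have "D x u \<noteq> 0" if "E x u" for u using D_zero[OF x E_V2[OF that]] that by auto
  then have "{u. E x u \<and> Suc (D x u) = D x x} = {}" "{u. E x u \<and> D x u = D x x} = {}"
    using x by auto
  then have "c 0 = 0" "a 0 = 0" using num_c[OF x x] num_a[OF x x] D_refl[OF x] by (metis card.empty)+
  moreover have "b 0 > 0" using b_pos d_ge_2 by simp
  ultimately show ?thesis using 0 by (simp add: cosine_1)
next
  case (Suc j)
  have Kp: "valency i > 0" using valency_pos i by blast
  have 1: "b j * dist_poly \<theta> j = valency i * (c i * cosine \<theta> j)"
    using valency_rec[of j] dist_poly_cosine[of j] i Suc by (simp add: algebra_simps)
  have "\<theta> * dist_poly \<theta> i = b j * dist_poly \<theta> j + a i * dist_poly \<theta> i + valency i * (b i * cosine \<theta> (Suc i))"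
  proof (cases "i = d")
    case True
    obtain f where "eigfun \<theta> f" "\<exists>x\<in>V. f x \<noteq> 0" using ev unfolding eigval_def by blast
    from sphere_sum_id[OF this] show ?thesis using b_d unfolding True[symmetric] Suc by simp
  next
    case False
    then have "c (Suc i) > 0" using c_pos i by simp
    moreover have "c (Suc i) * dist_poly \<theta> (Suc i) = valency i * (b i * cosine \<theta> (Suc i))"
      using valency_rec[of i] dist_poly_cosine[of "Suc i"] i False by (simp add: algebra_simps)
    ultimately have "(\<theta> - real (a i)) * dist_poly \<theta> i - real (b j) * dist_poly \<theta> j = valency i * (b i * cosine \<theta> (Suc i))"
      using Suc by simp
    then show ?thesis by (simp add: left_diff_distrib)
  qed
  then have "valency i * (\<theta> * cosine \<theta> i) = valency i * (c i * cosine \<theta> j + a i * cosine \<theta> i + b i * cosine \<theta> (Suc i))"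
    using 1 dist_poly_cosine[OF i, of \<theta>] by (simp add: algebra_simps)
  then show ?thesis using Kp Suc by simp
qed

section \<open>Positive semidefiniteness of the cosine matrix\<close>

lemma eigfun_cosine:
  assumes "eigval \<theta>" "y \<in> V" shows "eigfun \<theta> (\<lambda>x. cosine \<theta> (D y x))"
  unfolding eigfun_def using nbr_sum[of y _ "cosine \<theta>"] cosine_rec[OF assms(1)] D_le assms(2) by simp

text \<open>A row of the cosine matrix is an eigenfunction, so its sum over each sphere about
  \<open>y\<close> is a multiple of its value at \<open>y\<close>; grouping by the distance from
  \<open>y\<close> computes the square of the matrix.\<close>

lemma cosine_convolution:
  assumes ev: "eigval \<theta>" and y: "y \<in> V" "y' \<in> V"
  shows "(\<Sum>x\<in>V. cosine \<theta> (D x y) * cosine \<theta> (D x y')) = (\<Sum>i\<le>d. cosine \<theta> i * dist_poly \<theta> i) * cosine \<theta> (D y y')"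
proof -
  note f = eigfun_cosine[OF ev y(2)]
  have "(\<Sum>x\<in>V. cosine \<theta> (D x y) * cosine \<theta> (D x y')) = (\<Sum>x\<in>V. cosine \<theta> (D y x) * cosine \<theta> (D y' x))"
    using D_sym y by (intro sum.cong) auto
  also have "\<dots> = (\<Sum>i\<le>d. \<Sum>x\<in>{x \<in> V. D y x = i}. cosine \<theta> (D y x) * cosine \<theta> (D y' x))"
    using D_le y finite_V by (intro sum.group[symmetric]) auto
  also have "\<dots> = (\<Sum>i\<le>d. cosine \<theta> i * sum (\<lambda>x. cosine \<theta> (D y' x)) (sphere y i))"
    unfolding sphere_def by (auto simp: sum_distrib_left intro!: sum.cong)
  also have "\<dots> = (\<Sum>i\<le>d. cosine \<theta> i * dist_poly \<theta> i * cosine \<theta> (D y' y))"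
    using sphere_sum[OF f y(1)] by (intro sum.cong) auto
  finally show ?thesis using D_sym y by (simp add: sum_distrib_right)
qed

lemma kappa_pos: "(\<Sum>i\<le>d. cosine \<theta> i * dist_poly \<theta> i) > 0"
proof (rule sum_pos2[of _ 0])
  show "0 \<le> cosine \<theta> i * dist_poly \<theta> i" if "i \<in> {..d}" for i
  proof -
    have "cosine \<theta> i * dist_poly \<theta> i = valency i * (cosine \<theta> i)\<^sup>2"
      using that dist_poly_cosine[of i \<theta>] by (simp add: power2_eq_square)
    then show ?thesis using that valency_pos[of i] by simp
  qed
qed auto

text \<open>The matrix \<open>W\<close> of the cosines satisfies \<open>W\<^sup>2 = \<kappa> W\<close> with \<open>\<kappa> > 0\<close>, because its rows are
  eigenfunctions; so it is positive semidefinite, without any spectral theorem.\<close>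

lemma cosine_gram:
  fixes g :: "'a \<Rightarrow> real"
  assumes ev: "eigval \<theta>"
  shows "(\<Sum>x\<in>V. (\<Sum>y\<in>V. g y * cosine \<theta> (D x y))\<^sup>2) =
    (\<Sum>i\<le>d. cosine \<theta> i * dist_poly \<theta> i) * (\<Sum>x\<in>V. \<Sum>y\<in>V. g x * g y * cosine \<theta> (D x y))"
proof -
  have "(\<Sum>x\<in>V. (\<Sum>y\<in>V. g y * cosine \<theta> (D x y))\<^sup>2) =
      (\<Sum>x\<in>V. \<Sum>y\<in>V. \<Sum>y'\<in>V. g y * g y' * (cosine \<theta> (D x y) * cosine \<theta> (D x y')))"
    by (simp add: power2_eq_square sum_product algebra_simps)
  also have "\<dots> = (\<Sum>y\<in>V. \<Sum>y'\<in>V. \<Sum>x\<in>V. g y * g y' * (cosine \<theta> (D x y) * cosine \<theta> (D x y')))"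
    by (subst sum.swap) (intro sum.cong refl sum.swap)
  also have "\<dots> = (\<Sum>y\<in>V. \<Sum>y'\<in>V. g y * g y' * ((\<Sum>i\<le>d. cosine \<theta> i * dist_poly \<theta> i) * cosine \<theta> (D y y')))"
    using cosine_convolution[OF ev] by (simp add: sum_distrib_left[symmetric])
  also have "\<dots> = (\<Sum>i\<le>d. cosine \<theta> i * dist_poly \<theta> i) * (\<Sum>x\<in>V. \<Sum>y\<in>V. g x * g y * cosine \<theta> (D x y))"
    unfolding sum_distrib_left[of "\<Sum>i\<le>d. cosine \<theta> i * dist_poly \<theta> i"]
    by (intro sum.cong refl) (simp only: ac_simps)
  finally show ?thesis .
qed

lemma cosine_psd:
  fixes g :: "'a \<Rightarrow> real"
  assumes "eigval \<theta>" shows "(\<Sum>x\<in>V. \<Sum>y\<in>V. g x * g y * cosine \<theta> (D x y)) \<ge> 0"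
proof -
  have "(\<Sum>x\<in>V. (\<Sum>y\<in>V. g y * cosine \<theta> (D x y))\<^sup>2) \<ge> 0" by (simp add: sum_nonneg)
  then show ?thesis unfolding cosine_gram[OF assms] using kappa_pos[of \<theta>] by (simp add: zero_le_mult_iff)
qed

lemma cosine_null:
  fixes g :: "'a \<Rightarrow> real"
  assumes "eigval \<theta>" and "(\<Sum>x\<in>V. \<Sum>y\<in>V. g x * g y * cosine \<theta> (D x y)) = 0" and "x \<in> V"
  shows "(\<Sum>y\<in>V. g y * cosine \<theta> (D x y)) = 0"
  using cosine_gram[OF assms(1), of g] assms(2,3) finite_V by (simp add: sum_nonneg_eq_0_iff)

lemma cosine_2: "eigval \<theta> \<Longrightarrow> real (b 1) * cosine \<theta> 2 = (\<theta> - real (a 1)) * cosine \<theta> 1 - 1"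
  using cosine_rec[of \<theta> 1] c_1 d_ge_2 by (simp add: algebra_simps numeral_2_eq_2)

end

section \<open>Geometric distance-regular graphs\<close>

lemma sum_sum_three:
  fixes k :: "'a \<Rightarrow> 'a \<Rightarrow> real"
  assumes "finite T" "x \<in> T" "y \<in> T" "z \<in> T" "x \<noteq> y" "x \<noteq> z" "y \<noteq> z"
    and f: "f = (\<lambda>w. if w = x then 3 else if w = y \<or> w = z then - 2 else 0)"
  shows "(\<Sum>p\<in>T. \<Sum>q\<in>T. k p q * (f p * f q)) =
    9 * k x x + 4 * k y y + 4 * k z z - 6 * (k x y + k y x) - 6 * (k x z + k z x) + 4 * (k y z + k z y)"
proof -
  have 0: "f w = 0" if "w \<notin> {x, y, z}" for w using that f by auto
  have v: "f x = 3" "f y = -2" "f z = -2" using assms by auto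
  have sub: "{x, y, z} \<subseteq> T" using assms by auto
  have "(\<Sum>p\<in>T. \<Sum>q\<in>T. k p q * (f p * f q)) = (\<Sum>p\<in>{x,y,z}. \<Sum>q\<in>T. k p q * (f p * f q))"
    using 0 by (intro sum.mono_neutral_right[OF assms(1) sub]) auto
  also have "\<dots> = (\<Sum>p\<in>{x,y,z}. \<Sum>q\<in>{x,y,z}. k p q * (f p * f q))"
    using 0 by (intro sum.cong refl sum.mono_neutral_right[OF assms(1) sub]) auto
  also have "\<dots> = 9 * k x x + 4 * k y y + 4 * k z z - 6 * (k x y + k y x) - 6 * (k x z + k z x) + 4 * (k y z + k z y)"
    using assms(5-7) v by simp
  finally show ?thesis .
qed

text \<open>\<open>t\<close> is minus the smallest eigenvalue, a real number until
  \<open>m_t\<close> identifies it with the number of lines through a vertex. The factor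
  \<open>4 / 5\<close> stands in for \<open>1 - eps_star\<close>.\<close>

locale geometric_drg = drg V E D d a b c
  for V :: "'a set" and E D d a b c +
  fixes \<L> :: "'a set set" and n :: nat and t \<theta>1 :: real
  assumes line_V: "C \<in> \<L> \<Longrightarrow> C \<subseteq> V"
    and line_clique: "C \<in> \<L> \<Longrightarrow> x \<in> C \<Longrightarrow> y \<in> C \<Longrightarrow> x \<noteq> y \<Longrightarrow> E x y"
    and line_card: "C \<in> \<L> \<Longrightarrow> card C = n + 1"
    and line_ex1: "E x y \<Longrightarrow> \<exists>!C. C \<in> \<L> \<and> x \<in> C \<and> y \<in> C"
    and n_pos: "n > 0"
    and t_pos: "t > 0"
    and k_eq: "real (b 0) = t * n"
    and eigval_t: "eigval (- t)"
    and eigval_1: "eigval \<theta>1"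
    and \<theta>1_less: "\<theta>1 < b 0"
    and \<theta>1_gt: "\<theta>1 + 1 > 4 / 5 * b 1"
    and k_ge: "real (b 0) \<ge> t ^ 3"
    and local_conn: "\<exists>v\<in>V. \<forall>x y. E v x \<longrightarrow> E v y \<longrightarrow> (\<lambda>p q. E v p \<and> E v q \<and> E p q)\<^sup>*\<^sup>* x y"
begin

section \<open>Counting on Delsarte cliques\<close>

lemma finite_line: "C \<in> \<L> \<Longrightarrow> finite C"
  using line_V finite_V finite_subset by blast

lemma line_ex:
  assumes "E x y" obtains C where "C \<in> \<L>" "x \<in> C" "y \<in> C"
  using ex1_implies_ex[OF line_ex1[OF assms]] by blast

lemma line_unique:
  assumes "E x y" "C \<in> \<L>" "K \<in> \<L>" "x \<in> C" "y \<in> C" "x \<in> K" "y \<in> K" shows "C = K"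
  using line_ex1[OF assms(1)] assms(2-) by blast

lemma finite_lines: "finite {C \<in> \<L>. x \<in> C}"
  by (rule finite_subset[of _ "Pow V"]) (use line_V finite_V in auto)

lemma lines_card_mult:
  assumes x: "x \<in> V" shows "card {C \<in> \<L>. x \<in> C} * n = b 0"
proof -
  let ?L = "{C \<in> \<L>. x \<in> C}"
  have "{y. E x y} = (\<Union>C\<in>?L. C - {x})"
  proof (intro equalityI subsetI)
    fix y assume "y \<in> {y. E x y}"
    then have y: "E x y" by simp
    obtain C where "C \<in> \<L>" "x \<in> C" "y \<in> C" using line_ex[OF y] .
    moreover have "y \<noteq> x" using y by auto
    ultimately show "y \<in> (\<Union>C\<in>?L. C - {x})" by blast
  next
    fix y assume "y \<in> (\<Union>C\<in>?L. C - {x})"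
    then show "y \<in> {y. E x y}" using line_clique by blast
  qed
  moreover have "card (\<Union>C\<in>?L. C - {x}) = (\<Sum>C\<in>?L. card (C - {x}))"
  proof (rule card_UN_disjoint[OF finite_lines])
    show "\<forall>C\<in>?L. finite (C - {x})" using finite_line by auto
    show "\<forall>C\<in>?L. \<forall>K\<in>?L. C \<noteq> K \<longrightarrow> (C - {x}) \<inter> (K - {x}) = {}"
    proof (intro ballI impI, rule ccontr)
      fix C K assume CK: "C \<in> ?L" "K \<in> ?L" "C \<noteq> K" "(C - {x}) \<inter> (K - {x}) \<noteq> {}"
      then obtain y where y: "y \<in> C" "y \<in> K" "y \<noteq> x" by blast
      then have "E x y" using CK line_clique by blast
      then show False using line_unique[of x y C K] CK y by blast
    qed
  qed
  moreover have "(\<Sum>C\<in>?L. card (C - {x})) = (\<Sum>C\<in>?L. n)"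
    using line_card finite_line by (intro sum.cong) auto
  ultimately show ?thesis using degree[OF x] by simp
qed

definition m :: nat where "m = b 0 div n"

lemma lines_card: "x \<in> V \<Longrightarrow> card {C \<in> \<L>. x \<in> C} = m"
  using lines_card_mult[of x] n_pos unfolding m_def by (metis nonzero_mult_div_cancel_right not_gr_zero)

lemma m_n: "b 0 = m * n"
proof -
  obtain x where "x \<in> V" using D_att by blast
  then show ?thesis using lines_card_mult[of x] lines_card[of x] by simp
qed

lemma m_t: "real m = t"
  using k_eq n_pos unfolding m_n by simp

lemma n_ge: "n \<ge> m ^ 2"
proof -
  have "real m ^ 3 \<le> real (m * n)" using k_ge m_t m_n by simp
  moreover have "m > 0" using m_t t_pos by (metis of_nat_0_less_iff)
  ultimately have "real m ^ 2 \<le> real n" by (simp add: power2_eq_square power3_eq_cube)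
  then show ?thesis by (metis of_nat_le_iff of_nat_power)
qed

text \<open>The two edges of a geodesic of length 2 lie on different lines through its middle
  vertex.\<close>

lemma m_ge_2: "m \<ge> 2"
proof -
  obtain x z where xz: "x \<in> V" "z \<in> V" "D x z = Suc 1" using dist_ex[of 2] d_ge_2 by auto
  then obtain y where y: "E z y" "D x y = 1" using D_pred by blast
  have yV: "y \<in> V" using y E_V2 by blast
  have xy: "E x y" using D_one xz y yV by blast
  have yx: "E y x" "E y z" using xy y E_sym by blast+
  obtain C where C: "C \<in> \<L>" "y \<in> C" "x \<in> C" using line_ex[OF yx(1)] .
  obtain K where K: "K \<in> \<L>" "y \<in> K" "z \<in> K" using line_ex[OF yx(2)] .
  have "z \<notin> C"
  proof
    assume "z \<in> C"
    moreover have "x \<noteq> z" using xz by auto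
    ultimately have "E x z" using C line_clique by blast
    then show False using D_one[OF xz(1,2)] xz by simp
  qed
  then have "C \<noteq> K" using K by blast
  then have "card {C, K} = 2" by simp
  moreover have "card {C, K} \<le> card {C \<in> \<L>. y \<in> C}" using C K finite_lines by (intro card_mono) auto
  ultimately show ?thesis using lines_card[OF yV] by simp
qed

definition N :: "'a set \<Rightarrow> 'a \<Rightarrow> nat" where "N C x = card {z \<in> C. E x z}"

text \<open>The cosine at distance 1 is \<open>- 1 / n\<close>, so the sum is
  \<open>1 - n / n = 0\<close> for \<open>x\<close> in \<open>C\<close>. Hence the form vanishes at
  the indicator of \<open>C\<close>, and by semidefiniteness all other rows vanish on it
  too.\<close>

lemma line_null:
  assumes C: "C \<in> \<L>" and x: "x \<in> V"
  shows "(\<Sum>y\<in>C. cosine (- t) (D x y)) = 0"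
proof -
  define g where "g y = (if y \<in> C then 1 else 0 :: real)" for y
  have CV: "C \<subseteq> V" using line_V C by blast
  have red: "(\<Sum>y\<in>V. g y * F y) = (\<Sum>y\<in>C. F y)" for F :: "'a \<Rightarrow> real"
  proof -
    have "(\<Sum>y\<in>V. g y * F y) = (\<Sum>y\<in>V. if y \<in> C then F y else 0)"
      by (rule sum.cong) (auto simp: g_def)
    also have "\<dots> = (\<Sum>y\<in>C. F y)" using finite_V CV by (simp add: sum.inter_restrict[symmetric] Int_absorb1)
    finally show ?thesis .
  qed
  have u1: "cosine (- t) 1 = - 1 / n" using k_eq t_pos n_pos by (simp add: cosine_1)
  have "(\<Sum>x\<in>V. \<Sum>y\<in>V. g x * g y * cosine (- t) (D x y)) = (\<Sum>x\<in>C. \<Sum>y\<in>C. cosine (- t) (D x y))"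
    by (simp add: mult.assoc sum_distrib_left[symmetric] red)
  also have "\<dots> = (\<Sum>x\<in>C. 0)"
  proof (rule sum.cong[OF refl])
    fix x assume x: "x \<in> C"
    have xV: "x \<in> V" using x CV by blast
    have "(\<Sum>y\<in>C. cosine (- t) (D x y)) = cosine (- t) (D x x) + (\<Sum>y\<in>C - {x}. cosine (- t) (D x y))"
      using finite_line[OF C] x by (simp add: sum.remove)
    also have "(\<Sum>y\<in>C - {x}. cosine (- t) (D x y)) = (\<Sum>y\<in>C - {x}. cosine (- t) 1)"
    proof (rule sum.cong[OF refl])
      fix y assume "y \<in> C - {x}"
      then have "D x y = 1" using D_one[OF xV] line_clique[OF C x] CV by auto
      then show "cosine (- t) (D x y) = cosine (- t) 1" by simp
    qed
    also have "\<dots> = - 1" using line_card[OF C] x finite_line[OF C] n_pos u1 by simp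
    finally show "(\<Sum>y\<in>C. cosine (- t) (D x y)) = 0" using xV by simp
  qed
  finally have "(\<Sum>x\<in>V. \<Sum>y\<in>V. g x * g y * cosine (- t) (D x y)) = 0" by simp
  from cosine_null[OF eigval_t this x] show ?thesis by (simp add: red)
qed

lemma D_le_2: "E x y \<Longrightarrow> E y z \<Longrightarrow> D x z \<le> 2"
  using D_step[of x y z] D_one[of x y] E_V E_V2 by fastforce

lemma D_2:
  assumes "x \<in> V" "z \<in> V" "D x z \<le> 2" "x \<noteq> z" "\<not> E x z" shows "D x z = 2"
  using assms D_zero[of x z] D_one[of x z] by fastforce

lemma N_eq:
  assumes C: "C \<in> \<L>" and x: "x \<notin> C" "y \<in> C" "E x y"
  shows "N C x * (cosine (- t) 1 - cosine (- t) 2) = - (n + 1) * cosine (- t) 2"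
proof -
  have xV: "x \<in> V" using x E_V by blast
  have fin: "finite C" by (rule finite_line[OF C])
  have "(\<Sum>z\<in>C. cosine (- t) (D x z)) = (\<Sum>z\<in>C. cosine (- t) 2 + (if E x z then cosine (- t) 1 - cosine (- t) 2 else 0))"
  proof (rule sum.cong[OF refl])
    fix z assume z: "z \<in> C"
    have zV: "z \<in> V" using z line_V[OF C] by blast
    have "D x z \<le> 2"
      using D_le_2[OF x(3) line_clique[OF C x(2) z]] D_one[of x y] x xV zV E_V2[OF x(3)] by (cases "y = z") auto
    then have "D x z = 2" if "\<not> E x z" using D_2[OF xV zV] z x that by auto
    moreover have "D x z = 1" if "E x z" using D_one[OF xV zV] that by simp
    ultimately show "cosine (- t) (D x z) = cosine (- t) 2 + (if E x z then cosine (- t) 1 - cosine (- t) 2 else 0)" by simp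
  qed
  also have "\<dots> = (n + 1) * cosine (- t) 2 + N C x * (cosine (- t) 1 - cosine (- t) 2)"
    unfolding sum.distrib N_def using fin line_card[OF C] by (simp add: sum.inter_filter[symmetric])
  finally show ?thesis using line_null[OF C xV] by (simp add: algebra_simps)
qed

text \<open>\<open>N_eq\<close> determines \<open>N C x\<close> unless the cosines at 1 and 2
  coincide; then it would force both to vanish, but the first is \<open>- t / b 0\<close>.\<close>

lemma N_const:
  assumes "C \<in> \<L>" "x \<notin> C" "y \<in> C" "E x y" "C' \<in> \<L>" "x' \<notin> C'" "y' \<in> C'" "E x' y'"
  shows "N C x = N C' x'"
proof -
  have 1: "cosine (- t) 1 \<noteq> 0" using t_pos b_pos[of 0] d_ge_2 by (simp add: cosine_1)
  have "real (N C x) * (cosine (- t) 1 - cosine (- t) 2) = real (N C' x') * (cosine (- t) 1 - cosine (- t) 2)"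
    using N_eq[OF assms(1-4)] N_eq[OF assms(5-8)] by simp
  moreover have "cosine (- t) 1 \<noteq> cosine (- t) 2" using N_eq[OF assms(1-4)] 1 by auto
  ultimately show ?thesis by simp
qed

text \<open>Different neighbors of \<open>x\<close> on \<open>C\<close> lie on different lines
  through \<open>x\<close>, since a line containing two of them would be \<open>C\<close>.\<close>

lemma N_le_m:
  assumes C: "C \<in> \<L>" and x: "x \<notin> C" "x \<in> V"
  shows "N C x \<le> m"
proof -
  let ?Y = "{z \<in> C. E x z}"
  define l where "l z = (SOME K. K \<in> \<L> \<and> x \<in> K \<and> z \<in> K)" for z
  have l: "l z \<in> \<L> \<and> x \<in> l z \<and> z \<in> l z" if "E x z" for z
    unfolding l_def by (rule someI_ex) (use line_ex[OF that] in blast)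
  have "inj_on l ?Y"
  proof (rule inj_onI, rule ccontr)
    fix y z assume yz: "y \<in> ?Y" "z \<in> ?Y" "l y = l z" "y \<noteq> z"
    then have "E y z" using line_clique[OF C] by blast
    then have "l y = C" using line_unique[of y z "l y" C] l[of y] l[of z] yz C by auto
    then show False using l[of y] yz x by auto
  qed
  then have "card ?Y = card (l ` ?Y)" by (simp add: card_image)
  also have "\<dots> \<le> card {K \<in> \<L>. x \<in> K}" using l finite_lines by (intro card_mono) auto
  finally show ?thesis using lines_card[OF x(2)] by (simp add: N_def)
qed

text \<open>Terwilliger's bound as a statement on quadratic forms: the constant in general is
  \<open>- 1 - b 1 / (\<theta>1 + 1)\<close>.\<close>

lemma local_bound:
  fixes g :: "'a \<Rightarrow> real"
  assumes T: "T \<subseteq> V" and D2: "\<And>x y. x \<in> T \<Longrightarrow> y \<in> T \<Longrightarrow> D x y \<le> 2" and g0: "sum g T = 0"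
  shows "(\<Sum>x\<in>T. \<Sum>y\<in>T. of_bool (E x y) * (g x * g y)) \<ge> - (9 / 4) * (\<Sum>x\<in>T. (g x)\<^sup>2)"
proof -
  have fin: "finite T" using T finite_V finite_subset by blast
  define h where "h y = (if y \<in> T then g y else 0)" for y
  have red: "(\<Sum>y\<in>V. h y * F y) = (\<Sum>y\<in>T. g y * F y)" for F :: "'a \<Rightarrow> real"
  proof -
    have "(\<Sum>y\<in>V. h y * F y) = (\<Sum>y\<in>V. if y \<in> T then g y * F y else 0)"
      by (rule sum.cong) (auto simp: h_def)
    also have "\<dots> = (\<Sum>y\<in>T. g y * F y)" using finite_V T by (simp add: sum.inter_restrict[symmetric] Int_absorb1)
    finally show ?thesis .
  qed
  let ?u = "cosine \<theta>1"
  define Q where "Q = (\<Sum>x\<in>T. \<Sum>y\<in>T. of_bool (E x y) * (g x * g y))"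
  define W where "W = (\<Sum>x\<in>T. (g x)\<^sup>2)"
  have k0: "b 0 > 0" and b1: "b 1 > 0" using b_pos d_ge_2 by auto
  have "0 \<le> (\<Sum>x\<in>V. \<Sum>y\<in>V. h x * h y * ?u (D x y))" by (rule cosine_psd[OF eigval_1])
  also have "\<dots> = (\<Sum>x\<in>T. \<Sum>y\<in>T. g x * (g y * ?u (D x y)))"
    by (simp add: mult.assoc sum_distrib_left[symmetric] red)
  also have "\<dots> = (\<Sum>x\<in>T. \<Sum>y\<in>T. ?u 2 * (g x * g y) + (1 - ?u 2) * (of_bool (x = y) * (g x * g y))
      + (?u 1 - ?u 2) * (of_bool (E x y) * (g x * g y)))"
  proof (intro sum.cong refl)
    fix x y assume xy: "x \<in> T" "y \<in> T"
    then have V: "x \<in> V" "y \<in> V" using T by auto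
    \<comment> \<open>Only the distances 0, 1 and 2 occur on \<open>T\<close>, so the cosine matrix
      is a combination of the all-one matrix, the identity and the adjacency matrix; the first
      vanishes on zero-sum vectors.\<close>
    have "?u (D x y) = ?u 2 + (1 - ?u 2) * of_bool (x = y) + (?u 1 - ?u 2) * of_bool (E x y)"
    proof -
      consider "x = y" | "E x y" "x \<noteq> y" | "x \<noteq> y" "\<not> E x y" by blast
      then show ?thesis
      proof cases
        case 1 then show ?thesis using V by simp
      next
        case 2 then show ?thesis using D_one[OF V] by simp
      next
        case 3 then show ?thesis using D_2[OF V D2[OF xy]] by simp
      qed
    qed
    from arg_cong[OF this, of "\<lambda>c. g x * (g y * c)"]
    show "g x * (g y * ?u (D x y)) = ?u 2 * (g x * g y) + (1 - ?u 2) * (of_bool (x = y) * (g x * g y))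
      + (?u 1 - ?u 2) * (of_bool (E x y) * (g x * g y))"
      by (simp only: ring_distribs mult_ac)
  qed
  also have "\<dots> = ?u 2 * (sum g T * sum g T) + (1 - ?u 2) * W + (?u 1 - ?u 2) * Q"
  proof -
    have "(\<Sum>x\<in>T. \<Sum>y\<in>T. of_bool (x = y) * (g x * g y)) = W"
      unfolding W_def using fin by (auto simp: power2_eq_square sum.If_cases of_bool_def if_distrib if_distribR
          cong: if_cong intro!: sum.cong)
    moreover have "(\<Sum>x\<in>T. \<Sum>y\<in>T. g x * g y) = sum g T * sum g T" by (simp add: sum_product)
    ultimately show ?thesis unfolding Q_def by (simp only: sum.distrib sum_distrib_left[symmetric])
  qed
  finally have psd: "0 \<le> (1 - ?u 2) * W + (?u 1 - ?u 2) * Q" using g0 by simp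
  define r where "r = 1 - ?u 1"
  define s where "s = (\<theta>1 + 1) / b 1"
  have u1: "?u 1 = \<theta>1 / b 0" by (simp add: cosine_1)
  have r: "r > 0" using \<theta>1_less k0 unfolding r_def u1 by simp
  have s: "s > 4 / 5" using \<theta>1_gt b1 by (simp add: s_def field_simps)
  obtain x y where xy: "x \<in> V" "y \<in> V" "D x y = 1" using dist_ex[of 1] d_ge_2 by auto
  have a1: "real (a 1) = real (b 0) - 1 - real (b 1)" using abc_sum[OF xy(1,2)] c_1 xy by simp
  \<comment> \<open>The recurrence at \<open>i = 1\<close>. Both coefficients of the form acquire
    the factor \<open>r\<close>, which then cancels.\<close>
  have "real (b 1) * (?u 1 - ?u 2) = r * (\<theta>1 + 1)"
    using cosine_2[OF eigval_1] k0 unfolding r_def right_diff_distrib a1 u1 by (simp add: field_simps)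
  then have 12: "?u 1 - ?u 2 = r * s" using b1 by (simp add: s_def field_simps)
  then have 02: "1 - ?u 2 = r * (1 + s)" by (simp add: r_def algebra_simps)
  have "0 \<le> r * ((1 + s) * W + s * Q)" using psd unfolding 12 02 by (simp add: algebra_simps)
  then have *: "0 \<le> (1 + s) * W + s * Q" using r by (simp add: zero_le_mult_iff)
  have "W \<ge> 0" unfolding W_def by (simp add: sum_nonneg)
  \<comment> \<open>The ratio \<open>(1 + s) / s\<close> decreases in \<open>s\<close> and equals
    \<open>9 / 4\<close> at \<open>s = 4 / 5\<close>.\<close>
  then have "(1 + s) * W \<le> s * (9 / 4 * W)" using s mult_right_mono[of "1 + s" "s * (9 / 4)" W] by (simp add: algebra_simps)
  with * have "0 \<le> s * (9 / 4 * W + Q)" by (simp add: algebra_simps)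
  then have "0 \<le> 9 / 4 * W + Q" using s by (simp add: zero_le_mult_iff)
  then show ?thesis unfolding W_def Q_def by simp
qed

end

section \<open>The quadratic form on a neighborhood\<close>

lemma sum_of_bool_card:
  "finite T \<Longrightarrow> (\<Sum>y\<in>T. of_bool (Q y) :: real) = card {y \<in> T. Q y}"
  by (simp add: of_bool_def sum.If_cases Int_def)

context geometric_drg begin

definition coll :: "'a \<Rightarrow> 'a \<Rightarrow> 'a \<Rightarrow> bool" where
  "coll v x y \<longleftrightarrow> (\<exists>C\<in>\<L>. v \<in> C \<and> x \<in> C \<and> y \<in> C)"

lemma coll_commute: "coll v x y \<longleftrightarrow> coll v y x"
  unfolding coll_def by blast

lemma coll_refl: "E v x \<Longrightarrow> coll v x x"
  using line_ex[of v x] unfolding coll_def by blast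

lemma coll_line:
  assumes "E v x" "C \<in> \<L>" "v \<in> C" "x \<in> C" shows "coll v x y \<longleftrightarrow> y \<in> C"
  using line_unique[OF assms(1) _ assms(2)] assms unfolding coll_def by blast

lemma block:
  assumes "E v x" "C \<in> \<L>" "v \<in> C" "x \<in> C" shows "{y. E v y \<and> coll v x y} = C - {v}"
  using coll_line[OF assms] line_clique[OF assms(2,3)] E_irrefl by auto

lemma block_card:
  assumes "E v x" shows "card {y. E v y \<and> coll v x y} = n"
proof -
  obtain C where C: "C \<in> \<L>" "v \<in> C" "x \<in> C" using line_ex[OF assms] .
  show ?thesis unfolding block[OF assms C] using line_card[OF C(1)] C(2) by simp
qed

text \<open>The lines through \<open>v\<close> form an equitable partition of its neighborhood. On a
  line not containing \<open>x\<close>, \<open>N\<close> counts \<open>v\<close> besides the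
  \<open>p\<close> neighbors sought; hence \<open>Suc p\<close>.\<close>

lemma block_nbrs:
  assumes x: "E v x" and z: "E v z" and p: "\<And>C x y. C \<in> \<L> \<Longrightarrow> x \<notin> C \<Longrightarrow> y \<in> C \<Longrightarrow> E x y \<Longrightarrow> N C x = Suc p"
  shows "card {y. E v y \<and> coll v y z \<and> E x y} = (if coll v x z then n - 1 else p)"
proof -
  obtain C where C: "C \<in> \<L>" "v \<in> C" "z \<in> C" using line_ex[OF z] .
  have fin: "finite C" by (rule finite_line[OF C(1)])
  have set: "{y. E v y \<and> coll v y z \<and> E x y} = {y \<in> C. E x y} - {v}"
    using block[OF z C] by (auto simp: coll_commute)
  show ?thesis
  proof (cases "coll v x z")
    case True
    then have xC: "x \<in> C" using coll_line[OF z C, of x] coll_commute by blast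
    have "{y \<in> C. E x y} = C - {x}" using line_clique[OF C(1) xC] by auto
    moreover have "v \<noteq> x" using x by auto
    ultimately have "card ({y \<in> C. E x y} - {v}) = n - 1"
      using line_card[OF C(1)] C(2) xC fin by simp
    then show ?thesis unfolding set using True by simp
  next
    case False
    then have xC: "x \<notin> C" using coll_line[OF z C, of x] coll_commute by blast
    have "card {y \<in> C. E x y} = Suc p" using p[OF C(1) xC C(2) E_sym[OF x]] unfolding N_def .
    moreover have "v \<in> {y \<in> C. E x y}" using C x E_sym by simp
    ultimately have "card ({y \<in> C. E x y} - {v}) = p" using fin by simp
    then show ?thesis unfolding set using False by simp
  qed
qed

text \<open>This is \<open>local_bound\<close> for \<open>f\<close> minus its averages over the lines through \<open>v\<close>. Adjacency in the
  neighborhood preserves the span of the indicators of these lines, so the correction is explicit.\<close>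

lemma block_bound:
  fixes f :: "'a \<Rightarrow> real"
  assumes v: "v \<in> V" and p: "\<And>C x y. C \<in> \<L> \<Longrightarrow> x \<notin> C \<Longrightarrow> y \<in> C \<Longrightarrow> E x y \<Longrightarrow> N C x = Suc p"
  defines "T \<equiv> {x. E v x}"
  defines "\<mu> \<equiv> (\<Sum>x\<in>T. \<Sum>y\<in>T. of_bool (coll v x y) * (f x * f y))"
  shows "(\<Sum>x\<in>T. \<Sum>y\<in>T. of_bool (E x y) * (f x * f y)) - ((real n - 1 - p) * \<mu> + p * (sum f T)\<^sup>2) / n
    \<ge> - (9 / 4) * ((\<Sum>x\<in>T. (f x)\<^sup>2) - \<mu> / n)"
proof -
  have fin: "finite T" unfolding T_def by (rule finite_nbr)
  define M where "M x y = (of_bool (coll v x y) :: real)" for x y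
  define A where "A x y = (of_bool (E x y) :: real)" for x y
  have Msym: "M x y = M y x" and Asym: "A x y = A y x" for x y
    unfolding M_def A_def by (auto simp: coll_commute E_commute)
  have T: "E v x" if "x \<in> T" for x using that unfolding T_def by simp
  have M1: "(\<Sum>y\<in>T. M x y) = n" if "x \<in> T" for x
    using block_card[OF T[OF that]] sum_of_bool_card[OF fin, of "coll v x"] unfolding M_def T_def by simp
  have M1': "(\<Sum>x\<in>T. M x y) = n" if "y \<in> T" for y
    using M1[OF that] by (subst (asm) Msym)
  \<comment> \<open>In matrix form, \<open>A M = (n - 1 - p) M + p J\<close> with the all-one matrix
    \<open>J\<close>.\<close>
  have AM: "(\<Sum>y\<in>T. A x y * M y z) = (real n - 1 - p) * M x z + p" if "x \<in> T" "z \<in> T" for x z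
  proof -
    have "(\<Sum>y\<in>T. A x y * M y z) = (\<Sum>y\<in>T. of_bool (coll v y z \<and> E x y))"
      unfolding A_def M_def by (intro sum.cong) auto
    also have "\<dots> = real (card {y. E v y \<and> coll v y z \<and> E x y})"
      using sum_of_bool_card[OF fin, of "\<lambda>y. coll v y z \<and> E x y"] unfolding T_def by simp
    finally show ?thesis using block_nbrs[OF T[OF that(1)] T[OF that(2)] p] n_pos unfolding M_def by auto
  qed
  define h where "h x = (\<Sum>y\<in>T. M x y * f y) / n" for x
  define \<sigma> where "\<sigma> = sum f T"
  have n0: "real n > 0" using n_pos by simp
  have hM: "h x = h z" if "x \<in> T" "z \<in> T" "coll v x z" for x z
  proof -
    from line_ex[OF T[OF that(1)]] obtain C where C: "C \<in> \<L>" "v \<in> C" "x \<in> C" .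
    have zC: "z \<in> C" using coll_line[OF T[OF that(1)] C] that by blast
    have "M x y = M z y" for y
      unfolding M_def using coll_line[OF T[OF that(1)] C, of y] coll_line[OF T[OF that(2)] C(1,2) zC, of y] by simp
    then show ?thesis unfolding h_def by simp
  qed
  have hsum: "sum h T = \<sigma>"
  proof -
    have "sum h T = (\<Sum>x\<in>T. \<Sum>y\<in>T. M x y * f y / n)"
      by (rule sum.cong[OF refl]) (simp only: h_def sum_divide_distrib)
    also have "\<dots> = (\<Sum>y\<in>T. \<Sum>x\<in>T. M x y * f y / n)" by (rule sum.swap)
    also have "\<dots> = (\<Sum>y\<in>T. f y)"
    proof (rule sum.cong[OF refl])
      fix y assume "y \<in> T"
      have "(\<Sum>x\<in>T. M x y * f y / n) = (\<Sum>x\<in>T. M x y) * f y / n"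
        by (simp only: sum_distrib_right sum_divide_distrib)
      then show "(\<Sum>x\<in>T. M x y * f y / n) = f y" using M1'[OF \<open>y \<in> T\<close>] n0 by simp
    qed
    finally show ?thesis unfolding \<sigma>_def .
  qed
  have Mh: "(\<Sum>x\<in>T. M x z * h x) = n * h z" if "z \<in> T" for z
  proof -
    have "(\<Sum>x\<in>T. M x z * h x) = (\<Sum>x\<in>T. M z x * h z)"
    proof (rule sum.cong[OF refl])
      fix x assume "x \<in> T"
      then have "M x z * h x = M x z * h z" using hM[OF _ that] by (cases "coll v x z") (simp_all add: M_def)
      then show "M x z * h x = M z x * h z" by (subst (2) Msym)
    qed
    then show ?thesis using M1[OF that] by (simp add: sum_distrib_right[symmetric])
  qed
  have hf: "(\<Sum>x\<in>T. h x * f x) = \<mu> / n"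
    unfolding h_def \<mu>_def M_def by (simp add: sum_divide_distrib sum_distrib_right sum_distrib_left algebra_simps)
  have hh: "(\<Sum>x\<in>T. h x * h x) = \<mu> / n"
  proof -
    have "(\<Sum>x\<in>T. h x * h x) = (\<Sum>x\<in>T. \<Sum>y\<in>T. (M x y * h x) * f y) / n"
      unfolding sum_divide_distrib by (subst (2) h_def) (simp add: sum_divide_distrib sum_distrib_left algebra_simps)
    also have "\<dots> = (\<Sum>y\<in>T. (\<Sum>x\<in>T. M x y * h x) * f y) / n"
      by (subst sum.swap) (simp add: sum_distrib_right)
    also have "\<dots> = (\<Sum>y\<in>T. h y * f y)" using Mh n0 by (simp add: sum_divide_distrib)
    finally show ?thesis using hf by simp
  qed
  have Ah: "(\<Sum>y\<in>T. A x y * h y) = (real n - 1 - p) * h x + p * \<sigma> / n" if x: "x \<in> T" for x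
  proof -
    have "(\<Sum>y\<in>T. A x y * h y) = (\<Sum>y\<in>T. \<Sum>z\<in>T. A x y * M y z * f z) / n"
      unfolding h_def by (simp add: sum_divide_distrib sum_distrib_left mult.assoc)
    also have "\<dots> = (\<Sum>z\<in>T. (\<Sum>y\<in>T. A x y * M y z) * f z) / n"
      by (subst sum.swap) (simp add: sum_distrib_right)
    also have "\<dots> = (\<Sum>z\<in>T. ((real n - 1 - p) * M x z + p) * f z) / n"
      using AM[OF x] by simp
    also have "\<dots> = ((real n - 1 - p) * (\<Sum>z\<in>T. M x z * f z) + p * \<sigma>) / n"
      unfolding \<sigma>_def by (simp add: sum.distrib sum_distrib_left distrib_right mult.assoc)
    finally show ?thesis unfolding h_def by (simp add: add_divide_distrib)
  qed
  have fAh: "(\<Sum>x\<in>T. \<Sum>y\<in>T. A x y * (F x * h y)) = (real n - 1 - p) * (\<Sum>x\<in>T. h x * F x) + p * \<sigma> / n * sum F T"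
    for F :: "'a \<Rightarrow> real"
  proof -
    have "(\<Sum>x\<in>T. \<Sum>y\<in>T. A x y * (F x * h y)) = (\<Sum>x\<in>T. F x * (\<Sum>y\<in>T. A x y * h y))"
      by (simp add: sum_distrib_left algebra_simps)
    also have "\<dots> = (\<Sum>x\<in>T. F x * ((real n - 1 - p) * h x + p * \<sigma> / n))" using Ah by simp
    finally show ?thesis 
      by (simp add: distrib_left sum.distrib sum_distrib_left sum_divide_distrib mult_ac)
  qed
  \<comment> \<open>Both mixed terms and the square of the correction \<open>h\<close> take this
    value, so a single \<open>- c0\<close> survives in the form at \<open>f - h\<close>.\<close>
  define c0 where "c0 = ((real n - 1 - p) * \<mu> + p * \<sigma>\<^sup>2) / n"
  have fAh': "(\<Sum>x\<in>T. \<Sum>y\<in>T. A x y * (f x * h y)) = c0" and hAh: "(\<Sum>x\<in>T. \<Sum>y\<in>T. A x y * (h x * h y)) = c0"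
    unfolding fAh hf hh hsum c0_def by (simp_all add: \<sigma>_def[symmetric] add_divide_distrib power2_eq_square)
  have hAf: "(\<Sum>x\<in>T. \<Sum>y\<in>T. A x y * (h x * f y)) = c0"
    unfolding fAh'[symmetric] by (subst sum.swap) (use Asym in \<open>simp add: mult.commute\<close>)
  define g where "g x = f x - h x" for x
  have "sum g T = 0" unfolding g_def using hsum by (simp add: sum_subtractf \<sigma>_def)
  moreover have "T \<subseteq> V" unfolding T_def using E_V2 by blast
  moreover have "D x y \<le> 2" if "x \<in> T" "y \<in> T" for x y
    using D_le_2[OF E_sym[OF T[OF that(1)]] T[OF that(2)]] .
  ultimately have "- (9 / 4) * (\<Sum>x\<in>T. (g x)\<^sup>2) \<le> (\<Sum>x\<in>T. \<Sum>y\<in>T. A x y * (g x * g y))"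
    unfolding A_def by (intro local_bound)
  also have "(\<Sum>x\<in>T. \<Sum>y\<in>T. A x y * (g x * g y)) = (\<Sum>x\<in>T. \<Sum>y\<in>T. A x y * (f x * f y)) - c0"
  proof -
    have "(\<Sum>x\<in>T. \<Sum>y\<in>T. A x y * (g x * g y)) = (\<Sum>x\<in>T. \<Sum>y\<in>T. A x y * (f x * f y))
      - (\<Sum>x\<in>T. \<Sum>y\<in>T. A x y * (f x * h y)) - (\<Sum>x\<in>T. \<Sum>y\<in>T. A x y * (h x * f y))
      + (\<Sum>x\<in>T. \<Sum>y\<in>T. A x y * (h x * h y))"
      unfolding g_def by (simp add: algebra_simps sum.distrib sum_subtractf)
    then show ?thesis unfolding fAh' hAf hAh by simp
  qed
  also have "(\<Sum>x\<in>T. (g x)\<^sup>2) = (\<Sum>x\<in>T. (f x)\<^sup>2) - \<mu> / n"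
  proof -
    have "(\<Sum>x\<in>T. (g x)\<^sup>2) = (\<Sum>x\<in>T. (f x)\<^sup>2) - 2 * (\<Sum>x\<in>T. h x * f x) + (\<Sum>x\<in>T. h x * h x)"
      unfolding g_def power2_eq_square by (simp add: algebra_simps sum.distrib sum_subtractf sum_distrib_left)
    then show ?thesis unfolding hf hh by simp
  qed
  finally show ?thesis unfolding A_def c0_def \<sigma>_def by simp
qed

text \<open>The test vector has the values \<open>3\<close>, \<open>- 2\<close>, \<open>- 2\<close>, which approximate the extremal eigenvector
  of a path with centre \<open>x\<close>.\<close>

lemma block_test:
  assumes xyz: "E v x" "E v y" "E v z" "y \<noteq> z" "E x y" "E x z" "\<not> coll v x y" "\<not> coll v x z"
    and p: "\<And>C x y. C \<in> \<L> \<Longrightarrow> x \<notin> C \<Longrightarrow> y \<in> C \<Longrightarrow> E x y \<Longrightarrow> N C x = Suc p"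
  shows "- 24 + 8 * of_bool (E y z) - ((real n - 1 - p) * (17 + 8 * of_bool (coll v y z)) + p) / n
    \<ge> - (9 / 4) * (17 - (17 + 8 * of_bool (coll v y z)) / n)"
proof -
  let ?T = "{x. E v x}"
  define f :: "'a \<Rightarrow> real" where "f = (\<lambda>w. if w = x then 3 else if w = y \<or> w = z then - 2 else 0)"
  have ne: "x \<noteq> y" "x \<noteq> z" using xyz by auto
  have in': "x \<in> ?T" "y \<in> ?T" "z \<in> ?T" using xyz by auto
  note S = sum_sum_three[OF finite_nbr in' ne xyz(4) f_def]
  have "(\<Sum>p\<in>?T. \<Sum>q\<in>?T. of_bool (E p q) * (f p * f q)) = - 24 + 8 * of_bool (E y z)"
    unfolding S using xyz by (auto simp: E_commute)
  moreover have "(\<Sum>p\<in>?T. \<Sum>q\<in>?T. of_bool (coll v p q) * (f p * f q)) = 17 + 8 * of_bool (coll v y z)"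
    unfolding S using xyz(1-3)[THEN coll_refl] xyz by (auto simp: coll_commute coll_refl)
  moreover have "sum f ?T = - 1" and "(\<Sum>x\<in>?T. (f x)\<^sup>2) = 17"
  proof -
    have sub: "{x, y, z} \<subseteq> ?T" using in' by auto
    have 0: "f w = 0" if "w \<notin> {x, y, z}" for w using that unfolding f_def by auto
    have val: "f x = 3" "f y = -2" "f z = -2" using ne unfolding f_def by auto
    have "sum f ?T = sum f {x, y, z}"
      by (rule sum.mono_neutral_right[OF finite_nbr sub]) (use 0 in auto)
    then show "sum f ?T = - 1" using ne xyz(4) val by simp
    have "(\<Sum>x\<in>?T. (f x)\<^sup>2) = (\<Sum>x\<in>{x, y, z}. (f x)\<^sup>2)"
      by (rule sum.mono_neutral_right[OF finite_nbr sub]) (use 0 in auto)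
    then show "(\<Sum>x\<in>?T. (f x)\<^sup>2) = 17" using ne xyz(4) val by simp
  qed
  ultimately show ?thesis using block_bound[OF E_V[OF xyz(1)] p, where f = f] by simp
qed

end

lemma bound_clear_denominator:
  fixes n :: real
  assumes "p - X / n \<ge> - (9 / 4) * (17 - Y / n)" "n > 0"
  shows "p * n - X \<ge> - (9 / 4) * (17 * n - Y)"
proof -
  have "(p - X / n) * n = p * n - X" "- (9 / 4) * (17 - Y / n) * n = - (9 / 4) * (17 * n - Y)"
    using assms(2) by (simp_all add: field_simps)
  then show ?thesis using mult_right_mono[OF assms(1), of n] assms(2) by (simp only: less_imp_le)
qed

section \<open>Neighborhoods are grids\<close>

context geometric_drg begin

text \<open>Connectedness of one neighborhood enters here: a path between two lines through
  \<open>v\<close> leaves \<open>C1\<close> at some edge from \<open>p\<close> to \<open>q\<close>,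
  and then \<open>q\<close> has the neighbors \<open>v\<close> and \<open>p\<close> on
  \<open>C1\<close>.\<close>

lemma block_card_two:
  obtains C p q where "C \<in> \<L>" "q \<notin> C" "p \<in> C" "E q p" "N C q \<ge> 2"
proof -
  obtain v where v: "v \<in> V" "\<And>x y. E v x \<Longrightarrow> E v y \<Longrightarrow> (\<lambda>p q. E v p \<and> E v q \<and> E p q)\<^sup>*\<^sup>* x y"
    using local_conn by blast
  have "card {C \<in> \<L>. v \<in> C} \<ge> 2" using lines_card[OF v(1)] m_ge_2 by simp
  then obtain C1 C2 where C: "C1 \<in> \<L>" "v \<in> C1" "C2 \<in> \<L>" "v \<in> C2" "C1 \<noteq> C2"
    unfolding card_le_Suc_iff numeral_2_eq_2 by auto
  have ex: "\<exists>x. x \<in> K \<and> E v x" if "K \<in> \<L>" "v \<in> K" for K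
  proof -
    have "card (K - {v}) = n" using line_card[OF that(1)] that(2) by simp
    then obtain x where "x \<in> K - {v}" using n_pos by (metis all_not_in_conv card.empty less_not_refl)
    then show ?thesis using line_clique[OF that] by blast
  qed
  obtain x where x: "x \<in> C1" "E v x" using ex[OF C(1,2)] by blast
  obtain w where w: "w \<in> C2" "E v w" using ex[OF C(3,4)] by blast
  have wC1: "w \<notin> C1" using line_unique[OF w(2) C(1,3,2) _ C(4) w(1)] C(5) by blast
  have "\<exists>p q. p \<in> C1 \<and> q \<notin> C1 \<and> E v p \<and> E v q \<and> E p q"
  proof (rule ccontr)
    assume "\<not> ?thesis"
    then have step: "E v p \<Longrightarrow> E v q \<Longrightarrow> E p q \<Longrightarrow> p \<in> C1 \<Longrightarrow> q \<in> C1" for p q by blast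
    have "w \<in> C1" using v(2)[OF x(2) w(2)]
      by (induction rule: rtranclp_induct) (use x step in auto)
    then show False using wC1 by blast
  qed
  then obtain p q where pq: "p \<in> C1" "q \<notin> C1" "E v p" "E v q" "E p q" by blast
  have "card {v, p} \<le> N C1 q"
    unfolding N_def by (rule card_mono) (use finite_line[OF C(1)] pq C E_sym in auto)
  moreover have "v \<noteq> p" using pq by auto
  ultimately have "N C1 q \<ge> 2" by simp
  with C pq show thesis using that E_sym by blast
qed

text \<open>If \<open>q\<close> had two neighbors \<open>y\<close>, \<open>z\<close> on
  \<open>K\<close> besides \<open>p\<close>, the test vector with centre \<open>q\<close> in the
  neighborhood of \<open>p\<close> would have a Rayleigh quotient near \<open>- 41 / 17\<close>,
  below \<open>- 9 / 4\<close>. The error is of order \<open>r / n\<close>, and \<open>r < m\<close>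
  while \<open>n \<ge> m ^ 2\<close>.\<close>

lemma N_two:
  assumes "C \<in> \<L>" "x \<notin> C" "y \<in> C" "E x y" shows "N C x = 2"
proof -
  obtain K p q where K: "K \<in> \<L>" "q \<notin> K" "p \<in> K" "E q p" "N K q \<ge> 2" using block_card_two .
  obtain r where r: "N K q = Suc r" using K(5) by (cases "N K q") auto
  have all: "N C x = Suc r" if "C \<in> \<L>" "x \<notin> C" "y \<in> C" "E x y" for C x y
    using N_const[OF that K(1-4)] r by simp
  have rm: "Suc r \<le> m" using N_le_m[OF K(1,2) E_V[OF K(4)]] r by simp
  have "r = 1"
  proof (rule ccontr)
    assume "r \<noteq> 1"
    let ?Y = "{z \<in> K. E q z} - {p}"
    have "card {z \<in> K. E q z} = Suc r" using r unfolding N_def .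
    then have "card ?Y = r" using K(3,4) finite_line[OF K(1)] by simp
    then have "card ?Y \<ge> 2" using \<open>r \<noteq> 1\<close> r K(5) by linarith
    then obtain y z where yz: "y \<in> ?Y" "z \<in> ?Y" "y \<noteq> z"
      unfolding card_le_Suc_iff numeral_2_eq_2 by auto
    have "\<not> coll p q w" if "w \<in> ?Y" for w
      using coll_line[of p w K q] line_clique[OF K(1,3), of w] that K coll_commute by auto
    moreover have "coll p y z" unfolding coll_def using yz K by blast
    moreover have "E y z" using line_clique[OF K(1)] yz by blast
    moreover have "E p y" "E p z" using line_clique[OF K(1,3)] yz by auto
    ultimately have "- 24 + 8 - ((real n - 1 - r) * 25 + r) / n \<ge> - (9 / 4) * (17 - 25 / n)"
      using block_test[OF E_sym[OF K(4)] _ _ yz(3) _ _ _ _ all] yz by auto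
    from bound_clear_denominator[OF this]
    have "(- 24 + 8) * real n - ((real n - 1 - r) * 25 + r) \<ge> - (9 / 4) * (17 * real n - 25)"
      using n_pos by simp
    then have 1: "24 * real r \<ge> 11 / 4 * real n + 125 / 4" by (simp add: algebra_simps)
    have 2: "real r \<le> real m - 1" using rm by linarith
    have 3: "real n \<ge> (real m)\<^sup>2" using n_ge by (metis of_nat_le_iff of_nat_power)
    \<comment> \<open>With \<open>r \<le> m - 1\<close> and \<open>n \<ge> m ^ 2\<close> the
      inequality becomes quadratic in \<open>m\<close> with negative discriminant;
      \<open>48 / 11\<close> completes its square.\<close>
    have "11 / 4 * (real m - 48 / 11)\<^sup>2 \<ge> 0" by simp
    then show False using 1 2 3 by (simp add: power2_eq_square algebra_simps)
  qed
  then show ?thesis using all[OF assms] by simp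
qed

text \<open>The path from \<open>y\<close> over \<open>x\<close> to \<open>z\<close> would be
  induced, and its points would lie on three different lines. The test form is again near
  \<open>- 41\<close>, now as \<open>- 24 - 17\<close>, and with \<open>p = 1\<close> the bound
  fails for every positive \<open>n\<close>.\<close>

lemma local_row:
  assumes "E v x" "E v y" "E v z" "E x y" "E x z" "\<not> coll v x y" "\<not> coll v x z" "\<not> coll v y z"
  shows "E y z"
proof (rule ccontr)
  assume nE: "\<not> E y z"
  have "y \<noteq> z" using assms(2,8) coll_refl by blast
  from block_test[OF assms(1-3) this assms(4-7), of 1] N_two nE assms(8)
  have "- 24 - ((real n - 2) * 17 + 1) / n \<ge> - (9 / 4) * (17 - 17 / n)" by simp
  from bound_clear_denominator[OF this]
  have "- 24 * real n - ((real n - 2) * 17 + 1) \<ge> - (9 / 4) * (17 * real n - 17)"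
    using n_pos by simp
  then show False using n_pos by (simp add: algebra_simps)
qed

sublocale grid: local_grid V E \<L> m n
proof
  fix v x y z
  assume "E v x" "E v y" "E v z" "E x y" "E x z"
    "\<nexists>C. C \<in> \<L> \<and> v \<in> C \<and> x \<in> C \<and> y \<in> C" "\<nexists>C. C \<in> \<L> \<and> v \<in> C \<and> x \<in> C \<and> z \<in> C"
    "\<nexists>C. C \<in> \<L> \<and> v \<in> C \<and> y \<in> C \<and> z \<in> C"
  then show "E y z" using local_row[of v x y z] unfolding coll_def by blast
qed (fact finite_V, fact E_sym, simp, fact E_V, fact line_V, fact line_clique, fact line_card, fact line_ex1,
    fact lines_card, use N_two in \<open>simp add: N_def\<close>)

text \<open>The set \<open>U\<close> of common neighbors induces a 2-regular graph; the zero-sum test vector is \<open>card U\<close>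
  on \<open>x\<close> and \<open>z\<close>, and \<open>- 2\<close> on \<open>U\<close>.\<close>

lemma mu_le_4:
  assumes xz: "x \<noteq> z" "\<not> E x z"
  shows "card {u. E x u \<and> E z u} \<le> 4"
proof (cases "{u. E x u \<and> E z u} = {}")
  case False
  define U where "U = {u. E x u \<and> E z u}"
  define \<mu> where "\<mu> = real (card U)"
  have fin: "finite U" unfolding U_def by (rule finite_nbr')
  have U: "E x y" "E z y" "y \<in> V" if "y \<in> U" for y using that E_V2 unfolding U_def by auto
  obtain y0 where y0: "y0 \<in> U" using False unfolding U_def by blast
  have xzV: "x \<in> V" "z \<in> V" using U(1,2)[OF y0] E_V by blast+
  have nU: "x \<notin> U" "z \<notin> U" unfolding U_def by auto
  define T where "T = insert x (insert z U)"
  define g where "g y = (if y \<in> U then - 2 else \<mu>)" for y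
  have gx: "g x = \<mu>" "g z = \<mu>" and gU: "g y = - 2" if "y \<in> U" for y using nU that unfolding g_def by auto
  have sumT: "(\<Sum>y\<in>T. F y) = F x + F z + (\<Sum>y\<in>U. F y)" for F :: "'a \<Rightarrow> real"
    unfolding T_def using fin nU xz by simp
  have nzx: "\<not> E z x" using xz E_sym by blast
  \<comment> \<open>\<open>x\<close> and \<open>z\<close> are non-adjacent neighbors of
    \<open>y\<close>, so \<open>two_common\<close> in the grid at \<open>y\<close> counts exactly
    the neighbors of \<open>y\<close> in \<open>U\<close>.\<close>
  have deg: "(\<Sum>w\<in>U. of_bool (E y w) :: real) = 2" if "y \<in> U" for y
  proof -
    have "{w \<in> U. E y w} = {w. E y w \<and> E x w \<and> E z w}" unfolding U_def by blast
    then show ?thesis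
      using grid.two_common[OF E_sym[OF U(1)[OF that]] E_sym[OF U(2)[OF that]] xz] sum_of_bool_card[OF fin, of "E y"] by simp
  qed
  have sx: "(\<Sum>w\<in>T. of_bool (E v w) * (g v * g w)) = - 2 * \<mu>\<^sup>2" if "v = x \<or> v = z" for v
  proof -
    have "(\<Sum>w\<in>U. of_bool (E v w) * (g v * g w)) = (\<Sum>w\<in>U. \<mu> * - 2)"
      using that U gU gx by (intro sum.cong refl) auto
    then show ?thesis unfolding sumT using that xz nzx by (auto simp: \<mu>_def power2_eq_square)
  qed
  have sU: "(\<Sum>w\<in>T. of_bool (E y w) * (g y * g w)) = - 4 * \<mu> + 8" if y: "y \<in> U" for y
  proof -
    have "(\<Sum>w\<in>U. of_bool (E y w) * (g y * g w)) = (\<Sum>w\<in>U. of_bool (E y w) * 4)"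
      using gU y by (intro sum.cong refl) auto
    also have "\<dots> = 8" using deg[OF y] by (simp add: sum_distrib_right[symmetric])
    finally have "(\<Sum>w\<in>U. of_bool (E y w) * (g y * g w)) = 8" .
    moreover have "E y x" "E y z" using U[OF y] E_sym by blast+
    ultimately show ?thesis unfolding sumT using gU[OF y] gx[OF y] by simp
  qed
  have "- (9 / 4) * (\<Sum>y\<in>T. (g y)\<^sup>2) \<le> (\<Sum>y\<in>T. \<Sum>w\<in>T. of_bool (E y w) * (g y * g w))"
  proof (rule local_bound)
    show "T \<subseteq> V" unfolding T_def using xzV U by auto
    show "sum g T = 0" unfolding sumT using gx[OF y0] gU by (simp add: \<mu>_def)
    have zx: "D x z \<le> 2" using D_le_2[OF U(1)[OF y0] E_sym[OF U(2)[OF y0]]] .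
    have UU: "D v w \<le> 2" if "v \<in> U" "w \<in> U" for v w using D_le_2[OF E_sym[OF U(1)[OF that(1)]] U(1)[OF that(2)]] .
    have D1: "D v w \<le> 2" if "E v w" for v w using D_one[OF E_V[OF that] E_V2[OF that]] that by simp
    have xU: "D x w \<le> 2" "D z w \<le> 2" "D w x \<le> 2" "D w z \<le> 2" if "w \<in> U" for w
      using D1[OF U(1)[OF that]] D1[OF U(2)[OF that]] D1[OF E_sym[OF U(1)[OF that]]] D1[OF E_sym[OF U(2)[OF that]]]
      by simp_all
    show "D v w \<le> 2" if "v \<in> T" "w \<in> T" for v w
      using that zx UU xU xzV D_sym[of z x] unfolding T_def by auto
  qed
  also have "(\<Sum>y\<in>T. \<Sum>w\<in>T. of_bool (E y w) * (g y * g w)) = - 4 * \<mu>\<^sup>2 + \<mu> * (- 4 * \<mu> + 8)"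
    unfolding sumT[of "\<lambda>y. \<Sum>w\<in>T. of_bool (E y w) * (g y * g w)"] using sx sU by (simp add: \<mu>_def)
  also have "(\<Sum>y\<in>T. (g y)\<^sup>2) = 2 * \<mu>\<^sup>2 + 4 * \<mu>"
    unfolding sumT using gx[OF y0] gU by (simp add: \<mu>_def)
  \<comment> \<open>Hence \<open>\<mu> \<le> 34 / 7\<close>, which is less than 5.\<close>
  finally have "7 / 2 * \<mu> * \<mu> \<le> 17 * \<mu>" by (simp add: power2_eq_square algebra_simps)
  moreover have "\<mu> > 0" using y0 fin unfolding \<mu>_def by (simp add: card_gt_0_iff) blast
  ultimately have "\<mu> < 5" by simp
  then show ?thesis unfolding \<mu>_def U_def by simp
next
  case True
  then show ?thesis by (simp only: card.empty)
qed

lemma connected_E: assumes x: "x \<in> V" shows "y \<in> V \<Longrightarrow> E\<^sup>*\<^sup>* x y"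
proof (induction "D x y" arbitrary: y)
  case 0
  then show ?case using D_zero[OF x] by simp
next
  case (Suc i)
  then obtain z where z: "E y z" "D x z = i" using D_pred[OF x Suc(3)] by metis
  then show ?case using Suc(1)[of z] E_V2[OF z(1)] E_sym by (metis rtranclp.rtrancl_into_rtrancl)
qed

text \<open>The isomorphism turns \<open>card (A - B)\<close> into \<open>D\<close>. Since
  \<open>n \<ge> m\<close>, the set \<open>S\<close> has two disjoint \<open>m\<close>-subsets,
  which are at distance \<open>m\<close>; so the diameter is the number of lines through a
  vertex.\<close>

theorem johnson:
  fixes S :: "'s set"
  assumes S: "finite S" "card S = m + n"
  obtains \<phi> where "bij_betw \<phi> {A. A \<subseteq> S \<and> card A = m} V"
    "\<And>A B. A \<subseteq> S \<Longrightarrow> card A = m \<Longrightarrow> B \<subseteq> S \<Longrightarrow> card B = m \<Longrightarrow> E (\<phi> A) (\<phi> B) \<longleftrightarrow> jadj A B"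
    "d = m"
proof -
  interpret JC: johnson_charts V E \<L> m n S
    by unfold_locales (use S m_ge_2 n_pos mu_le_4 in auto)
  obtain \<phi> where p: "bij_betw \<phi> JC.J V" "\<And>A B. A \<in> JC.J \<Longrightarrow> B \<in> JC.J \<Longrightarrow> E (\<phi> A) (\<phi> B) \<longleftrightarrow> jadj A B"
    using JC.johnson_iso[of thesis] connected_E D_att by blast
  have pV: "\<phi> A \<in> V" if "A \<in> JC.J" for A using bij_betw_apply[OF p(1) that] .
  have inj: "A = B" if "\<phi> A = \<phi> B" "A \<in> JC.J" "B \<in> JC.J" for A B
    using p(1) that unfolding bij_betw_def inj_on_def by blast
  have le: "D (\<phi> A) (\<phi> B) \<le> card (A - B)" if A: "A \<in> JC.J" and "B \<in> JC.J" for A B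
    using that(2)
  proof (induction "card (A - B)" arbitrary: B)
    case 0
    then have "B \<in> JC.rad A 0" unfolding JC.rad_def by simp
    then show ?case using JC.rad_0[OF A] pV[OF A] by simp
  next
    case (Suc j)
    then have "A \<noteq> B" by auto
    then obtain h e where he: "h \<in> B - A" "e \<in> A - B" using JC.pred_ex[OF Suc(3) A] by blast
    note sw = JC.closer_swap[OF Suc(3) A he]
    have C: "swap B h e \<in> JC.J" using JC.jn_J[OF sw(1)] .
    have "E (\<phi> (swap B h e)) (\<phi> B)" using p(2)[OF C Suc(3)] JC.jn_jadj[OF sw(1)] jadj_sym by blast
    then show ?case using D_step[OF pV[OF A]] Suc(1)[OF _ C] sw(2) Suc(2) by fastforce
  qed
  have ge: "card (A - B) \<le> D (\<phi> A) (\<phi> B)" if A: "A \<in> JC.J" and "B \<in> JC.J" for A B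
    using that(2)
  proof (induction "D (\<phi> A) (\<phi> B)" arbitrary: B)
    case 0
    then show ?case using D_zero[OF pV[OF A] pV[OF 0(2)]] inj[OF _ A 0(2)] by simp
  next
    case (Suc i)
    then obtain z where z: "E (\<phi> B) z" "D (\<phi> A) z = i" using D_pred[OF pV[OF A] pV[OF Suc(3)]] by metis
    obtain C where C: "C \<in> JC.J" "z = \<phi> C" using E_V2[OF z(1)] p(1) unfolding bij_betw_def by blast
    have "jadj B C" using p(2)[OF Suc(3) C(1)] z C by simp
    then obtain f where f: "C - B = {f}" unfolding jadj_def by blast
    have "card (A - B) \<le> card ((A - C) \<union> {f})" using f JC.J_finite[OF A] by (intro card_mono) auto
    also have "\<dots> \<le> Suc (card (A - C))" using JC.J_finite[OF A] by (simp add: card_insert_if)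
    finally show ?case using Suc(1)[of C] Suc(2) z C by simp
  qed
  have "d \<le> m"
  proof -
    obtain x y where xy: "x \<in> V" "y \<in> V" "D x y = d" using D_att by blast
    then obtain A B where AB: "A \<in> JC.J" "B \<in> JC.J" "x = \<phi> A" "y = \<phi> B" using p(1) unfolding bij_betw_def by blast
    have "d \<le> card (A - B)" using le[OF AB(1,2)] AB xy by simp
    also have "\<dots> \<le> m" using card_mono[OF JC.J_finite[OF AB(1)], of "A - B"] JC.J_card[OF AB(1)] by auto
    finally show ?thesis .
  qed
  moreover have "m \<le> d"
  proof -
    obtain A where A: "A \<subseteq> S" "card A = m" using obtain_subset_with_card_n[of m S] S by auto
    have "m * 1 \<le> m ^ 2" unfolding power2_eq_square by (rule mult_le_mono2) (use m_ge_2 in simp)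
    then have "m \<le> card (S - A)" using A S n_ge finite_subset[OF A(1) S(1)] by (simp add: card_Diff_subset)
    then obtain B where B: "B \<subseteq> S - A" "card B = m" using obtain_subset_with_card_n by metis
    have AB: "A \<in> JC.J" "B \<in> JC.J" "A - B = A" using A B unfolding JC.J_def by auto
    show ?thesis using ge[OF AB(1,2)] AB(3) A D_le[OF pV[OF AB(1)] pV[OF AB(2)]] by simp
  qed
  ultimately have "d = m" by simp
  with p show thesis by (intro that[of \<phi>]) (auto simp: JC.J_def)
qed

end

section \<open>Spectra and distances of graphs\<close>

text \<open>Eigenvectors as functions on the vertices, free of the enumeration behind
  \<open>adj_matrix\<close>.\<close>

definition graph_eigfun :: "'a pair_pre_digraph \<Rightarrow> real \<Rightarrow> ('a \<Rightarrow> real) \<Rightarrow> bool" where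
  "graph_eigfun G \<theta> w \<longleftrightarrow> (\<exists>x\<in>pverts G. w x \<noteq> 0) \<and>
    (\<forall>x\<in>pverts G. (\<Sum>y\<in>neighbors G x. w y) = \<theta> * w x)"

context pair_fin_digraph begin

lemma neighbors_sub: "neighbors G x \<subseteq> pverts G"
  unfolding neighbors_def using in_arcsD2 by blast

lemma adj_matrix_mult:
  assumes vs: "distinct vs" "set vs = pverts G" and i: "i < length vs"
  shows "(\<Sum>j<length vs. (if (vs ! i, vs ! j) \<in> parcs G then 1 else 0) * w (vs ! j)) =
    (\<Sum>y\<in>neighbors G (vs ! i). w y :: real)"
proof -
  have bij: "bij_betw ((!) vs) {..<length vs} (pverts G)"
    using bij_betw_nth[OF vs(1), of "{..<length vs}" "set vs"] vs by simp
  have "(\<Sum>j<length vs. (if (vs ! i, vs ! j) \<in> parcs G then 1 else 0) * w (vs ! j)) =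
      (\<Sum>y\<in>pverts G. (if (vs ! i, y) \<in> parcs G then 1 else 0) * w y)"
    by (rule sum.reindex_bij_betw[OF bij])
  also have "\<dots> = (\<Sum>y\<in>pverts G. if y \<in> neighbors G (vs ! i) then w y else 0)"
    by (rule sum.cong) (auto simp: neighbors_def)
  also have "\<dots> = (\<Sum>y\<in>neighbors G (vs ! i). w y)"
    using pair_finite_verts neighbors_sub[of "vs ! i"] by (simp add: sum.inter_restrict[symmetric] Int_absorb1)
  finally show ?thesis .
qed

lemma eigenvalue_adj_matrix_iff:
  assumes vs: "distinct vs" "set vs = pverts G"
  shows "eigenvalue (adj_matrix G vs) \<theta> \<longleftrightarrow> (\<exists>w. graph_eigfun G \<theta> w)"
proof -
  let ?n = "length vs" and ?A = "adj_matrix G vs"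
  have A: "?A \<in> carrier_mat ?n ?n" by (simp add: adj_matrix_def)
  have row: "(?A *\<^sub>v v) $ i = (\<Sum>j<?n. (if (vs ! i, vs ! j) \<in> parcs G then 1 else 0) * v $ j)"
    if "i < ?n" "v \<in> carrier_vec ?n" for i v
    using that by (simp add: adj_matrix_def scalar_prod_def lessThan_atLeast0)
  have idx: "\<exists>i<?n. vs ! i = x" if "x \<in> pverts G" for x
    using that vs by (metis in_set_conv_nth)
  show ?thesis
  proof
    assume "eigenvalue ?A \<theta>"
    then obtain v where v: "v \<in> carrier_vec ?n" "v \<noteq> 0\<^sub>v ?n" "?A *\<^sub>v v = \<theta> \<cdot>\<^sub>v v"
      unfolding eigenvalue_def eigenvector_def using A by auto
    define w where "w x = v $ (THE i. i < ?n \<and> vs ! i = x)" for x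
    have w: "w (vs ! i) = v $ i" if "i < ?n" for i
    proof -
      have "(THE j. j < ?n \<and> vs ! j = vs ! i) = i"
        by (rule the_equality) (use that vs nth_eq_iff_index_eq in auto)
      then show ?thesis by (simp add: w_def)
    qed
    have "\<exists>i<?n. v $ i \<noteq> 0"
      using v(1,2) by (metis carrier_vecD eq_vecI index_zero_vec)
    then have "\<exists>x\<in>pverts G. w x \<noteq> 0" using w vs by (metis nth_mem)
    moreover have "(\<Sum>y\<in>neighbors G x. w y) = \<theta> * w x" if x: "x \<in> pverts G" for x
    proof -
      obtain i where i: "i < ?n" "x = vs ! i" using idx[OF x] by blast
      have "(\<Sum>y\<in>neighbors G x. w y) = (\<Sum>j<?n. (if (vs ! i, vs ! j) \<in> parcs G then 1 else 0) * w (vs ! j))"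
        unfolding i(2) by (rule adj_matrix_mult[OF vs i(1), symmetric])
      also have "\<dots> = (?A *\<^sub>v v) $ i" unfolding row[OF i(1) v(1)] using w by (intro sum.cong) auto
      also have "\<dots> = \<theta> * w x" unfolding v(3) using i v(1) w by simp
      finally show ?thesis .
    qed
    ultimately show "\<exists>w. graph_eigfun G \<theta> w" unfolding graph_eigfun_def by blast
  next
    assume "\<exists>w. graph_eigfun G \<theta> w"
    then obtain w x where w: "x \<in> pverts G" "w x \<noteq> 0"
      "\<And>x. x \<in> pverts G \<Longrightarrow> (\<Sum>y\<in>neighbors G x. w y) = \<theta> * w x" unfolding graph_eigfun_def by blast
    define v where "v = vec ?n (\<lambda>i. w (vs ! i))"
    have vc: "v \<in> carrier_vec ?n" by (simp add: v_def)
    obtain i where i: "i < ?n" "vs ! i = x" using idx[OF w(1)] by blast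
    have "v $ i \<noteq> 0" using i w by (simp add: v_def)
    then have "v \<noteq> 0\<^sub>v ?n" using i by auto
    moreover have "?A *\<^sub>v v = \<theta> \<cdot>\<^sub>v v"
    proof (rule eq_vecI)
      fix i assume "i < dim_vec (\<theta> \<cdot>\<^sub>v v)"
      then have i: "i < ?n" by (simp add: v_def)
      have "(?A *\<^sub>v v) $ i = (\<Sum>j<?n. (if (vs ! i, vs ! j) \<in> parcs G then 1 else 0) * w (vs ! j))"
        unfolding row[OF i vc] by (rule sum.cong) (auto simp: v_def)
      also have "\<dots> = \<theta> * w (vs ! i)"
        unfolding adj_matrix_mult[OF vs i] using w(3)[of "vs ! i"] i vs nth_mem by metis
      finally show "(?A *\<^sub>v v) $ i = (\<theta> \<cdot>\<^sub>v v) $ i" using i by (simp add: v_def)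
    qed (use A vc in simp)
    ultimately show "eigenvalue ?A \<theta>"
      unfolding eigenvalue_def eigenvector_def using vc A by auto
  qed
qed

lemma graph_spectrum_iff: "\<theta> \<in> graph_spectrum G \<longleftrightarrow> (\<exists>w. graph_eigfun G \<theta> w)"
proof -
  obtain vs where "set vs = pverts G" "distinct vs" using finite_distinct_list[OF pair_finite_verts] by blast
  then show ?thesis unfolding graph_spectrum_def using eigenvalue_adj_matrix_iff by blast
qed

text \<open>Finiteness gives meaning to the \<open>Min\<close> and \<open>Max\<close> that define
  the extremal eigenvalues.\<close>

lemma finite_graph_spectrum: "finite (graph_spectrum G)"
proof -
  obtain vs where vs: "set vs = pverts G" "distinct vs" using finite_distinct_list[OF pair_finite_verts] by blast
  let ?A = "adj_matrix G vs"
  have A: "?A \<in> carrier_mat (length vs) (length vs)" by (simp add: adj_matrix_def)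
  have "char_poly ?A \<noteq> 0" using degree_monic_char_poly[OF A] by auto
  then have "finite {\<theta>. poly (char_poly ?A) \<theta> = 0}" by (rule poly_roots_finite)
  then have "finite {\<theta>. eigenvalue ?A \<theta>}" unfolding eigenvalue_root_char_poly[OF A] .
  moreover have "graph_spectrum G \<subseteq> {\<theta>. eigenvalue ?A \<theta>}"
    using graph_spectrum_iff eigenvalue_adj_matrix_iff[OF vs(2,1)] by blast
  ultimately show ?thesis by (rule finite_subset[rotated])
qed

end

text \<open>A least exponent replaces the infimum over walks in \<open>gdist\<close>; it is
  meaningful only if \<open>v\<close> is reachable from \<open>u\<close>.\<close>

definition walk_dist :: "'a pair_pre_digraph \<Rightarrow> 'a \<Rightarrow> 'a \<Rightarrow> nat" where
  "walk_dist G u v = (LEAST i. (u, v) \<in> parcs G ^^ i)"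

context pair_wf_digraph begin

lemma awalk_relpow: "awalk u p v \<Longrightarrow> (u, v) \<in> parcs G ^^ length p"
proof (induction p arbitrary: u)
  case Nil
  then show ?case by (simp add: awalk_Nil_iff)
next
  case (Cons e p)
  then have "(u, snd e) \<in> parcs G" "awalk (snd e) p v" by (auto simp: awalk_Cons_iff)
  then show ?case unfolding length_Cons by (intro relpow_Suc_I2[OF _ Cons.IH])
qed

lemma relpow_awalk: "(u, v) \<in> parcs G ^^ i \<Longrightarrow> u \<in> pverts G \<Longrightarrow> \<exists>p. awalk u p v \<and> length p = i"
proof (induction i arbitrary: u)
  case 0
  then show ?case by (auto simp: awalk_Nil_iff)
next
  case (Suc i)
  then obtain w where w: "(u, w) \<in> parcs G" "(w, v) \<in> parcs G ^^ i" by (metis relpow_Suc_D2)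
  then obtain p where "awalk w p v" "length p = i" using Suc.IH in_arcsD2 by blast
  then have "awalk u ((u, w) # p) v" "length ((u, w) # p) = Suc i" using w(1) in_arcsD1 by (auto simp: awalk_Cons_iff)
  then show ?case by blast
qed

lemma awalk_cost_one: "awalk_cost (\<lambda>_. 1) p = length p"
  by (induction p) auto

lemma gdist_walk_dist:
  assumes u: "u \<in> pverts G" and conn: "(u, v) \<in> (parcs G)\<^sup>*"
  shows "gdist G u v = ereal (real (walk_dist G u v))"
proof -
  obtain i where i: "(u, v) \<in> parcs G ^^ i" using conn rtrancl_imp_relpow by blast
  have W: "(u, v) \<in> parcs G ^^ walk_dist G u v" unfolding walk_dist_def by (rule LeastI[of _ i]) (rule i)
  then obtain p where p: "awalk u p v" "length p = walk_dist G u v" using relpow_awalk u by blast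
  have 1: "\<mu> (\<lambda>_. 1) u v \<le> ereal (real (walk_dist G u v))"
    using min_cost_le_walk_cost[OF p(1), of "\<lambda>_. 1"] p(2) by (simp add: awalk_cost_one)
  have "ereal (real (walk_dist G u v)) \<le> \<mu> (\<lambda>_. 1) u v"
    unfolding \<mu>_def
  proof (rule INF_greatest)
    fix q assume "q \<in> {p. awalk u p v}"
    then have "(u, v) \<in> parcs G ^^ length q" using awalk_relpow by blast
    then have "walk_dist G u v \<le> length q" unfolding walk_dist_def by (rule Least_le)
    then show "ereal (real (walk_dist G u v)) \<le> ereal (awalk_cost (\<lambda>_. 1) q)" by (simp add: awalk_cost_one)
  qed
  with 1 show ?thesis unfolding gdist_def by simp
qed

end

lemma (in pair_graph) mk_symmetric_parcs: "parcs (mk_symmetric (with_proj G)) = parcs G"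
  unfolding mk_symmetric_def using arcs_symmetric by force

text \<open>\<open>connected\<close> speaks of the symmetric closure, which has the same arcs when
  the digraph is symmetric.\<close>

lemma (in pair_graph) connected_rtrancl:
  assumes "connected (with_proj G)" "u \<in> pverts G" "v \<in> pverts G"
  shows "(u, v) \<in> (parcs G)\<^sup>*"
proof -
  have "u \<rightarrow>\<^sup>*\<^bsub>with_proj (mk_symmetric (with_proj G))\<^esub> v"
    using assms unfolding connected_def strongly_connected_def by (simp add: mk_symmetric_def)
  then have "(u, v) \<in> rtrancl_on (pverts (mk_symmetric (with_proj G))) (parcs G)"
    unfolding reachable_def by (simp add: mk_symmetric_parcs)
  then show ?thesis by (rule rtrancl_on_rtranclI)
qed

lemma relpow_sym:
  assumes "\<And>x y. (x, y) \<in> R \<Longrightarrow> (y, x) \<in> R" shows "(x, y) \<in> R ^^ i \<Longrightarrow> (y, x) \<in> R ^^ i"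
proof (induction i arbitrary: x y)
  case (Suc i)
  then obtain z where "(x, z) \<in> R ^^ i" "(z, y) \<in> R" by auto
  then show ?case using Suc.IH assms relpow_Suc_I2 by metis
qed auto

lemma distance_regular_drg:
  assumes dr: "distance_regular X d a b c" and d2: "d \<ge> 2"
  shows "drg (pverts X) (\<lambda>x y. (x, y) \<in> parcs X) (walk_dist X) d a b c"
proof -
  have pg: "pair_graph X" and con: "connected (with_proj X)" and diam: "diameter X = ereal (real d)"
    using dr unfolding distance_regular_def by auto
  interpret pair_graph X by (rule pg)
  let ?V = "pverts X" and ?D = "walk_dist X"
  have ne: "?V \<noteq> {}" using con unfolding connected_def strongly_connected_def by (simp add: mk_symmetric_def)
  have sym: "(x, y) \<in> parcs X \<Longrightarrow> (y, x) \<in> parcs X" for x y by (rule arcs_symmetric)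
  have path: "(x, y) \<in> (parcs X)\<^sup>*" if "x \<in> ?V" "y \<in> ?V" for x y using connected_rtrancl con that by blast
  have gd: "gdist X x y = ereal (real (?D x y))" if "x \<in> ?V" "y \<in> ?V" for x y
    by (rule gdist_walk_dist[OF that(1) path[OF that]])
  have Dw: "(x, y) \<in> parcs X ^^ ?D x y" if "x \<in> ?V" "y \<in> ?V" for x y
  proof -
    from rtrancl_imp_relpow[OF path[OF that]] obtain i where i: "(x, y) \<in> parcs X ^^ i" ..
    show ?thesis unfolding walk_dist_def by (rule LeastI[of _ i]) (rule i)
  qed
  have Dle: "?D x y \<le> i" if "(x, y) \<in> parcs X ^^ i" for x y i
    unfolding walk_dist_def using that by (rule Least_le)
  have D0: "?D x y = 0 \<longleftrightarrow> x = y" if "x \<in> ?V" "y \<in> ?V" for x y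
  proof
    assume "?D x y = 0"
    then show "x = y" using Dw[OF that] by simp
  next
    assume "x = y"
    then show "?D x y = 0" using Dle[of x y 0] by simp
  qed
  have D1: "?D x y = 1 \<longleftrightarrow> (x, y) \<in> parcs X" if "x \<in> ?V" "y \<in> ?V" for x y
  proof
    assume "?D x y = 1"
    then show "(x, y) \<in> parcs X" using Dw[OF that] by simp
  next
    assume xy: "(x, y) \<in> parcs X"
    then have "?D x y \<le> 1" using Dle[of x y 1] by simp
    moreover have "?D x y \<noteq> 0" using D0[OF that] xy no_loops' by blast
    ultimately show "?D x y = 1" by simp
  qed
  have dle: "?D x y \<le> d" if "x \<in> ?V" "y \<in> ?V" for x y
  proof -
    have "gdist X x y \<le> (SUP v\<in>?V. gdist X x v)" by (rule SUP_upper[OF that(2)])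
    also have "\<dots> \<le> diameter X" unfolding diameter_def by (rule SUP_upper[OF that(1)])
    finally show ?thesis using gd[OF that] diam by simp
  qed
  have att: "\<exists>x\<in>?V. \<exists>y\<in>?V. ?D x y = d"
  proof (rule ccontr)
    assume "\<not> ?thesis"
    \<comment> \<open>Distances are integers, so if \<open>d\<close> is missed they are all at most
      \<open>d - 1\<close>, and so is their supremum.\<close>
    then have "gdist X x y \<le> ereal (real (d - 1))" if "x \<in> ?V" "y \<in> ?V" for x y
      using dle[OF that] gd[OF that] that by fastforce
    then have "diameter X \<le> ereal (real (d - 1))" unfolding diameter_def by (intro SUP_least) auto
    then show False using diam d2 by simp
  qed
  have num: "card {u. (w, u) \<in> parcs X \<and> Suc (?D v u) = ?D v w} = c (?D v w) \<and>
      card {u. (w, u) \<in> parcs X \<and> ?D v u = ?D v w} = a (?D v w) \<and>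
      card {u. (w, u) \<in> parcs X \<and> ?D v u = Suc (?D v w)} = b (?D v w)"
    if vw: "v \<in> ?V" "w \<in> ?V" for v w
  proof -
    let ?i = "?D v w"
    have g: "gdist X v u = ereal (real (?D v u))" if "(w, u) \<in> parcs X" for u
      using gd[OF vw(1) in_arcsD2[OF that]] .
    have "{u \<in> neighbors X w. gdist X v u + 1 = ereal (real ?i)} = {u. (w, u) \<in> parcs X \<and> Suc (?D v u) = ?D v w}"
      using g by (auto simp: neighbors_def one_ereal_def)
    moreover have "{u \<in> neighbors X w. gdist X v u = ereal (real ?i)} = {u. (w, u) \<in> parcs X \<and> ?D v u = ?D v w}"
      using g by (auto simp: neighbors_def)
    moreover have "{u \<in> neighbors X w. gdist X v u = ereal (real (?i + 1))} = {u. (w, u) \<in> parcs X \<and> ?D v u = Suc (?D v w)}"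
      using g by (auto simp: neighbors_def)
    moreover have "card {u \<in> neighbors X w. gdist X v u + 1 = ereal (real ?i)} = c ?i \<and>
        card {u \<in> neighbors X w. gdist X v u = ereal (real ?i)} = a ?i \<and>
        card {u \<in> neighbors X w. gdist X v u = ereal (real (?i + 1))} = b ?i"
      using dr dle[OF vw] vw gd[OF vw] unfolding distance_regular_def by blast
    ultimately show ?thesis by simp
  qed
  show ?thesis
  proof
    show "?D x y = ?D y x" if "x \<in> ?V" "y \<in> ?V" for x y
      using Dle[OF relpow_sym[OF sym Dw[OF that]]] Dle[OF relpow_sym[OF sym Dw[OF that(2,1)]]] by simp
    show "?D x z \<le> Suc (?D x y)" if "x \<in> ?V" "(y, z) \<in> parcs X" for x y z
      by (rule Dle, rule relpow_Suc_I[OF Dw[OF that(1) in_arcsD1[OF that(2)]] that(2)])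
    show "\<exists>z. (y, z) \<in> parcs X \<and> ?D x z = i" if xy: "x \<in> ?V" "y \<in> ?V" "?D x y = Suc i" for x y i
    proof -
      have "(x, y) \<in> parcs X ^^ Suc i" using Dw[OF xy(1,2)] xy(3) by simp
      then obtain z where z: "(x, z) \<in> parcs X ^^ i" "(z, y) \<in> parcs X" by auto
      have "?D x z \<le> i" by (rule Dle[OF z(1)])
      moreover have "?D x y \<le> Suc (?D x z)"
        by (rule Dle, rule relpow_Suc_I[OF Dw[OF xy(1) in_arcsD1[OF z(2)]] z(2)])
      ultimately have "?D x z = i" using xy(3) by simp
      then show ?thesis using sym z by blast
    qed
    show "(x, x) \<notin> parcs X" for x using no_loops'[of x x] by blast
  qed (use sym in_arcsD1 pair_finite_verts D0 D1 dle att num d2 in auto)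
qed

lemma neighborhood_connected:
  assumes pg: "pair_graph X" and con: "connected (neighborhood_graph X v)"
    and xy: "(v, x) \<in> parcs X" "(v, y) \<in> parcs X"
  shows "(\<lambda>p q. (v, p) \<in> parcs X \<and> (v, q) \<in> parcs X \<and> (p, q) \<in> parcs X)\<^sup>*\<^sup>* x y"
proof -
  interpret pair_graph X by (rule pg)
  let ?M = "mk_symmetric (neighborhood_graph X v)"
  have V: "pverts ?M = neighbors X v"
    by (simp add: mk_symmetric_def neighborhood_graph_def induce_subgraph_def)
  have A: "(p, q) \<in> parcs ?M \<Longrightarrow> (v, p) \<in> parcs X \<and> (v, q) \<in> parcs X \<and> (p, q) \<in> parcs X" for p q
    using arcs_symmetric by (auto simp: mk_symmetric_def neighborhood_graph_def induce_subgraph_def neighbors_def)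
  have "x \<rightarrow>\<^sup>*\<^bsub>with_proj ?M\<^esub> y"
    using con xy V unfolding connected_def strongly_connected_def by (simp add: neighbors_def)
  then have "(x, y) \<in> (parcs ?M)\<^sup>*"
    unfolding reachable_def by (simp add: rtrancl_on_rtranclI)
  then show ?thesis
  proof (induction rule: rtrancl_induct)
    case (step p q)
    then show ?case using A[OF step(2)] by (auto intro: rtranclp.rtrancl_into_rtrancl)
  qed simp
qed

section \<open>The constant \<open>\<vartheta>\<^sub>1\<close>\<close>

text \<open>A coarse lower bound suffices; it comes from the star with five leaves, whose smallest
  eigenvalue is \<open>- sqrt 5\<close>.\<close>

definition star5 :: "nat pair_pre_digraph" where
  "star5 = \<lparr>pverts = {..5}, parcs = {0} \<times> {1..5} \<union> {1..5} \<times> {0}\<rparr>"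

lemma star5_pair_graph: "pair_graph star5"
proof
  show "finite (parcs star5)" by (simp add: star5_def)
  show "symmetric (with_proj star5)"
    unfolding symmetric_def by (auto simp: star5_def sym_def)
qed (auto simp: star5_def)

lemma star5_neighbors:
  "neighbors star5 0 = {1..5}" "i \<in> {1..5} \<Longrightarrow> neighbors star5 i = {0}"
  by (auto simp: neighbors_def star5_def)

lemma star5_eigfun_iff:
  "graph_eigfun star5 \<theta> w \<longleftrightarrow> (\<exists>x\<le>5. w x \<noteq> 0) \<and> (\<Sum>y=1..5. w y) = \<theta> * w 0 \<and> (\<forall>i\<in>{1..5}. w 0 = \<theta> * w i)"
proof -
  have V: "pverts star5 = insert 0 {1..5}" by (auto simp: star5_def)
  have "(\<forall>x\<in>pverts star5. (\<Sum>y\<in>neighbors star5 x. w y) = \<theta> * w x) \<longleftrightarrow>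
      (\<Sum>y=1..5. w y) = \<theta> * w 0 \<and> (\<forall>i\<in>{1..5}. w 0 = \<theta> * w i)"
    unfolding V using star5_neighbors by (simp add: ball_simps del: atLeastAtMost_iff)
  moreover have "(\<exists>x\<in>pverts star5. w x \<noteq> 0) \<longleftrightarrow> (\<exists>x\<le>5. w x \<noteq> 0)" by (auto simp: star5_def)
  ultimately show ?thesis unfolding graph_eigfun_def by simp
qed

lemma star5_smallest_eigenvalue: "smallest_eigenvalue star5 = - sqrt 5"
proof -
  interpret pair_graph star5 by (rule star5_pair_graph)
  have "graph_eigfun star5 (- sqrt 5) (\<lambda>x. if x = 0 then - sqrt 5 else 1)"
    unfolding star5_eigfun_iff by auto
  then have mem: "- sqrt 5 \<in> graph_spectrum star5" using graph_spectrum_iff by blast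
  have "- sqrt 5 \<le> \<theta>" if "\<theta> \<in> graph_spectrum star5" for \<theta>
  proof -
    from that obtain w where "graph_eigfun star5 \<theta> w" unfolding graph_spectrum_iff ..
    note w' = this[unfolded star5_eigfun_iff]
    have w: "\<exists>x\<le>5. w x \<noteq> 0" "(\<Sum>y=1..5. w y) = \<theta> * w 0" "\<And>i. i \<in> {1..5} \<Longrightarrow> w 0 = \<theta> * w i"
      using w' by blast+
    show ?thesis
    proof (cases "w 0 = 0")
      case True
      then obtain x where "x \<in> {1..5}" "w x \<noteq> 0" using w(1) by (metis One_nat_def Suc_leI atLeastAtMost_iff neq0_conv)
      then have "\<theta> = 0" using w(3)[of x] True by simp
      then show ?thesis by simp
    next
      case False
      have "\<theta> * (\<theta> * w 0) = (\<Sum>y\<in>{1..5::nat}. \<theta> * w y)" unfolding w(2)[symmetric] by (rule sum_distrib_left)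
      also have "\<dots> = (\<Sum>y\<in>{1..5::nat}. w 0)" using w(3) by (intro sum.cong) auto
      finally have "\<theta>\<^sup>2 = 5" using False by (simp add: power2_eq_square)
      then have "\<bar>\<theta>\<bar> = sqrt 5" by (metis real_sqrt_abs)
      then show ?thesis by linarith
    qed
  qed
  then show ?thesis unfolding smallest_eigenvalue_def using mem finite_graph_spectrum by (intro Min_eqI) auto
qed

lemma star5_min_valency_one: "min_valency_one star5"
proof -
  have "out_arcs (with_proj star5) v = (if v = 0 then {0} \<times> {1..5} else {(v, 0)})" if "v \<le> 5" for v
    using that by (auto simp: out_arcs_def star5_def)
  then have "out_degree (with_proj star5) v = (if v = 0 then 5 else 1)" if "v \<le> 5" for v
    using that by (simp add: out_degree_def)
  then show ?thesis unfolding min_valency_one_def by (auto simp: star5_def intro!: bexI[of _ 1])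
qed

text \<open>A star with four leaves has smallest eigenvalue exactly \<open>- 2\<close>, so five
  leaves give the smallest star that counts; its \<open>- sqrt 5\<close> is still above
  \<open>- 9 / 4\<close>.\<close>

lemma vartheta1_bounds: "- 9 / 4 \<le> vartheta1" "vartheta1 \<le> - 2"
proof -
  let ?T = "{smallest_eigenvalue H | H :: nat pair_pre_digraph.
     pair_graph H \<and> min_valency_one H \<and> smallest_eigenvalue H < - 2}"
  have s: "sqrt 5 > 2" by (rule real_less_rsqrt) simp
  have s': "sqrt 5 \<le> 9 / 4" by (rule real_le_lsqrt) (simp_all add: power2_eq_square)
  have mem: "- sqrt 5 \<in> ?T"
    using star5_pair_graph star5_min_valency_one star5_smallest_eigenvalue s by (intro CollectI exI[of _ star5]) auto
  have bd: "bdd_above ?T" by (rule bdd_aboveI[of _ "-2"]) auto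
  show "vartheta1 \<le> - 2" unfolding vartheta1_def by (rule cSup_least) (use mem in auto)
  have "- sqrt 5 \<le> vartheta1" unfolding vartheta1_def by (rule cSup_upper[OF mem bd])
  then show "- 9 / 4 \<le> vartheta1" using s' by simp
qed

text \<open>Since \<open>1 - eps_star\<close> is \<open>1 / (- 1 - vartheta1)\<close>, the bound
  \<open>- 9 / 4\<close> turns into \<open>4 / 5\<close>; that \<open>vartheta1\<close> is at most
  \<open>- 2\<close> makes the denominator positive.\<close>

lemma eps_star_bound: "1 - eps_star \<ge> 4 / 5"
proof -
  have "- 1 - vartheta1 > 0" "- 1 - vartheta1 \<le> 5 / 4" using vartheta1_bounds by simp_all
  moreover from this have eq: "1 - eps_star = 1 / (- 1 - vartheta1)"
    unfolding eps_star_def by (simp add: field_simps)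
  ultimately show ?thesis unfolding eq by (subst pos_le_divide_eq) simp_all
qed

section \<open>The characterization\<close>

text \<open>The eigenvalue equation is evaluated at a vertex where the eigenfunction is largest in
  absolute value.\<close>

lemma (in drg) eigval_le:
  assumes "eigval \<theta>" shows "\<theta> \<le> b 0"
proof -
  obtain f x0 where f: "eigfun \<theta> f" "x0 \<in> V" "f x0 \<noteq> 0" using assms unfolding eigval_def by blast
  obtain x where x: "x \<in> V" "\<And>y. y \<in> V \<Longrightarrow> \<bar>f y\<bar> \<le> \<bar>f x\<bar>"
  proof -
    have "Max ((\<lambda>y. \<bar>f y\<bar>) ` V) \<in> (\<lambda>y. \<bar>f y\<bar>) ` V" using finite_V f(2) by (intro Max_in) auto
    then obtain x where "x \<in> V" "\<bar>f x\<bar> = Max ((\<lambda>y. \<bar>f y\<bar>) ` V)" by (metis imageE)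
    then show thesis using finite_V by (intro that[of x]) simp_all
  qed
  have "\<bar>f x\<bar> > 0" using x(2)[OF f(2)] f(3) by linarith
  have "\<theta> * \<bar>f x\<bar> \<le> \<bar>\<theta> * f x\<bar>" by (simp add: abs_mult mult_right_mono)
  also have "\<theta> * f x = (\<Sum>y | E x y. f y)" using f(1) x(1) unfolding eigfun_def by simp
  also have "\<bar>\<Sum>y | E x y. f y\<bar> \<le> (\<Sum>y | E x y. \<bar>f y\<bar>)" by (rule sum_abs)
  also have "\<dots> \<le> (\<Sum>y | E x y. \<bar>f x\<bar>)" by (rule sum_mono) (use x(2) E_V2 in auto)
  also have "\<dots> = b 0 * \<bar>f x\<bar>" using degree[OF x(1)] by simp
  finally show ?thesis using \<open>\<bar>f x\<bar> > 0\<close> by simp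
qed

lemma jadj_iff_card:
  assumes "finite A" "finite B" "card A = d" "card B = d" "d > 0"
  shows "jadj A B \<longleftrightarrow> card (A \<inter> B) + 1 = d"
proof -
  have "card (A - B) = d - card (A \<inter> B)" "card (B - A) = d - card (A \<inter> B)"
    using assms card_Diff_subset_Int[of A B] card_Diff_subset_Int[of B A] by (simp_all add: Int_commute)
  moreover have "card (A \<inter> B) \<le> d" using assms card_mono[of A "A \<inter> B"] by auto
  moreover have "jadj A B \<longleftrightarrow> card (A - B) = 1 \<and> card (B - A) = 1"
    unfolding is_singleton_altdef[symmetric] jadj_def is_singleton_def by blast
  ultimately show ?thesis using assms(5) by auto
qed

lemma digraph_iso_of_bij:
  assumes wf: "pair_wf_digraph G" and bij: "bij_betw \<psi> (pverts G) (pverts H)"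
    and H: "\<And>x y. (x, y) \<in> parcs H \<Longrightarrow> x \<in> pverts H \<and> y \<in> pverts H"
    and adj: "\<And>x y. x \<in> pverts G \<Longrightarrow> y \<in> pverts G \<Longrightarrow> (\<psi> x, \<psi> y) \<in> parcs H \<longleftrightarrow> (x, y) \<in> parcs G"
  shows "digraph_iso (with_proj G) (with_proj H)"
proof -
  interpret pair_wf_digraph G by (rule wf)
  define h where "h = \<lparr>iso_verts = \<psi>, iso_arcs = map_prod \<psi> \<psi>, iso_head = snd, iso_tail = fst\<rparr>"
  have inj: "inj_on \<psi> (pverts G)" and im: "\<psi> ` pverts G = pverts H" using bij by (auto simp: bij_betw_def)
  have "inj_on (map_prod \<psi> \<psi>) (parcs G)"
    by (rule inj_on_subset[OF map_prod_inj_on[OF inj inj]]) (use in_arcsD1 in_arcsD2 in auto)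
  then have "digraph_isomorphism h"
    unfolding digraph_isomorphism_def h_def using inj wf_digraph_axioms by auto
  moreover have "map_prod \<psi> \<psi> ` parcs G = parcs H"
  proof (intro equalityI subsetI)
    fix e assume "e \<in> map_prod \<psi> \<psi> ` parcs G"
    then obtain x y where "(x, y) \<in> parcs G" "e = (\<psi> x, \<psi> y)" by auto
    then show "e \<in> parcs H" using adj in_arcsD1 in_arcsD2 by metis
  next
    fix e assume "e \<in> parcs H"
    then obtain p q where e: "e = (p, q)" "p \<in> pverts H" "q \<in> pverts H" "(p, q) \<in> parcs H" using H by (cases e) auto
    then obtain x y where xy: "x \<in> pverts G" "p = \<psi> x" "y \<in> pverts G" "q = \<psi> y" using im by blast
    then have "(x, y) \<in> parcs G" using adj e by simp
    then show "e \<in> map_prod \<psi> \<psi> ` parcs G" using e xy by force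
  qed
  then have "with_proj H = app_iso h (with_proj G)"
    using im by (simp add: app_iso_def h_def with_proj_def)
  ultimately show ?thesis unfolding digraph_iso_def by blast
qed

theorem theorem1p2:
  fixes X :: "'a pair_pre_digraph"
    and d :: nat and a b c :: "nat \<Rightarrow> nat"
    and m \<theta>1 :: real
  assumes "distance_regular X d a b c"
    and "d \<ge> 2"
    and "geometric X (b 0)"
    and "smallest_eigenvalue X = - m"
    and "second_largest_eigenvalue X = \<theta>1"
    and "c 2 \<ge> 2"
    and "\<theta>1 + 1 > (1 - eps_star) * real (b 1)"
    and "real (b 0) \<ge> max (m ^ 3) 29"
    and "\<exists>v\<in>pverts X. connected (neighborhood_graph X v)"
  shows "\<exists>s::nat. real s = real (b 0) / real d + real d \<and> s \<ge> 2 * d + 1 \<and>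
           digraph_iso (with_proj X) (with_proj (johnson_graph s d))"
proof -
  have pg: "pair_graph X" using assms(1) unfolding distance_regular_def by blast
  interpret pair_graph X by (rule pg)
  let ?V = "pverts X" and ?E = "\<lambda>x y. (x, y) \<in> parcs X"
  interpret dr: drg ?V ?E "walk_dist X" d a b c by (rule distance_regular_drg[OF assms(1,2)])
  have eig: "dr.eigval \<theta> \<longleftrightarrow> \<theta> \<in> graph_spectrum X" for \<theta>
    unfolding graph_spectrum_iff dr.eigval_def dr.eigfun_def graph_eigfun_def neighbors_def by blast
  obtain v0 where v0: "v0 \<in> ?V" using dr.D_att by blast
  have "dr.eigval (real (b 0))" unfolding dr.eigval_def using dr.eigfun_one v0 by (intro exI[of _ "\<lambda>_. 1"]) auto
  then have k: "real (b 0) \<in> graph_spectrum X" by (simp add: eig)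
  have maxk: "Max (graph_spectrum X) = real (b 0)"
    by (rule Max_eqI[OF finite_graph_spectrum _ k]) (use dr.eigval_le eig in blast)
  have mS: "- m \<in> graph_spectrum X"
    using Min_in[OF finite_graph_spectrum] k assms(4) unfolding smallest_eigenvalue_def by auto
  obtain \<C> where geo: "(\<forall>C\<in>\<C>. delsarte_clique X (b 0) C) \<and>
      (\<forall>u v. (u, v) \<in> parcs X \<longrightarrow> (\<exists>!C. C \<in> \<C> \<and> u \<in> C \<and> v \<in> C))"
    using assms(3) unfolding geometric_def ..
  have C: "delsarte_clique X (b 0) C" if "C \<in> \<C>" for C using geo that by simp
  have ex1: "\<exists>!C. C \<in> \<C> \<and> u \<in> C \<and> v \<in> C" if "(u, v) \<in> parcs X" for u v using geo that by simp
  have card: "real (card C) = 1 + real (b 0) / m" if "C \<in> \<C>" for C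
    using C[OF that] assms(4) unfolding delsarte_clique_def by simp
  have CV: "C \<subseteq> ?V" if "C \<in> \<C>" for C
    using C[OF that] unfolding delsarte_clique_def clique_def by blast
  have k29: "real (b 0) \<ge> 29" and km: "real (b 0) \<ge> m ^ 3" using assms(8) by auto
  \<comment> \<open>The sign of \<open>m\<close> has to be derived: an edge exists because the
    degree is positive, and its clique has at least two vertices, so
    \<open>b 0 / m \<ge> 1\<close>.\<close>
  have "{y. ?E v0 y} \<noteq> {}" using dr.degree[OF v0] k29 by (metis card.empty of_nat_0 not_numeral_le_zero)
  then obtain w0 where w0: "(v0, w0) \<in> parcs X" by blast
  obtain C0 where C0: "C0 \<in> \<C>" "v0 \<in> C0" "w0 \<in> C0" using ex1_implies_ex[OF ex1[OF w0]] by blast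
  have "finite C0" using CV[OF C0(1)] pair_finite_verts finite_subset by blast
  moreover have "v0 \<noteq> w0" using no_loops'[OF w0] .
  ultimately have "card C0 \<ge> 2" using C0 card_mono[of C0 "{v0, w0}"] by simp
  then have kge: "real (b 0) / m \<ge> 1" using card[OF C0(1)] by linarith
  have m0: "m > 0"
  proof (rule ccontr)
    assume "\<not> m > 0"
    then have "real (b 0) / m \<le> 0" by (intro divide_nonneg_nonpos) simp_all
    with kge show False by simp
  qed
  define n where "n = card C0 - 1"
  have n: "real n = real (b 0) / m" "n > 0" using \<open>card C0 \<ge> 2\<close> card[OF C0(1)] by (auto simp: n_def)
  \<comment> \<open>The spectrum has an element besides its maximum \<open>b 0\<close>, so the
    \<open>Max\<close> in \<open>second_largest_eigenvalue\<close> is attained.\<close>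
  have "- m \<noteq> real (b 0)" using m0 k29 by linarith
  then have "second_largest_eigenvalue X \<in> graph_spectrum X - {real (b 0)}"
    unfolding second_largest_eigenvalue_def maxk using mS finite_graph_spectrum by (intro Max_in) auto
  then have th: "\<theta>1 \<in> graph_spectrum X" "\<theta>1 \<noteq> real (b 0)" using assms(5) by auto
  interpret gd: geometric_drg ?V ?E "walk_dist X" d a b c \<C> n m \<theta>1
  proof
    show "card C = n + 1" if "C \<in> \<C>" for C
    proof -
      have "real (card C) = real (n + 1)" using card[OF that] n by simp
      then show ?thesis by (simp only: of_nat_eq_iff)
    qed
    show "(x, y) \<in> parcs X" if "C \<in> \<C>" "x \<in> C" "y \<in> C" "x \<noteq> y" for C x y
      using C[OF that(1)] that unfolding delsarte_clique_def clique_def by blast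
    show "real (b 0) = m * real n" using n(1) m0 by simp
    show "\<theta>1 < real (b 0)" using dr.eigval_le[of \<theta>1] eig th by fastforce
    have "4 / 5 * real (b 1) \<le> (1 - eps_star) * real (b 1)"
      by (rule mult_right_mono[OF eps_star_bound]) simp
    then show "\<theta>1 + 1 > 4 / 5 * real (b 1)" using assms(7) by linarith
    show "\<exists>v\<in>?V. \<forall>x y. (v, x) \<in> parcs X \<longrightarrow> (v, y) \<in> parcs X \<longrightarrow>
        (\<lambda>p q. (v, p) \<in> parcs X \<and> (v, q) \<in> parcs X \<and> (p, q) \<in> parcs X)\<^sup>*\<^sup>* x y"
      using assms(9) neighborhood_connected[OF pg] by blast
  qed (fact CV, fact ex1, fact n(2), fact m0, use mS th eig km in simp_all)
  obtain \<phi> where p: "bij_betw \<phi> {A. A \<subseteq> {..<gd.m + n} \<and> card A = gd.m} ?V"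
    "\<And>A B. A \<subseteq> {..<gd.m + n} \<Longrightarrow> card A = gd.m \<Longrightarrow> B \<subseteq> {..<gd.m + n} \<Longrightarrow> card B = gd.m \<Longrightarrow>
      (\<phi> A, \<phi> B) \<in> parcs X \<longleftrightarrow> jadj A B" and dm: "d = gd.m"
    using gd.johnson[of "{..<gd.m + n}"] by auto
  let ?J = "johnson_graph (d + n) d"
  have JV: "pverts ?J = {A. A \<subseteq> {..<d + n} \<and> card A = d}"
    and JE: "(A, B) \<in> parcs ?J \<longleftrightarrow> A \<in> pverts ?J \<and> B \<in> pverts ?J \<and> card (A \<inter> B) + 1 = d" for A B
    by (simp_all add: johnson_graph_def Let_def)
  have bij: "bij_betw \<phi> (pverts ?J) ?V" using p(1) dm JV by simp
  let ?\<psi> = "the_inv_into (pverts ?J) \<phi>"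
  have "digraph_iso (with_proj X) (with_proj ?J)"
  proof (rule digraph_iso_of_bij)
    show "pair_wf_digraph X" by (rule pair_wf_digraph)
    show "bij_betw ?\<psi> ?V (pverts ?J)" by (rule bij_betw_the_inv_into[OF bij])
    show "A \<in> pverts ?J \<and> B \<in> pverts ?J" if "(A, B) \<in> parcs ?J" for A B using that JE by blast
    show "(?\<psi> x, ?\<psi> y) \<in> parcs ?J \<longleftrightarrow> (x, y) \<in> parcs X" if "x \<in> ?V" "y \<in> ?V" for x y
    proof -
      from that have "x \<in> \<phi> ` pverts ?J" "y \<in> \<phi> ` pverts ?J" using bij unfolding bij_betw_def by simp_all
      then obtain A B where AB: "A \<in> pverts ?J" "x = \<phi> A" "B \<in> pverts ?J" "y = \<phi> B" by blast
      have inj: "inj_on \<phi> (pverts ?J)" using bij unfolding bij_betw_def by simp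
      have "?\<psi> x = A" "?\<psi> y = B"
        using the_inv_into_f_f[OF inj AB(1)] the_inv_into_f_f[OF inj AB(3)] AB by simp_all
      moreover have "jadj A B \<longleftrightarrow> card (A \<inter> B) + 1 = d"
        by (rule jadj_iff_card) (use AB JV assms(2) in \<open>auto intro: finite_subset\<close>)
      ultimately show ?thesis using p(2)[of A B] AB JE JV dm by simp
    qed
  qed
  moreover have "real (d + n) = real (b 0) / real d + real d"
    using gd.m_t n(1) dm by simp
  moreover have "d + n \<ge> 2 * d + 1"
  proof -
    have "2 * d \<le> d ^ 2" unfolding power2_eq_square using assms(2) by simp
    then show ?thesis using gd.n_ge dm assms(2) by simp
  qed
  ultimately show ?thesis by blast
qed

end
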